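(* Let $\mathcal{H}_A,\mathcal{H}_B$ be finite-dimensional Hilbert spaces and let $|\phi\rangle\langle\phi|$ be a pure state on $\mathcal{H}_A\otimes\mathcal{H}_B$, with $\rho_A=\operatorname{Tr}_B|\phi\rangle\langle\phi|$ and $\rho_B=\operatorname{Tr}_A|\phi\rangle\langle\phi|$. Define $$C(|\phi\rangle\langle\phi|):=\sup\left\{\liminf_{n\to\infty}\frac1n\log\frac{M_n}{N_n}\ \middle|\ \exists\ \text{codes }\Phi^{(n)}=(M_n,N_n,C^{(n)}_\bullet,X^{(n)})\text{ for }|\phi\rangle\langle\phi|^{\otimes n}\ (n\ge1)\text{ such that }\mathrm{E}[\Phi^{(n)}]\to 0\right\},$$ where codes and the error probability $\mathrm{E}$ are as defined in the context. Then $$C(|\phi\rangle\langle\phi|)=H(\rho_B)=H(\rho_A).$$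
   Context: $\mathcal{S}(\mathcal{H})$ denotes the set of density operators on $\mathcal{H}$; $H(\rho)=-\operatorname{Tr}\rho\log\rho$, with the same base of logarithm throughout. A (dense coding) code for $|\phi\rangle\langle\phi|^{\otimes n}$ is a quadruple $\Phi^{(n)}=(M_n,N_n,C^{(n)}_\bullet,X^{(n)})$ consisting of: a positive integer $M_n$ (number of classical messages); a positive integer $N_n$ (dimension of the quantum system sent); an encoding $i\mapsto C^{(n)}_i$, $i\in\{1,\dots,M_n\}$, where each $C^{(n)}_i$ is a completely positive map taking $\mathcal{S}(\mathcal{H}_A^{\otimes n})$ to $\mathcal{S}(\mathbb{C}^{N_n})$ (hence trace preserving); and a decoding POVM $X^{(n)}=\{X^{(n)}_i\}_{i=1}^{M_n}$ on $\mathbb{C}^{N_n}\otimes\mathcal{H}_B^{\otimes n}$. Its average error probability is $$\mathrm{E}[\Phi^{(n)}]=\frac1{M_n}\sum_{i=1}^{M_n}\operatorname{Tr}\,(C^{(n)}_i\otimes I)(|\phi\rangle\langle\phi|^{\otimes n})\,(I-X^{(n)}_i),$$ where $C^{(n)}_i\otimes I$ acts as $C_i^{(n)}$ on $\mathcal{H}_A^{\otimes n}$ and as the identity map on $\mathcal{H}_B^{\otimes n}$. *)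

theory Defs
  imports
    "Jordan_Normal_Form.Schur_Decomposition"
    "HOL-Library.Extended_Real"
    "HOL-Library.Liminf_Limsup"
begin

text \<open>
  A Hilbert space of dimension \<open>d\<close> is modelled by \<open>\<complex>\<^sup>d\<close> with its standard orthonormal basis
  \<open>e\<^sub>0, \<dots>, e\<^sub>d\<^sub>-\<^sub>1\<close>, and operators on it by \<open>d \<times> d\<close> complex matrices.
  The basis vector \<open>e\<^sub>a \<otimes> e\<^sub>b\<close> of \<open>\<complex>\<^sup>d \<otimes> \<complex>\<^sup>k\<close> has index \<open>a * k + b\<close>.
\<close>

definition mtrace :: "complex mat \<Rightarrow> complex" where
  "mtrace A = (\<Sum>i<dim_row A. A $$ (i, i))"

text \<open>
  The order on the complex numbers is the one of \<open>Complex_Order\<close>: \<open>0 \<le> z\<close> means that \<open>z\<close> is real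
  and nonnegative. Hence the condition below includes self-adjointness.
\<close>

definition psd :: "nat \<Rightarrow> complex mat \<Rightarrow> bool" where
  "psd d A \<longleftrightarrow> A \<in> carrier_mat d d \<and> (\<forall>v \<in> carrier_vec d. 0 \<le> (A *\<^sub>v v) \<bullet>c v)"

definition density_op :: "nat \<Rightarrow> complex mat \<Rightarrow> bool" where
  "density_op d A \<longleftrightarrow> psd d A \<and> mtrace A = 1"

definition pure_state :: "complex vec \<Rightarrow> complex mat" where
  "pure_state \<phi> = mat (dim_vec \<phi>) (dim_vec \<phi>) (\<lambda>(i, j). \<phi> $ i * cnj (\<phi> $ j))"

definition ptrace_B :: "nat \<Rightarrow> nat \<Rightarrow> complex mat \<Rightarrow> complex mat" where
  "ptrace_B dA dB A = mat dA dA (\<lambda>(i, j). \<Sum>b<dB. A $$ (i * dB + b, j * dB + b))"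

definition ptrace_A :: "nat \<Rightarrow> nat \<Rightarrow> complex mat \<Rightarrow> complex mat" where
  "ptrace_A dA dB A = mat dB dB (\<lambda>(i, j). \<Sum>a<dA. A $$ (a * dB + i, a * dB + j))"

text \<open>
  Functional calculus for a self-adjoint matrix. A spectral decomposition exists and \<open>B\<close> does not
  depend on which one is used.
\<close>

definition mat_fun :: "(real \<Rightarrow> real) \<Rightarrow> complex mat \<Rightarrow> complex mat" where
  "mat_fun f A = (SOME B. \<exists>U l. U \<in> carrier_mat (dim_row A) (dim_row A)
      \<and> mat_adjoint U * U = 1\<^sub>m (dim_row A)
      \<and> A = U * mat_diag (dim_row A) (\<lambda>i. complex_of_real (l i)) * mat_adjoint U
      \<and> B = U * mat_diag (dim_row A) (\<lambda>i. complex_of_real (f (l i))) * mat_adjoint U)"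

text \<open>
  The value of \<open>log b 0\<close> is irrelevant: on the kernel of \<open>\<rho>\<close> it is multiplied by the eigenvalue \<open>0\<close>,
  which gives the usual convention \<open>0 log 0 = 0\<close>.
\<close>

definition vn_entropy :: "real \<Rightarrow> complex mat \<Rightarrow> real" where
  "vn_entropy b \<rho> = - Re (mtrace (\<rho> * mat_fun (log b) \<rho>))"

text \<open>
  The basis of the \<open>n\<close>-fold tensor power of \<open>\<complex>\<^sup>d\<close> is indexed by \<open>i < d ^ n\<close>; the \<open>k\<close>-th tensor
  factor carries the \<open>k\<close>-th base-\<open>d\<close> digit of \<open>i\<close>.
\<close>

definition digit :: "nat \<Rightarrow> nat \<Rightarrow> nat \<Rightarrow> nat" where
  "digit d k i = (i div d ^ k) mod d"

text \<open>
  The \<open>n\<close>-fold tensor power of an operator \<open>A\<close> on \<open>H\<^sub>A \<otimes> H\<^sub>B\<close>, where \<open>H\<^sub>A\<close> and \<open>H\<^sub>B\<close> have dimensions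
  \<open>dA\<close> and \<open>dB\<close>, with the factors reordered so that the result acts on the \<open>n\<close>-fold tensor power of
  \<open>H\<^sub>A\<close> tensored with the \<open>n\<close>-fold tensor power of \<open>H\<^sub>B\<close>: its entry at row
  \<open>(a\<^sub>k)\<^sub>k, (b\<^sub>k)\<^sub>k\<close> and column \<open>(a'\<^sub>k)\<^sub>k, (b'\<^sub>k)\<^sub>k\<close> is the product over \<open>k\<close> of the entries of \<open>A\<close>
  at \<open>(a\<^sub>k, b\<^sub>k), (a'\<^sub>k, b'\<^sub>k)\<close>.
\<close>

definition pair_digit :: "nat \<Rightarrow> nat \<Rightarrow> nat \<Rightarrow> nat \<Rightarrow> nat \<Rightarrow> nat" where
  "pair_digit dA dB n k i = digit dA k (i div dB ^ n) * dB + digit dB k (i mod dB ^ n)"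

definition bipartite_tensor_power :: "nat \<Rightarrow> nat \<Rightarrow> nat \<Rightarrow> complex mat \<Rightarrow> complex mat" where
  "bipartite_tensor_power dA dB n A = mat (dA ^ n * dB ^ n) (dA ^ n * dB ^ n)
     (\<lambda>(i, j). \<Prod>k<n. A $$ (pair_digit dA dB n k i, pair_digit dA dB n k j))"

definition linear_op_map :: "nat \<Rightarrow> nat \<Rightarrow> (complex mat \<Rightarrow> complex mat) \<Rightarrow> bool" where
  "linear_op_map d N C \<longleftrightarrow>
     (\<forall>X \<in> carrier_mat d d. C X \<in> carrier_mat N N) \<and>
     (\<forall>X \<in> carrier_mat d d. \<forall>Y \<in> carrier_mat d d. C (X + Y) = C X + C Y) \<and>
     (\<forall>X \<in> carrier_mat d d. \<forall>c. C (c \<cdot>\<^sub>m X) = c \<cdot>\<^sub>m C X)"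

text \<open>
  \<open>C \<otimes> I\<close>, where \<open>C\<close> maps operators on \<open>\<complex>\<^sup>d\<close> to operators on \<open>\<complex>\<^sup>N\<close> and \<open>I\<close> is the identity map
  on operators on \<open>\<complex>\<^sup>k\<close>. Writing \<open>X\<close> as the sum over \<open>b, b' < k\<close> of \<open>X\<^sub>b\<^sub>b\<^sub>' \<otimes> |b\<rangle>\<langle>b'|\<close> with
  \<open>X\<^sub>b\<^sub>b\<^sub>' = op_block d k X b b'\<close>, the result is the sum of \<open>C X\<^sub>b\<^sub>b\<^sub>' \<otimes> |b\<rangle>\<langle>b'|\<close>.
\<close>

definition op_block :: "nat \<Rightarrow> nat \<Rightarrow> complex mat \<Rightarrow> nat \<Rightarrow> nat \<Rightarrow> complex mat" where
  "op_block d k X b b' = mat d d (\<lambda>(i, j). X $$ (i * k + b, j * k + b'))"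

definition tensor_id ::
    "nat \<Rightarrow> nat \<Rightarrow> nat \<Rightarrow> (complex mat \<Rightarrow> complex mat) \<Rightarrow> complex mat \<Rightarrow> complex mat" where
  "tensor_id d N k C X = mat (N * k) (N * k)
     (\<lambda>(i, j). C (op_block d k X (i mod k) (j mod k)) $$ (i div k, j div k))"

definition completely_positive :: "nat \<Rightarrow> nat \<Rightarrow> (complex mat \<Rightarrow> complex mat) \<Rightarrow> bool" where
  "completely_positive d N C \<longleftrightarrow> linear_op_map d N C \<and>
     (\<forall>k. \<forall>X. psd (d * k) X \<longrightarrow> psd (N * k) (tensor_id d N k C X))"

definition is_povm :: "nat \<Rightarrow> nat \<Rightarrow> (nat \<Rightarrow> complex mat) \<Rightarrow> bool" where
  "is_povm d M X \<longleftrightarrow> (\<forall>i \<in> {1..M}. psd d (X i)) \<and>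
     mat d d (\<lambda>(r, c). \<Sum>i \<in> {1..M}. X i $$ (r, c)) = 1\<^sub>m d"

record dc_code =
  num_msgs :: nat
  qdim :: nat
  enc :: "nat \<Rightarrow> complex mat \<Rightarrow> complex mat"
  dec :: "nat \<Rightarrow> complex mat"

definition is_code :: "nat \<Rightarrow> nat \<Rightarrow> nat \<Rightarrow> dc_code \<Rightarrow> bool" where
  "is_code dA dB n \<Phi> \<longleftrightarrow> num_msgs \<Phi> > 0 \<and> qdim \<Phi> > 0 \<and>
     (\<forall>i \<in> {1..num_msgs \<Phi>}. completely_positive (dA ^ n) (qdim \<Phi>) (enc \<Phi> i) \<and>
        (\<forall>\<sigma>. density_op (dA ^ n) \<sigma> \<longrightarrow> density_op (qdim \<Phi>) (enc \<Phi> i \<sigma>))) \<and>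
     is_povm (qdim \<Phi> * dB ^ n) (num_msgs \<Phi>) (dec \<Phi>)"

text \<open>The traces below are real for every code; \<open>Re\<close> only adjusts the type.\<close>

definition avg_error :: "nat \<Rightarrow> nat \<Rightarrow> complex mat \<Rightarrow> nat \<Rightarrow> dc_code \<Rightarrow> real" where
  "avg_error dA dB \<rho> n \<Phi> = 1 / real (num_msgs \<Phi>) *
     (\<Sum>i \<in> {1..num_msgs \<Phi>}. Re (mtrace
        (tensor_id (dA ^ n) (qdim \<Phi>) (dB ^ n) (enc \<Phi> i) (bipartite_tensor_power dA dB n \<rho>)
         * (1\<^sub>m (qdim \<Phi> * dB ^ n) - dec \<Phi> i))))"

text \<open>
  Rates are taken in the extended reals, since the limes inferior can be \<open>-\<infinity>\<close> (for \<open>qdim\<close> growing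
  super-exponentially). Codes are required for \<open>n \<ge> 1\<close> only; the term for \<open>n = 0\<close> affects neither
  limit.
\<close>

definition dc_capacity :: "real \<Rightarrow> nat \<Rightarrow> nat \<Rightarrow> complex mat \<Rightarrow> ereal" where
  "dc_capacity b dA dB \<rho> = Sup {liminf (\<lambda>n. ereal (1 / real n *
        log b (real (num_msgs (\<Phi> n)) / real (qdim (\<Phi> n))))) | \<Phi>.
     (\<forall>n \<ge> 1. is_code dA dB n (\<Phi> n)) \<and> (\<lambda>n. avg_error dA dB \<rho> n (\<Phi> n)) \<longlonglongrightarrow> 0}"

end

theory Submission
  imports Defs "HOL-Real_Asymp.Real_Asymp"
begin

text \<open>
  Diagonalising \<open>\<rho>\<^sub>A\<close> gives \<open>\<phi> = \<Sum>\<^sub>m u\<^sub>m \<otimes> \<beta>\<^sub>m\<close> with \<open>u\<close> orthonormal and \<open>\<beta>\<close> orthogonal,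
  \<open>\<parallel>\<beta>\<^sub>m\<parallel>\<^sup>2 = l\<^sub>m\<close> being the eigenvalues of \<open>\<rho>\<^sub>A\<close>, and the \<open>n\<close>-fold power has the same form, indexed by
  sequences \<open>s\<close> with weights \<open>q\<^sub>s = \<Prod> l\<^sub>s\<^sub>k\<close>.

  Converse: since the encodings preserve the trace, every encoded state has the marginal \<open>\<rho>\<^sub>B\<^sup>\<otimes>\<^sup>n\<close> on the
  receiver's side, so it is almost supported on \<open>\<complex>\<^sup>N\<close> tensored with the span of the \<open>\<beta>\<^sub>s\<close>, \<open>s\<close> typical.
  That space has dimension \<open>N |T|\<close>, and there cannot be more than about \<open>N |T|\<close> distinguishable messages
  in it. No entropy inequality is needed.

  Direct part: on each level set of \<open>q\<close> the state is maximally entangled. The sender projects onto the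
  span of the typical \<open>u\<^sub>s\<close> (coherently over the level sets) and applies, in each level set of size \<open>D\<^sub>v\<close>,
  one of the \<open>D\<^sub>v\<^sup>2\<close> generalised Pauli operators. This gives \<open>N = |T|\<close> and \<open>M = min\<^sub>v D\<^sub>v\<^sup>2\<close> perfectly
  distinguishable messages up to the probability of \<open>T\<close>. There are only polynomially many level sets, so
  those with \<open>D\<^sub>v\<close> much smaller than \<open>b\<^sup>n\<^sup>H\<close> can be dropped from \<open>T\<close>.
\<close>

text \<open>The two bounds meet at \<open>H\<close> because \<open>|T|\<close> and the useful
  \<open>D_v\<close> are both about \<open>b powr (n H)\<close>: the converse limits
  \<open>M / N\<close> to a constant times \<open>|T|\<close>, and the scheme reaches
  \<open>M / N = D_v^2 / |T|\<close>. The weights of the level sets are fixed by the state and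
  differ from one level set to the next, so two messages are made orthogonal inside each level set
  separately; this is why the smallest level set limits \<open>M\<close>. Dropping small level sets
  is cheap because every typical sequence has probability at most about
  \<open>b powr - (n H)\<close>: a level set that is too small is also improbable. What the converse
  takes from an encoding is that its output is a state whose marginal at the receiver does not
  depend on the message. Cutting such a state down to the typical subspace costs constant factors,
  and these vanish once the logarithm is divided by \<open>n\<close>. The equality of the two
  entropies is separate: both reduced states come from one coefficient matrix, whose overlaps link
  their spectra.\<close>

section \<open>Quadratic forms and the spectral theorem\<close>

text \<open>Vectors are functions on the naturals of which only the values below \<open>d\<close>
  count. Positivity, norms and inner products then become finite sums, and tensor factors are
  reached by index arithmetic.\<close>

definition qform :: "nat \<Rightarrow> complex mat \<Rightarrow> (nat \<Rightarrow> complex) \<Rightarrow> complex" where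
  "qform d A v = (\<Sum>i<d. \<Sum>j<d. cnj (v i) * A $$ (i, j) * v j)"

definition sqnorm :: "nat \<Rightarrow> (nat \<Rightarrow> complex) \<Rightarrow> real" where
  "sqnorm d v = (\<Sum>i<d. (cmod (v i))\<^sup>2)"

lemma sqnorm_nonneg [simp]: "0 \<le> sqnorm d v"
  by (simp add: sqnorm_def sum_nonneg)

lemma sqnorm_sum: "complex_of_real (sqnorm d v) = (\<Sum>i<d. cnj (v i) * v i)"
  by (simp add: sqnorm_def complex_norm_square[symmetric] mult.commute del: of_real_power)

lemma qform_vec:
  assumes "A \<in> carrier_mat d d" "v \<in> carrier_vec d"
  shows "(A *\<^sub>v v) \<bullet>c v = qform d A (\<lambda>i. v $ i)"
  using assms unfolding qform_def
  by (auto simp: scalar_prod_def sum_distrib_left sum_distrib_right atLeast0LessThan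
        mult_ac intro!: sum.cong)

lemma qform_cong: "(\<And>i. i < d \<Longrightarrow> u i = v i) \<Longrightarrow> qform d A u = qform d A v"
  unfolding qform_def by (auto intro!: sum.cong)

lemma psd_iff: "psd d A \<longleftrightarrow> A \<in> carrier_mat d d \<and> (\<forall>v. 0 \<le> qform d A v)"
proof (intro iffI conjI allI)
  assume A: "psd d A"
  then show "A \<in> carrier_mat d d" by (simp add: psd_def)
  fix v
  have "0 \<le> (A *\<^sub>v vec d v) \<bullet>c vec d v" using A unfolding psd_def by auto
  also have "\<dots> = qform d A v"
    using A by (subst qform_vec[of _ d]) (auto simp: psd_def intro!: qform_cong)
  finally show "0 \<le> qform d A v" .
next
  assume "A \<in> carrier_mat d d \<and> (\<forall>v. 0 \<le> qform d A v)"
  then show "psd d A" by (auto simp: psd_def qform_vec)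
qed

lemma psd_carrier: "psd d A \<Longrightarrow> A \<in> carrier_mat d d"
  by (simp add: psd_def)

lemma psd_qform: "psd d A \<Longrightarrow> 0 \<le> qform d A v"
  by (simp add: psd_iff)

lemma sum_delta_lessThan:
  fixes f :: "nat \<Rightarrow> 'a::comm_semiring_1"
  assumes "i < n"
  shows "(\<Sum>k<n. (if k = i then 1 else 0) * f k) = f i"
    "(\<Sum>k<n. (if i = k then 1 else 0) * f k) = f i"
    "(\<Sum>k<n. f k * (if k = i then 1 else 0)) = f i"
    "(\<Sum>k<n. f k * (if i = k then 1 else 0)) = f i"
  using assms by (simp_all add: if_distrib[of "\<lambda>x. x * _"] if_distrib[of "\<lambda>x. _ * x"] cong: if_cong)

text \<open>Polarisation: \<open>qform\<close> is real at \<open>e_i\<close>, \<open>e_j\<close>,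
  \<open>e_i + e_j\<close> and \<open>e_i + \<i> e_j\<close>, and the vanishing imaginary parts
  determine both the real and the imaginary part of the difference of the two sides. The expansion
  \<open>ex\<close> also covers \<open>i = j\<close>.\<close>

lemma psd_hermitian:
  assumes "psd d A" "i < d" "j < d"
  shows "A $$ (i, j) = cnj (A $$ (j, i))"
proof -
  let ?e = "\<lambda>i k. if k = i then 1 else 0 :: complex"
  have ex: "qform d A (\<lambda>k. x * ?e i k + y * ?e j k) =
     cnj x * x * A $$ (i,i) + cnj y * y * A $$ (j,j) + cnj x * y * A $$ (i,j) + cnj y * x * A $$ (j,i)"
    for x y
  proof -
    have "qform d A (\<lambda>k. x * ?e i k + y * ?e j k) =
      (\<Sum>k<d. (\<Sum>l<d. (cnj x * x) * ?e i k * (A $$ (k,l) * ?e i l)) +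
      (\<Sum>l<d. (cnj y * y) * ?e j k * (A $$ (k,l) * ?e j l)) +
      (\<Sum>l<d. (cnj x * y) * ?e i k * (A $$ (k,l) * ?e j l)) +
      (\<Sum>l<d. (cnj y * x) * ?e j k * (A $$ (k,l) * ?e i l)))"
      unfolding qform_def sum.distrib[symmetric]
      by (intro sum.cong refl) (auto simp: algebra_simps)
    also have "\<dots> = cnj x * x * A $$ (i,i) + cnj y * y * A $$ (j,j) + cnj x * y * A $$ (i,j)
      + cnj y * x * A $$ (j,i)"
      unfolding sum_distrib_left[symmetric] sum.distrib using assms(2,3)
      by (simp only: sum_delta_lessThan mult.assoc sum_distrib_left[symmetric])
    finally show ?thesis .
  qed
  have im: "Im (qform d A v) = 0" for v
    using psd_qform[OF assms(1), of v] by (simp add: less_eq_complex_def)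
  note I = im[of "\<lambda>k. x * ?e i k + y * ?e j k" for x y, unfolded ex]
  from I[of 1 0] I[of 0 1] I[of 1 1] I[of 1 \<i>] show ?thesis
    by (auto simp: complex_eq_iff)
qed

section \<open>Unitary diagonalisation of self-adjoint matrices\<close>

lemma mat_adjoint_mat:
  "mat_adjoint A = mat (dim_col A) (dim_row A) (\<lambda>(i, j). cnj (A $$ (j, i)))" for A :: "complex mat"
  by (rule eq_matI) (auto simp: mat_adjoint_def mat_of_rows_index)

lemma mat_adjoint_carrier [simp]: "A \<in> carrier_mat n m \<Longrightarrow> mat_adjoint A \<in> carrier_mat m n"
  for A :: "complex mat"
  by (auto simp: mat_adjoint_mat)

lemma mat_adjoint_index: "i < dim_col A \<Longrightarrow> j < dim_row A \<Longrightarrow> mat_adjoint A $$ (i, j) = cnj (A $$ (j, i))"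
  for A :: "complex mat"
  by (simp add: mat_adjoint_mat)

lemma mat_adjoint_mult:
  "A \<in> carrier_mat n m \<Longrightarrow> B \<in> carrier_mat m k \<Longrightarrow> mat_adjoint (A * B) = mat_adjoint B * mat_adjoint A"
  for A B :: "complex mat"
  by (rule eq_matI) (auto simp: mat_adjoint_mat scalar_prod_def mult.commute intro!: sum.cong)

lemma mat_adjoint_adjoint: "mat_adjoint (mat_adjoint A) = A" for A :: "complex mat"
  by (rule eq_matI) (auto simp: mat_adjoint_mat)

text \<open>The reflection along \<open>w = v - e_0\<close> swaps \<open>e_0\<close> and
  \<open>v\<close>. Since \<open>v 0\<close> is real, \<open>c = 1 / (1 - v 0)\<close> is real and
  equals 2 divided by the square norm of \<open>w\<close>, which makes \<open>H\<close> unitary. If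
  \<open>v 0 = 1\<close>, then \<open>v = e_0\<close> and \<open>w\<close> would vanish, so the
  identity is taken.\<close>

lemma householder:
  fixes v :: "nat \<Rightarrow> complex"
  assumes v: "sqnorm n v = 1" and v0: "Im (v 0) = 0" and n: "0 < n"
  obtains H where "H \<in> carrier_mat n n" "mat_adjoint H * H = 1\<^sub>m n" "\<And>i. i < n \<Longrightarrow> H $$ (i, 0) = v i"
proof (cases "v 0 = 1")
  case True
  have "sqnorm n v = 1 + (\<Sum>i\<in>{..<n} - {0}. (cmod (v i))\<^sup>2)"
    unfolding sqnorm_def using n True by (subst sum.remove[of _ 0]) auto
  with v have "(\<Sum>i\<in>{..<n} - {0}. (cmod (v i))\<^sup>2) = 0" by simp
  then have "\<And>i. i < n \<Longrightarrow> i \<noteq> 0 \<Longrightarrow> v i = 0" by (subst (asm) sum_nonneg_eq_0_iff) auto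
  with True show thesis by (intro that[of "1\<^sub>m n"]) (auto simp: mat_adjoint_mat intro!: eq_matI)
next
  case False
  define c where "c = 1 / (1 - v 0)"
  define w where "w k = v k - (if k = 0 then 1 else 0)" for k
  define H where "H = mat n n (\<lambda>(i, j). (if i = j then 1 else 0) - c * w i * cnj (w j))"
  have cv0: "cnj (v 0) = v 0" using v0 by (simp add: complex_eq_iff)
  have cc: "cnj c = c" by (simp add: c_def cv0)
  have cw0: "cnj (w 0) = w 0" by (simp add: w_def cv0)
  have c0: "c * w 0 = -1" using False by (simp add: c_def w_def field_simps)
  have "(\<Sum>k<n. cnj (w k) * w k) =
    (\<Sum>k<n. cnj (v k) * v k) - (\<Sum>k<n. cnj (v k) * (if k = 0 then 1 else 0))
     - (\<Sum>k<n. v k * (if k = 0 then 1 else 0)) + (\<Sum>k<n. 1 * (if k = 0 then 1 else 0))"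
    unfolding sum_subtractf[symmetric] sum.distrib[symmetric]
    by (intro sum.cong refl) (auto simp: w_def algebra_simps)
  also have "\<dots> = 1 - v 0 - v 0 + 1"
    using n v by (simp only: sum_delta_lessThan sqnorm_sum[symmetric] cv0) simp
  finally have ww: "c * (\<Sum>k<n. cnj (w k) * w k) = 2" using False by (simp add: c_def field_simps)
  have "mat_adjoint H * H = 1\<^sub>m n"
  proof (rule eq_matI)
    fix i j assume ij: "i < dim_row (1\<^sub>m n)" "j < dim_col (1\<^sub>m n)"
    then have "(mat_adjoint H * H) $$ (i, j) =
      (\<Sum>k<n. cnj ((if k = i then 1 else 0) - c * w k * cnj (w i)) *
        ((if k = j then 1 else 0) - c * w k * cnj (w j)))"
      by (auto simp: H_def mat_adjoint_mat scalar_prod_def atLeast0LessThan intro!: sum.cong)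
    also have "\<dots> = (\<Sum>k<n. (if k = i then 1 else 0) * (if k = j then 1 else 0))
      - (\<Sum>k<n. (if k = i then 1 else 0) * (c * w k * cnj (w j)))
      - (\<Sum>k<n. c * cnj (w k) * w i * (if k = j then 1 else 0))
      + c * w i * cnj (w j) * (c * (\<Sum>k<n. cnj (w k) * w k))"
      unfolding sum_subtractf[symmetric] sum.distrib[symmetric] sum_distrib_left
      by (intro sum.cong refl) (auto simp: algebra_simps cc)
    also have "\<dots> = (if i = j then 1 else 0)"
      unfolding ww using ij by (simp add: sum_delta_lessThan)
    finally show "(mat_adjoint H * H) $$ (i, j) = 1\<^sub>m n $$ (i, j)" using ij by simp
  qed (auto simp: H_def mat_adjoint_mat)
  moreover have "H $$ (i, 0) = v i" if "i < n" for i
  proof -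
    have "H $$ (i, 0) = (if i = 0 then 1 else 0) - c * w 0 * w i"
      using that n cw0 by (simp add: H_def mult_ac)
    then show ?thesis unfolding c0 by (simp add: w_def)
  qed
  ultimately show thesis by (intro that[of H]) (auto simp: H_def)
qed

lemma complex_mat_eigenvector:
  assumes A: "A \<in> carrier_mat n n" and n: "0 < n"
  obtains k v where "sqnorm n v = 1" "Im (v 0) = 0"
    "\<And>i. i < n \<Longrightarrow> (\<Sum>j<n. A $$ (i, j) * v j) = k * v i"
proof -
  from degree_monic_char_poly[OF A] n have "degree (char_poly A) \<noteq> 0" by simp
  then have "\<exists>k. poly (char_poly A) k = 0"
    using fundamental_theorem_of_algebra_alt[of "char_poly A"]
    by (metis degree_pCons_0)
  then obtain k where "eigenvalue A k" using eigenvalue_root_char_poly[OF A] by blast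
  then obtain x where "eigenvector A x k" by (auto simp: eigenvalue_def)
  then have x: "x \<in> carrier_vec n" "x \<noteq> 0\<^sub>v n" "A *\<^sub>v x = k \<cdot>\<^sub>v x"
    using A by (auto simp: eigenvector_def)
  define r where "r = sqnorm n (($) x)"
  from x obtain i where i: "i < n" "x $ i \<noteq> 0" by (metis carrier_vecD eq_vecI index_zero_vec(1,2))
  then have "(cmod (x $ i))\<^sup>2 \<le> r"
    unfolding r_def sqnorm_def by (intro member_le_sum) auto
  with i have r: "0 < r" by (smt (verit) zero_less_norm_iff zero_less_power)
  \<comment> \<open>The modulus normalises; the phase turns entry 0 into a nonnegative real, the
    shape that \<open>householder\<close> asks for.\<close>
  define z where "z = (if x $ 0 = 0 then 1 else cnj (sgn (x $ 0))) / sqrt r"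
  have mz: "cmod z ^ 2 = 1 / r" using r
    by (auto simp: z_def norm_divide norm_sgn power_divide)
  show thesis
  proof (rule that[of "\<lambda>i. z * x $ i" k])
    show "sqnorm n (\<lambda>i. z * x $ i) = 1"
    proof -
      have "sqnorm n (\<lambda>i. z * x $ i) = (cmod z)\<^sup>2 * r"
        by (simp add: sqnorm_def norm_mult power_mult_distrib sum_distrib_left r_def)
      with r mz show ?thesis by simp
    qed
    have "cnj y * y = of_real ((cmod y)\<^sup>2)" for y
      by (simp add: complex_norm_square mult.commute del: of_real_power)
    then show "Im (z * x $ 0) = 0" by (auto simp: z_def sgn_eq mult_ac)
    fix i assume "i < n"
    have "(A *\<^sub>v x) $ i = (k \<cdot>\<^sub>v x) $ i" by (simp add: x)
    then have *: "(\<Sum>j<n. A $$ (i, j) * x $ j) = k * x $ i"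
      using \<open>i < n\<close> A x(1) by (auto simp: scalar_prod_def atLeast0LessThan)
    have "(\<Sum>j<n. A $$ (i, j) * (z * x $ j)) = z * (\<Sum>j<n. A $$ (i, j) * x $ j)"
      by (simp add: sum_distrib_left mult_ac)
    with * show "(\<Sum>j<n. A $$ (i, j) * (z * x $ j)) = k * (z * x $ i)" by simp
  qed
qed

lemma four_block_diag_mult:
  fixes A B C D :: "complex mat"
  assumes "A \<in> carrier_mat m m" "C \<in> carrier_mat m m" "B \<in> carrier_mat n n" "D \<in> carrier_mat n n"
  shows "four_block_mat A (0\<^sub>m m n) (0\<^sub>m n m) B * four_block_mat C (0\<^sub>m m n) (0\<^sub>m n m) D
    = four_block_mat (A * C) (0\<^sub>m m n) (0\<^sub>m n m) (B * D)"
  by (subst mult_four_block_mat[of _ m m _ n _ n _ _ m _ n])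
    (use assms in \<open>simp_all add: left_mult_zero_mat[of _ m] right_mult_zero_mat[of _ _ m]
      left_mult_zero_mat[of _ n] right_mult_zero_mat[of _ _ n] right_add_zero_mat[of _ m m]
        left_add_zero_mat[of _ n n]
      mult_carrier_mat[of _ n n _ n] mult_carrier_mat[of _ m m _ m]\<close>)

text \<open>Deflation by induction on the dimension: conjugation with a Householder unitary whose
  first column is an eigenvector makes the first column equal to \<open>k\<close> times
  \<open>e_0\<close>. Self-adjointness then clears the first row and makes \<open>k\<close> real,
  and the induction hypothesis diagonalises the remaining block \<open>A3\<close>.\<close>

lemma spectral_theorem:
  assumes "A \<in> carrier_mat n n" "mat_adjoint A = A"
  shows "\<exists>U l. U \<in> carrier_mat n n \<and> mat_adjoint U * U = 1\<^sub>m n \<and>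
    A = U * mat_diag n (\<lambda>i. complex_of_real (l i)) * mat_adjoint U"
  using assms
proof (induction n arbitrary: A)
  case 0
  then show ?case by (intro exI[of _ "1\<^sub>m 0"]) (auto simp: mat_adjoint_mat intro!: eq_matI)
next
  case (Suc n)
  let ?N = "Suc n"
  note A = Suc.prems(1)
  obtain k v where v: "sqnorm ?N v = 1" "Im (v 0) = 0"
    and ev: "\<And>i. i < ?N \<Longrightarrow> (\<Sum>j<?N. A $$ (i, j) * v j) = k * v i"
    using complex_mat_eigenvector[OF A] by blast
  obtain H where H: "H \<in> carrier_mat ?N ?N" and HH: "mat_adjoint H * H = 1\<^sub>m ?N"
    and H0: "\<And>i. i < ?N \<Longrightarrow> H $$ (i, 0) = v i"
    using householder[OF v] by blast
  have Ha [simp]: "mat_adjoint H \<in> carrier_mat ?N ?N" using H by simp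
  have HH': "H * mat_adjoint H = 1\<^sub>m ?N"
    using mat_mult_left_right_inverse[OF Ha H HH] .
  define A' where "A' = mat_adjoint H * (A * H)"
  have A': "A' \<in> carrier_mat ?N ?N" using H A Ha unfolding A'_def by (meson mult_carrier_mat)
  have herm: "mat_adjoint A' = A'"
    using H A Suc.prems(2)
    by (simp add: A'_def mat_adjoint_mult[of _ ?N ?N _ ?N] mat_adjoint_adjoint assoc_mult_mat[of _ ?N ?N
      _ ?N _ ?N])
  have col0: "A' $$ (i, 0) = (if i = 0 then k else 0)" if "i < ?N" for i
  proof -
    have AH: "(A * H) $$ (j, 0) = k * H $$ (j, 0)" if "j < ?N" for j
      using that ev[of j] A H H0 by (simp add: scalar_prod_def atLeast0LessThan)
    have "A' $$ (i, 0) = (\<Sum>j<?N. mat_adjoint H $$ (i, j) * (A * H) $$ (j, 0))"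
      using that A H unfolding A'_def
      by (subst index_mult_mat) (auto simp: scalar_prod_def atLeast0LessThan mat_adjoint_mat
        simp del: sum.lessThan_Suc)
    also have "\<dots> = k * (\<Sum>j<?N. mat_adjoint H $$ (i, j) * H $$ (j, 0))"
      unfolding sum_distrib_left by (intro sum.cong refl) (simp add: AH mult_ac)
    also have "(\<Sum>j<?N. mat_adjoint H $$ (i, j) * H $$ (j, 0)) = (mat_adjoint H * H) $$ (i, 0)"
      using that H by (subst index_mult_mat) (auto
        simp: scalar_prod_def atLeast0LessThan mat_adjoint_mat simp del: sum.lessThan_Suc)
    finally show ?thesis using that unfolding HH by simp
  qed
  have hij: "A' $$ (i, j) = cnj (A' $$ (j, i))" if "i < ?N" "j < ?N" for i j
    using mat_adjoint_index[of i A' j] A' that unfolding herm by auto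
  have row0: "A' $$ (0, i) = (if i = 0 then k else 0)" if "i < ?N" for i
    using hij[of 0 i] col0[OF that] hij[of 0 0] col0[of 0] that by auto
  have kr: "k = complex_of_real (Re k)" using hij[of 0 0] col0[of 0] by (simp add: complex_eq_iff)
  define A3 where "A3 = mat n n (\<lambda>(i, j). A' $$ (Suc i, Suc j))"
  have A3: "A3 \<in> carrier_mat n n" by (simp add: A3_def)
  have "mat_adjoint A3 = A3"
  proof (intro eq_matI)
    fix i j assume "i < dim_row A3" "j < dim_col A3"
    then show "mat_adjoint A3 $$ (i, j) = A3 $$ (i, j)"
      using hij[of "Suc i" "Suc j"] by (simp add: A3_def mat_adjoint_mat)
  qed (auto simp: A3_def mat_adjoint_mat)
  from Suc.IH[OF A3 this] obtain U l where U: "U \<in> carrier_mat n n" "mat_adjoint U * U = 1\<^sub>m n"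
    and A3U: "A3 = U * mat_diag n (\<lambda>i. complex_of_real (l i)) * mat_adjoint U" by blast
  have Ua: "mat_adjoint U \<in> carrier_mat n n" using U by simp
  define V where "V = four_block_mat (1\<^sub>m 1) (0\<^sub>m 1 n) (0\<^sub>m n 1) U"
  define m where "m i = (case i of 0 \<Rightarrow> Re k | Suc j \<Rightarrow> l j)" for i
  define D where "D = mat_diag ?N (\<lambda>i. complex_of_real (m i))"
  have V: "V \<in> carrier_mat ?N ?N" using U unfolding V_def
    by (metis four_block_carrier_mat one_carrier_mat plus_1_eq_Suc)
  have D: "D \<in> carrier_mat ?N ?N" by (simp add: D_def)
  have Va: "mat_adjoint V = four_block_mat (1\<^sub>m 1) (0\<^sub>m 1 n) (0\<^sub>m n 1) (mat_adjoint U)"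
    using U by (intro eq_matI) (auto simp: V_def mat_adjoint_mat Let_def)
  have Dd: "D = four_block_mat (mat 1 1 (\<lambda>_. k)) (0\<^sub>m 1 n) (0\<^sub>m n 1) (mat_diag n (\<lambda>i. complex_of_real (l i)))"
    by (intro eq_matI) (auto simp: D_def m_def mat_diag_def Let_def kr[symmetric] split: nat.splits)
  have VV: "mat_adjoint V * V = 1\<^sub>m ?N"
  proof -
    have "mat_adjoint V * V = four_block_mat (1\<^sub>m 1) (0\<^sub>m 1 n) (0\<^sub>m n 1) (1\<^sub>m n)"
      unfolding Va unfolding V_def
      by (subst four_block_diag_mult[OF _ _ Ua U(1)]) (simp_all add: U(2) one_carrier_mat)
    also have "\<dots> = 1\<^sub>m ?N" by (intro eq_matI) (auto simp: Let_def)
    finally show ?thesis .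
  qed
  have A'V: "A' = V * D * mat_adjoint V"
  proof -
    have "V * D = four_block_mat (1\<^sub>m 1 * mat 1 1 (\<lambda>_. k)) (0\<^sub>m 1 n) (0\<^sub>m n 1) (U
      * mat_diag n (\<lambda>i. complex_of_real (l i)))"
      unfolding Dd V_def by (rule four_block_diag_mult) (use U in auto)
    then have "V * D * mat_adjoint V = four_block_mat (1\<^sub>m 1 * mat 1 1 (\<lambda>_. k) * 1\<^sub>m 1) (0\<^sub>m 1 n) (0\<^sub>m n 1) A3"
      unfolding Va A3U using U Ua by (subst four_block_diag_mult[symmetric])
        (auto simp: mult_carrier_mat[of _ n n])
    then have "V * D * mat_adjoint V = four_block_mat (mat 1 1 (\<lambda>_. k)) (0\<^sub>m 1 n) (0\<^sub>m n 1) A3"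
      by (simp add: right_mult_one_mat[of _ 1 1] left_mult_one_mat[of _ 1 1])
    also have "\<dots> = A'"
      using A' row0 col0 by (intro eq_matI) (auto simp: A3_def Let_def)
    finally show ?thesis by simp
  qed
  have VaC: "mat_adjoint V \<in> carrier_mat ?N ?N" using V by simp
  note asc = assoc_mult_mat[of _ ?N ?N _ ?N _ ?N] mult_carrier_mat[of _ ?N ?N _ ?N]
  have HVa: "mat_adjoint (H * V) = mat_adjoint V * mat_adjoint H"
    using H V by (rule mat_adjoint_mult)
  have "mat_adjoint (H * V) * (H * V) = mat_adjoint V * (mat_adjoint H * H) * V"
    unfolding HVa using H V VaC Ha by (simp only: asc)
  also have "\<dots> = mat_adjoint V * V" unfolding HH using VaC by simp
  finally have un: "mat_adjoint (H * V) * (H * V) = 1\<^sub>m ?N" unfolding VV .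
  have "(H * mat_adjoint H) * A * (H * mat_adjoint H) = A"
    unfolding HH' using A left_mult_one_mat[OF A] right_mult_one_mat[OF A] by (simp only:)
  then have "A = (H * mat_adjoint H) * A * (H * mat_adjoint H)" ..
  also have "\<dots> = H * A' * mat_adjoint H"
    unfolding A'_def using H A Ha by (simp only: asc)
  also have "\<dots> = (H * V) * D * mat_adjoint (H * V)"
    unfolding A'V HVa using H V VaC Ha D by (simp only: asc)
  finally have "A = (H * V) * D * mat_adjoint (H * V)" .
  then show ?case using un H V unfolding D_def
    by (intro exI[of _ "H * V"] exI[of _ m] conjI mult_carrier_mat[of _ ?N ?N])
qed

text \<open>Entrywise form, with \<open>u k\<close> the eigenvector for \<open>l k\<close>.
  Orthonormality and completeness are both recorded, so that either Kronecker delta is at hand when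
  sums are contracted.\<close>

definition spectral_decomp :: "nat \<Rightarrow> complex mat \<Rightarrow> (nat \<Rightarrow> nat \<Rightarrow> complex) \<Rightarrow> (nat \<Rightarrow> real) \<Rightarrow> bool" where
  "spectral_decomp n A u l \<longleftrightarrow>
    (\<forall>i<n. \<forall>j<n. (\<Sum>k<n. cnj (u i k) * u j k) = (if i = j then 1 else 0)) \<and>
    (\<forall>i<n. \<forall>j<n. (\<Sum>k<n. u k i * cnj (u k j)) = (if i = j then 1 else 0)) \<and>
    (\<forall>i<n. \<forall>j<n. A $$ (i, j) = (\<Sum>k<n. u k i * complex_of_real (l k) * cnj (u k j)))"

lemma spectral_decompI:
  assumes U: "U \<in> carrier_mat n n" and UU: "mat_adjoint U * U = 1\<^sub>m n"
    and A: "A = U * mat_diag n (\<lambda>i. complex_of_real (l i)) * mat_adjoint U"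
  shows "spectral_decomp n A (\<lambda>k i. U $$ (i, k)) l"
proof -
  have Ua: "mat_adjoint U \<in> carrier_mat n n" using U by simp
  have UU': "U * mat_adjoint U = 1\<^sub>m n" using mat_mult_left_right_inverse[OF Ua U UU] .
  show ?thesis unfolding spectral_decomp_def
  proof (intro conjI allI impI)
    fix i j assume ij: "i < n" "j < n"
    have "(mat_adjoint U * U) $$ (i, j) = (\<Sum>k<n. cnj (U $$ (k, i)) * U $$ (k, j))"
      using ij U by (subst index_mult_mat) (auto simp: scalar_prod_def mat_adjoint_mat atLeast0LessThan)
    then show "(\<Sum>k<n. cnj (U $$ (k, i)) * U $$ (k, j)) = (if i = j then 1 else 0)"
      using ij by (simp add: UU)
    have "(U * mat_adjoint U) $$ (i, j) = (\<Sum>k<n. U $$ (i, k) * cnj (U $$ (j, k)))"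
      using ij U by (subst index_mult_mat) (auto simp: scalar_prod_def mat_adjoint_mat atLeast0LessThan)
    then show "(\<Sum>k<n. U $$ (i, k) * cnj (U $$ (j, k))) = (if i = j then 1 else 0)"
      using ij by (simp add: UU')
    show "A $$ (i, j) = (\<Sum>k<n. U $$ (i, k) * complex_of_real (l k) * cnj (U $$ (j, k)))"
      unfolding A mat_diag_mult_right[OF U] using ij U
      by (subst index_mult_mat) (auto simp: scalar_prod_def mat_adjoint_mat atLeast0LessThan)
  qed
qed

text \<open>\<open>mat_fun\<close> picks its decomposition by \<open>SOME\<close>. Opening that
  choice yields one pair \<open>U\<close>, \<open>l\<close> for both the matrix and its logarithm,
  and the trace is evaluated in exactly this pair.\<close>

lemma vn_entropy_spectral:
  assumes A: "A \<in> carrier_mat n n" "mat_adjoint A = A"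
  obtains u l where "spectral_decomp n A u l" "vn_entropy b A = - (\<Sum>i<n. l i * log b (l i))"
proof -
  have dr: "dim_row A = n" using A by simp
  have "\<exists>B U l. U \<in> carrier_mat n n \<and> mat_adjoint U * U = 1\<^sub>m n
      \<and> A = U * mat_diag n (\<lambda>i. complex_of_real (l i)) * mat_adjoint U
      \<and> B = U * mat_diag n (\<lambda>i. complex_of_real (log b (l i))) * mat_adjoint U"
    using spectral_theorem[OF A] by blast
  from someI_ex[OF this] obtain U l where U: "U \<in> carrier_mat n n" "mat_adjoint U * U = 1\<^sub>m n"
    and AU: "A = U * mat_diag n (\<lambda>i. complex_of_real (l i)) * mat_adjoint U"
    and BU: "mat_fun (log b) A = U * mat_diag n (\<lambda>i. complex_of_real (log b (l i))) * mat_adjoint U"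
    unfolding mat_fun_def dr by blast
  have Ua: "mat_adjoint U \<in> carrier_mat n n" using U by simp
  note dc = spectral_decompI[OF U AU]
  let ?D = "\<lambda>f. mat_diag n (\<lambda>i. complex_of_real (f i))"
  let ?g = "\<lambda>i. l i * log b (l i)"
  have "A * mat_fun (log b) A = U * ?D l * (mat_adjoint U * U) * (?D (\<lambda>i. log b (l i))) * mat_adjoint U"
    by (subst AU, unfold BU) (use U(1) Ua in
      \<open>simp add: assoc_mult_mat[of _ n n _ n _ n] mult_carrier_mat[of _ n n _ n]\<close>)
  also have "\<dots> = U * (?D l * ?D (\<lambda>i. log b (l i))) * mat_adjoint U"
    unfolding U using U(1) Ua by (simp add: assoc_mult_mat[of _ n n _ n _ n] right_mult_one_mat[of _ n
      n] del: mat_diag_diag)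
  also have "\<dots> = U * ?D ?g * mat_adjoint U" by (simp del: of_real_mult add: of_real_mult[symmetric])
  finally have eq: "A * mat_fun (log b) A = U * ?D ?g * mat_adjoint U" .
  note dg = spectral_decompI[OF U eq]
  have "mtrace (A * mat_fun (log b) A) = (\<Sum>i<n. \<Sum>k<n. U $$ (i, k) * complex_of_real (?g k) * cnj (U $$ (i, k)))"
    unfolding mtrace_def using A dg by (auto simp: spectral_decomp_def intro!: sum.cong)
  also have "\<dots> = (\<Sum>k<n. complex_of_real (?g k) * (\<Sum>i<n. cnj (U $$ (i, k)) * U $$ (i, k)))"
    by (subst sum.swap) (simp add: sum_distrib_left mult_ac)
  also have "\<dots> = (\<Sum>k<n. complex_of_real (?g k))"
    using dc by (auto simp: spectral_decomp_def intro!: sum.cong)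
  finally have "vn_entropy b A = - (\<Sum>i<n. ?g i)" unfolding vn_entropy_def by simp
  with dc show thesis using that by blast
qed

section \<open>Schmidt decomposition and equality of the two entropies\<close>

lemma sum_rotate:
  "(\<Sum>a\<in>A. \<Sum>b\<in>B. \<Sum>c\<in>C. f a b c) = (\<Sum>b\<in>B. \<Sum>c\<in>C. \<Sum>a\<in>A. f a b c)"
  by (subst sum.swap) (intro sum.cong refl, rule sum.swap)

text \<open>\<open>T\<close> is the coefficient matrix of a bipartite vector and \<open>R\<close>
  its reduced state. The columns of \<open>T\<close> are expanded in the eigenbasis
  \<open>u\<close>; orthogonality of the coefficient vectors \<open>\<beta>\<close> expresses that
  \<open>R\<close> is diagonal in this basis.\<close>

lemma schmidt_vectors:
  fixes T :: "nat \<Rightarrow> nat \<Rightarrow> complex"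
  assumes sd: "spectral_decomp n R u l"
    and R: "\<And>i j. i < n \<Longrightarrow> j < n \<Longrightarrow> R $$ (i, j) = (\<Sum>b<m. T i b * cnj (T j b))"
  obtains \<beta> where
    "\<And>x b. x < n \<Longrightarrow> T x b = (\<Sum>k<n. u k x * \<beta> k b)"
    "\<And>i j. i < n \<Longrightarrow> j < n \<Longrightarrow> (\<Sum>b<m. cnj (\<beta> i b) * \<beta> j b) = (if i = j then complex_of_real (l i) else 0)"
proof
  note s1 = sd[unfolded spectral_decomp_def, THEN conjunct1, rule_format]
  note s2 = sd[unfolded spectral_decomp_def, THEN conjunct2, THEN conjunct1, rule_format]
  note s3 = sd[unfolded spectral_decomp_def, THEN conjunct2, THEN conjunct2, rule_format]
  define \<beta> where "\<beta> k b = (\<Sum>x<n. cnj (u k x) * T x b)" for k b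
  fix x b assume x: "x < n"
  have "(\<Sum>k<n. u k x * \<beta> k b) = (\<Sum>y<n. (\<Sum>k<n. u k x * cnj (u k y)) * T y b)"
    unfolding \<beta>_def sum_distrib_left sum_distrib_right by (subst sum.swap) (simp add: mult_ac)
  also have "\<dots> = (\<Sum>y<n. (if x = y then 1 else 0) * T y b)"
    using x by (intro sum.cong refl) (simp add: s2)
  finally show "T x b = (\<Sum>k<n. u k x * (\<Sum>x<n. cnj (u k x) * T x b))" 
    using x unfolding \<beta>_def by (simp add: sum_delta_lessThan)
next
  note s1 = sd[unfolded spectral_decomp_def, THEN conjunct1, rule_format]
  note s3 = sd[unfolded spectral_decomp_def, THEN conjunct2, THEN conjunct2, rule_format]
  fix i j assume ij: "i < n" "j < n"
  have "(\<Sum>b<m. cnj (\<Sum>x<n. cnj (u i x) * T x b) * (\<Sum>x<n. cnj (u j x) * T x b))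
    = (\<Sum>b<m. \<Sum>y<n. \<Sum>x<n. u i y * cnj (u j x) * (T x b * cnj (T y b)))"
    unfolding cnj_sum sum_product by (simp add: mult_ac)
  also have "\<dots> = (\<Sum>y<n. \<Sum>x<n. u i y * cnj (u j x) * (\<Sum>b<m. T x b * cnj (T y b)))"
    unfolding sum_distrib_left by (rule sum_rotate)
  also have "\<dots> = (\<Sum>y<n. \<Sum>x<n. \<Sum>k<n. u i y * cnj (u j x) * (u k x * complex_of_real (l k) * cnj (u k y)))"
    unfolding sum_distrib_left[symmetric] by (intro sum.cong refl) (simp add: R[symmetric] s3)
  also have "\<dots> = (\<Sum>k<n. complex_of_real (l k) * (\<Sum>y<n. cnj (u k y) * u i y) * (\<Sum>x<n. cnj (u j x) * u k x))"
    unfolding mult.assoc sum_product unfolding sum_distrib_left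
    by (subst sum_rotate[symmetric]) (simp add: mult_ac)
  also have "\<dots> = (\<Sum>k<n. (if k = i then 1 else 0) * (complex_of_real (l k) * (if k = j then 1 else 0)))"
    using ij by (intro sum.cong refl) (auto simp: s1)
  also have "\<dots> = (if i = j then complex_of_real (l i) else 0)"
    using ij by (subst sum_delta_lessThan) auto
  finally show "(\<Sum>b<m. cnj (\<Sum>x<n. cnj (u i x) * T x b) * (\<Sum>x<n. cnj (u j x) * T x b))
    = (if i = j then complex_of_real (l i) else 0)" .
qed

text \<open>No bijection between eigenvalues is built, so multiplicities and unequal numbers of
  zeros cause no trouble. The overlap \<open>S k j\<close> of \<open>\<beta> k\<close> with
  \<open>v j\<close> vanishes unless \<open>l k = r j\<close>, and the squared moduli have row sums
  \<open>l\<close> and column sums \<open>r\<close>. Hence \<open>h (l k)\<close> can be replaced by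
  \<open>h (r j)\<close> inside a double sum.\<close>

lemma schmidt_spectra:
  fixes T :: "nat \<Rightarrow> nat \<Rightarrow> complex" and h :: "real \<Rightarrow> real"
  assumes A: "spectral_decomp n A u l" "\<And>i j. i < n \<Longrightarrow> j < n \<Longrightarrow> A $$ (i, j) = (\<Sum>b<m. T i b * cnj (T j b))"
    and B: "spectral_decomp m B v r" "\<And>i j. i < m \<Longrightarrow> j < m \<Longrightarrow> B $$ (i, j) = (\<Sum>a<n. T a i * cnj (T a j))"
  shows "(\<Sum>i<n. l i * h (l i)) = (\<Sum>j<m. r j * h (r j))"
proof -
  obtain \<beta> where T: "\<And>x b. x < n \<Longrightarrow> T x b = (\<Sum>k<n. u k x * \<beta> k b)"
    and \<beta>: "\<And>i j. i < n \<Longrightarrow> j < n \<Longrightarrow> (\<Sum>b<m. cnj (\<beta> i b) * \<beta> j b) = (if i = j then complex_of_real (l i) else 0)"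
    using schmidt_vectors[OF A] by blast
  note u1 = A(1)[unfolded spectral_decomp_def, THEN conjunct1, rule_format]
  note v1 = B(1)[unfolded spectral_decomp_def, THEN conjunct1, rule_format]
  note v2 = B(1)[unfolded spectral_decomp_def, THEN conjunct2, THEN conjunct1, rule_format]
  note v3 = B(1)[unfolded spectral_decomp_def, THEN conjunct2, THEN conjunct2, rule_format]
  have B\<beta>: "B $$ (i, j) = (\<Sum>k<n. \<beta> k i * cnj (\<beta> k j))" if "i < m" "j < m" for i j
  proof -
    have "B $$ (i, j) = (\<Sum>a<n. \<Sum>k<n. \<Sum>k'<n. (u k a * \<beta> k i) * cnj (u k' a * \<beta> k' j))"
      using that by (simp add: B(2) T sum_product)
    also have "\<dots> = (\<Sum>k<n. \<Sum>k'<n. (\<Sum>a<n. cnj (u k' a) * u k a) * (\<beta> k i * cnj (\<beta> k' j)))"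
      unfolding sum_distrib_right by (subst sum_rotate) (simp add: mult_ac)
    also have "\<dots> = (\<Sum>k<n. \<Sum>k'<n. (if k' = k then 1 else 0) * (\<beta> k i * cnj (\<beta> k' j)))"
      by (intro sum.cong refl) (simp add: u1)
    finally show ?thesis by (simp add: sum_delta_lessThan)
  qed
  have Bev: "(\<Sum>b'<m. B $$ (b, b') * \<beta> k b') = complex_of_real (l k) * \<beta> k b" if "b < m" "k < n" for b k
  proof -
    have "(\<Sum>b'<m. B $$ (b, b') * \<beta> k b') = (\<Sum>b'<m. \<Sum>i<n. \<beta> i b * (cnj (\<beta> i b') * \<beta> k b'))"
      using that by (intro sum.cong refl) (simp add: B\<beta> sum_distrib_left sum_distrib_right mult_ac)
    also have "\<dots> = (\<Sum>i<n. \<beta> i b * (\<Sum>b'<m. cnj (\<beta> i b') * \<beta> k b'))"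
      unfolding sum_distrib_left by (rule sum.swap)
    also have "\<dots> = (\<Sum>i<n. complex_of_real (l i) * \<beta> i b * (if i = k then 1 else 0))"
      using that by (intro sum.cong refl) (simp add: \<beta>)
    finally show ?thesis using that by (simp add: sum_delta_lessThan)
  qed
  define S where "S k j = (\<Sum>b<m. cnj (v j b) * \<beta> k b)" for k j
  \<comment> \<open>\<open>\<beta> k\<close> is an eigenvector of \<open>B\<close> by
    \<open>Bev\<close>, and \<open>v j\<close> by choice; evaluating \<open>B\<close> between them
    from either side gives the two factors.\<close>
  have comm: "complex_of_real (l k) * S k j = complex_of_real (r j) * S k j" if "k < n" "j < m" for k j
  proof -
    have "complex_of_real (l k) * S k j = (\<Sum>b<m. cnj (v j b) * (complex_of_real (l k) * \<beta> k b))"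
      by (simp add: S_def sum_distrib_left mult.left_commute)
    also have "\<dots> = (\<Sum>b<m. cnj (v j b) * (\<Sum>b'<m. B $$ (b, b') * \<beta> k b'))"
      using that by (intro sum.cong refl) (simp add: Bev)
    also have "\<dots> = (\<Sum>b<m. \<Sum>b'<m. cnj (v j b) * B $$ (b, b') * \<beta> k b')"
      by (simp add: sum_distrib_left mult.assoc)
    also have "\<dots> = (\<Sum>b'<m. (\<Sum>b<m. cnj (v j b) * B $$ (b, b')) * \<beta> k b')"
      unfolding sum_distrib_right by (rule sum.swap)
    also have "\<dots> = (\<Sum>b'<m. complex_of_real (r j) * cnj (v j b') * \<beta> k b')"
    proof (intro sum.cong refl)
      fix b' assume "b' \<in> {..<m}"
      have "(\<Sum>b<m. cnj (v j b) * B $$ (b, b')) = 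
        (\<Sum>b<m. \<Sum>i<m. (complex_of_real (r i) * cnj (v i b')) * (cnj (v j b) * v i b))"
        using \<open>b' \<in> _\<close> by (intro sum.cong refl) (simp add: v3 sum_distrib_left mult_ac)
      also have "\<dots> = (\<Sum>i<m. (complex_of_real (r i) * cnj (v i b')) * (\<Sum>b<m. cnj (v j b) * v i b))"
        unfolding sum_distrib_left by (rule sum.swap)
      also have "\<dots> = (\<Sum>i<m. (complex_of_real (r i) * cnj (v i b')) * (if j = i then 1 else 0))"
        using that by (intro sum.cong refl) (simp add: v1)
      finally show "(\<Sum>b<m. cnj (v j b) * B $$ (b, b')) * \<beta> k b' = complex_of_real (r j) * cnj (v j b') * \<beta> k b'"
        using that by (simp add: sum_delta_lessThan)
    qed
    also have "\<dots> = complex_of_real (r j) * S k j" by (simp add: S_def sum_distrib_left mult_ac)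
    finally show ?thesis .
  qed
  have row: "(\<Sum>j<m. (cmod (S k j))\<^sup>2) = l k" if "k < n" for k
  proof -
    have "complex_of_real (\<Sum>j<m. (cmod (S k j))\<^sup>2) = (\<Sum>j<m. cnj (S k j) * S k j)"
      using sqnorm_sum[of m "S k"] by (simp add: sqnorm_def)
    also have "\<dots> = (\<Sum>j<m. \<Sum>b<m. \<Sum>b'<m. (v j b * cnj (\<beta> k b)) * (cnj (v j b') * \<beta> k b'))"
      by (simp add: S_def sum_product)
    also have "\<dots> = (\<Sum>b<m. \<Sum>b'<m. (cnj (\<beta> k b) * \<beta> k b') * (\<Sum>j<m. v j b * cnj (v j b')))"
      unfolding sum_distrib_left by (subst sum_rotate) (simp add: mult_ac)
    also have "\<dots> = (\<Sum>b<m. \<Sum>b'<m. (cnj (\<beta> k b) * \<beta> k b') * (if b = b' then 1 else 0))"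
      by (intro sum.cong refl) (simp add: v2)
    also have "\<dots> = (\<Sum>b<m. cnj (\<beta> k b) * \<beta> k b)" by (simp add: sum_delta_lessThan)
    also have "\<dots> = complex_of_real (l k)" using that by (simp add: \<beta>)
    finally show ?thesis using of_real_eq_iff by blast
  qed
  have col: "(\<Sum>k<n. (cmod (S k j))\<^sup>2) = r j" if "j < m" for j
  proof -
    have "complex_of_real (\<Sum>k<n. (cmod (S k j))\<^sup>2) = (\<Sum>k<n. S k j * cnj (S k j))"
      using sqnorm_sum[of n "\<lambda>k. S k j"] by (simp add: sqnorm_def mult.commute)
    also have "\<dots> = (\<Sum>k<n. \<Sum>b<m. \<Sum>b'<m. (cnj (v j b) * \<beta> k b) * (v j b' * cnj (\<beta> k b')))"
      by (simp add: S_def sum_product)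
    also have "\<dots> = (\<Sum>b<m. \<Sum>b'<m. (cnj (v j b) * v j b') * (\<Sum>k<n. \<beta> k b * cnj (\<beta> k b')))"
      unfolding sum_distrib_left by (subst sum_rotate) (simp add: mult_ac)
    also have "\<dots> = (\<Sum>b<m. \<Sum>b'<m. \<Sum>i<m. complex_of_real (r i) * ((cnj (v j b) * v i b) * (cnj (v i b')
      * v j b')))"
      by (intro sum.cong refl) (simp add: B\<beta>[symmetric] v3 sum_distrib_left mult_ac)
    also have "\<dots> = (\<Sum>i<m. complex_of_real (r i) * ((\<Sum>b<m. cnj (v j b) * v i b) * (\<Sum>b'<m. cnj (v i b')
      * v j b')))"
      unfolding sum_product unfolding sum_distrib_left by (rule sum_rotate[symmetric])
    also have "\<dots> = (\<Sum>i<m. complex_of_real (r i) * (if j = i then 1 else 0))"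
      using that by (intro sum.cong refl) (auto simp: v1)
    also have "\<dots> = complex_of_real (r j)" using that by (simp add: sum_delta_lessThan)
    finally show ?thesis using of_real_eq_iff by blast
  qed
  have "(\<Sum>i<n. l i * h (l i)) = (\<Sum>i<n. \<Sum>j<m. (cmod (S i j))\<^sup>2 * h (l i))"
    by (simp add: row[symmetric] sum_distrib_right)
  also have "\<dots> = (\<Sum>i<n. \<Sum>j<m. (cmod (S i j))\<^sup>2 * h (r j))"
  proof (intro sum.cong refl)
    fix i j assume "i \<in> {..<n}" "j \<in> {..<m}"
    with comm[of i j] have "S i j = 0 \<or> l i = r j" by auto
    then show "(cmod (S i j))\<^sup>2 * h (l i) = (cmod (S i j))\<^sup>2 * h (r j)" by auto
  qed
  also have "\<dots> = (\<Sum>j<m. (\<Sum>i<n. (cmod (S i j))\<^sup>2) * h (r j))"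
    unfolding sum_distrib_right by (rule sum.swap)
  also have "\<dots> = (\<Sum>j<m. r j * h (r j))" by (simp add: col)
  finally show ?thesis .
qed

section \<open>Positive semidefinite matrices as sums of rank-one matrices\<close>

definition inner :: "nat \<Rightarrow> (nat \<Rightarrow> complex) \<Rightarrow> (nat \<Rightarrow> complex) \<Rightarrow> complex" where
  "inner d u v = (\<Sum>i<d. cnj (u i) * v i)"

lemma inner_self: "inner d v v = complex_of_real (sqnorm d v)"
  by (simp add: inner_def sqnorm_sum)

lemma inner_cnj: "cnj (inner d u v) = inner d v u"
  by (simp add: inner_def mult.commute)

lemma inner_mult_self: "inner d u v * inner d v u = complex_of_real ((cmod (inner d v u))\<^sup>2)"
  by (subst inner_cnj[symmetric]) (simp add: complex_norm_square mult.commute del: of_real_power)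

lemma cmod_inner_commute: "cmod (inner d u v) = cmod (inner d v u)"
  by (metis inner_cnj complex_mod_cnj)

lemma inner_add_right: "inner d u (\<lambda>i. v i + w i) = inner d u v + inner d u w"
  by (simp add: inner_def sum.distrib algebra_simps)

lemma inner_diff_right: "inner d u (\<lambda>i. v i - w i) = inner d u v - inner d u w"
  by (simp add: inner_def sum_subtractf algebra_simps)

lemma inner_diff_left: "inner d (\<lambda>i. v i - w i) u = inner d v u - inner d w u"
  by (simp add: inner_def sum_subtractf algebra_simps)

lemma inner_sum_right: "inner d u (\<lambda>i. \<Sum>k\<in>K. c k * f k i) = (\<Sum>k\<in>K. c k * inner d u (f k))"
  unfolding inner_def sum_distrib_left by (subst sum.swap) (simp add: mult_ac)

lemma inner_sum_left: "inner d (\<lambda>i. \<Sum>k\<in>K. c k * f k i) u = (\<Sum>k\<in>K. cnj (c k) * inner d (f k) u)"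
  by (subst inner_cnj[symmetric], simp add: inner_sum_right inner_cnj)

definition orthonormal_family :: "nat \<Rightarrow> 'a set \<Rightarrow> ('a \<Rightarrow> nat \<Rightarrow> complex) \<Rightarrow> bool" where
  "orthonormal_family d K f \<longleftrightarrow> (\<forall>k\<in>K. \<forall>k'\<in>K. inner d (f k) (f k') = (if k = k' then 1 else 0))"

lemma sqnorm_residual:
  assumes "orthonormal_family d K f" "finite K"
  shows "sqnorm d (\<lambda>i. w i - (\<Sum>k\<in>K. inner d (f k) w * f k i)) = sqnorm d w - (\<Sum>k\<in>K. (cmod (inner d (f k) w))\<^sup>2)"
proof -
  let ?p = "\<lambda>i. \<Sum>k\<in>K. inner d (f k) w * f k i" and ?s = "\<Sum>k\<in>K. complex_of_real ((cmod (inner d (f k) w))\<^sup>2)"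
  have wp: "inner d w ?p = ?s"
    unfolding inner_sum_right by (intro sum.cong refl) (simp only: inner_mult_self cmod_inner_commute[of d w])
  have pw: "inner d ?p w = ?s"
    by (subst inner_cnj[symmetric], subst wp) simp
  have "inner d (f k) ?p = inner d (f k) w" if "k \<in> K" for k
  proof -
    have "inner d (f k) ?p = (\<Sum>k'\<in>K. if k = k' then inner d (f k') w else 0)"
      unfolding inner_sum_right using assms(1) that
      by (intro sum.cong refl) (auto simp: orthonormal_family_def)
    also have "\<dots> = inner d (f k) w" using that assms(2) by simp
    finally show ?thesis .
  qed
  then have "inner d ?p ?p = (\<Sum>k\<in>K. cnj (inner d (f k) w) * inner d (f k) w)"
    by (simp add: inner_sum_left)
  also have "\<dots> = ?s" by (intro sum.cong refl) (simp add: complex_norm_square mult.commute del: of_real_power)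
  finally have pp: "inner d ?p ?p = ?s" .
  have "complex_of_real (sqnorm d (\<lambda>i. w i - ?p i)) = inner d w w - inner d w ?p - inner d ?p w + inner d ?p ?p"
    unfolding inner_self[symmetric] by (simp add: inner_diff_left inner_diff_right)
  also have "\<dots> = complex_of_real (sqnorm d w - (\<Sum>k\<in>K. (cmod (inner d (f k) w))\<^sup>2))"
    unfolding wp pw pp by (simp add: inner_self)
  finally show ?thesis using of_real_eq_iff by blast
qed

lemma bessel:
  assumes "orthonormal_family d K f" "finite K"
  shows "(\<Sum>k\<in>K. (cmod (inner d (f k) w))\<^sup>2) \<le> sqnorm d w"
  using sqnorm_residual[OF assms, of w] sqnorm_nonneg[of d "\<lambda>i. w i - (\<Sum>k\<in>K. inner d (f k) w * f k i)"]
  by linarith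

text \<open>A resolution of \<open>A\<close> into unnormalised rank-one terms. The index type is
  free, so that the same notion covers eigenvectors, single vectors and Kraus images indexed by
  pairs.\<close>

definition gram_of :: "nat \<Rightarrow> complex mat \<Rightarrow> 'a set \<Rightarrow> ('a \<Rightarrow> nat \<Rightarrow> complex) \<Rightarrow> bool" where
  "gram_of d A K w \<longleftrightarrow> A \<in> carrier_mat d d \<and> (\<forall>i<d. \<forall>j<d. A $$ (i, j) = (\<Sum>m\<in>K. w m i * cnj (w m j)))"

lemma qform_gram:
  assumes "gram_of d A K w"
  shows "qform d A v = complex_of_real (\<Sum>m\<in>K. (cmod (inner d (w m) v))\<^sup>2)"
proof -
  have "qform d A v = (\<Sum>i<d. \<Sum>j<d. \<Sum>m\<in>K. cnj (v i) * w m i * (cnj (w m j) * v j))"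
    unfolding qform_def using assms
    by (intro sum.cong refl) (simp add: gram_of_def sum_distrib_left sum_distrib_right mult_ac)
  also have "\<dots> = (\<Sum>m\<in>K. inner d v (w m) * inner d (w m) v)"
    unfolding inner_def sum_product by (subst sum_rotate[symmetric]) (simp add: mult_ac)
  also have "\<dots> = complex_of_real (\<Sum>m\<in>K. (cmod (inner d (w m) v))\<^sup>2)"
    unfolding of_real_sum by (intro sum.cong refl) (rule inner_mult_self)
  finally show ?thesis .
qed

lemma gram_psd: "gram_of d A K w \<Longrightarrow> psd d A"
  unfolding psd_iff
  by (auto simp: qform_gram sum_nonneg less_eq_complex_def) (simp add: gram_of_def)

lemma mtrace_gram:
  assumes "gram_of d A K w"
  shows "mtrace A = complex_of_real (\<Sum>m\<in>K. sqnorm d (w m))"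
proof -
  have "mtrace A = (\<Sum>i<d. \<Sum>m\<in>K. w m i * cnj (w m i))"
    using assms by (auto simp: mtrace_def gram_of_def intro!: sum.cong)
  also have "\<dots> = (\<Sum>m\<in>K. \<Sum>i<d. cnj (w m i) * w m i)" by (subst sum.swap) (simp add: mult.commute)
  finally show ?thesis by (simp add: sqnorm_sum)
qed

lemma mtrace_mult_gram:
  assumes "gram_of d A K w" "B \<in> carrier_mat d d"
  shows "mtrace (A * B) = (\<Sum>m\<in>K. qform d B (w m))"
proof -
  have "mtrace (A * B) = (\<Sum>i<d. \<Sum>j<d. A $$ (i, j) * B $$ (j, i))"
    using assms by (auto simp: mtrace_def gram_of_def scalar_prod_def atLeast0LessThan intro!: sum.cong)
  also have "\<dots> = (\<Sum>i<d. \<Sum>j<d. \<Sum>m\<in>K. cnj (w m j) * B $$ (j, i) * w m i)"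
    using assms by (intro sum.cong refl) (simp add: gram_of_def sum_distrib_left sum_distrib_right mult_ac)
  also have "\<dots> = (\<Sum>m\<in>K. qform d B (w m))"
    unfolding qform_def by (subst sum_rotate[symmetric]) (intro sum.cong refl, rule sum.swap)
  finally show ?thesis .
qed

text \<open>The eigenvectors are scaled by the square roots of the eigenvalues, which are
  nonnegative because each is the value of the form at its eigenvector.\<close>

lemma psd_gram:
  assumes "psd d A"
  obtains w where "gram_of d A {..<d} w"
proof -
  have A: "A \<in> carrier_mat d d" using assms by (rule psd_carrier)
  have "mat_adjoint A = A"
  proof (rule eq_matI)
    fix i j assume "i < dim_row A" "j < dim_col A"
    then show "mat_adjoint A $$ (i, j) = A $$ (i, j)"
      using psd_hermitian[OF assms, of i j] A by (simp add: mat_adjoint_mat)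
  qed (use A in \<open>auto simp: mat_adjoint_mat\<close>)
  from vn_entropy_spectral[OF A this] obtain u l where sd: "spectral_decomp d A u l" by blast
  note u1 = sd[unfolded spectral_decomp_def, THEN conjunct1, rule_format]
  note u3 = sd[unfolded spectral_decomp_def, THEN conjunct2, THEN conjunct2, rule_format]
  have l: "0 \<le> l m" if "m < d" for m
  proof -
    have "qform d A (u m) = (\<Sum>i<d. \<Sum>j<d. \<Sum>k<d. complex_of_real (l k) * ((cnj (u m i) * u k i)
      * (cnj (u k j) * u m j)))"
      unfolding qform_def by (intro sum.cong refl) (simp add: u3 sum_distrib_left sum_distrib_right mult_ac)
    also have "\<dots> = (\<Sum>k<d. complex_of_real (l k) * ((\<Sum>i<d. cnj (u m i) * u k i) * (\<Sum>j<d. cnj (u k j) * u m j)))"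
      unfolding sum_product unfolding sum_distrib_left by (rule sum_rotate[symmetric])
    also have "\<dots> = (\<Sum>k<d. complex_of_real (l k) * (if k = m then 1 else 0))"
      using that by (intro sum.cong refl) (auto simp: u1)
    also have "\<dots> = complex_of_real (l m)" using that by (simp add: sum_delta_lessThan)
    finally show ?thesis using psd_qform[OF assms, of "u m"] by (simp add: less_eq_complex_def)
  qed
  show thesis
  proof (rule that[of "\<lambda>m i. complex_of_real (sqrt (l m))
    * u m i"], unfold gram_of_def, intro conjI allI impI A)
    fix i j assume ij: "i < d" "j < d"
    have eqm: "complex_of_real (sqrt (l m)) * u m i * cnj (complex_of_real (sqrt (l m)) * u m j) 
      = u m i * complex_of_real (l m) * cnj (u m j)" if "m < d" for m
      using l[OF that] by (simp add: mult_ac flip: of_real_mult)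
    then show "A $$ (i, j) = (\<Sum>m<d. complex_of_real (sqrt (l m)) * u m i
      * cnj (complex_of_real (sqrt (l m)) * u m j))"
      unfolding u3[OF ij]
    proof (intro sum.cong refl)
      fix m assume "m \<in> {..<d}"
      then show "u m i * complex_of_real (l m) * cnj (u m j) =
          complex_of_real (sqrt (l m)) * u m i * cnj (complex_of_real (sqrt (l m)) * u m j)"
        by (intro eqm[symmetric]) simp
    qed
  qed
qed

text \<open>Lagrange's identity: the gap is half the sum of the squares
  \<open>(a i * b j - a j * b i)\<^sup>2\<close>.\<close>

lemma real_Cauchy_Schwarz:
  fixes a b :: "'a \<Rightarrow> real"
  shows "(\<Sum>k\<in>K. a k * b k)\<^sup>2 \<le> (\<Sum>k\<in>K. (a k)\<^sup>2) * (\<Sum>k\<in>K. (b k)\<^sup>2)"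
proof -
  have "0 \<le> (\<Sum>i\<in>K. \<Sum>j\<in>K. (a i * b j - a j * b i)\<^sup>2)" by (intro sum_nonneg) auto
  also have "\<dots> = (\<Sum>i\<in>K. \<Sum>j\<in>K. (a i)\<^sup>2 * (b j)\<^sup>2) + (\<Sum>i\<in>K. \<Sum>j\<in>K. (b i)\<^sup>2 * (a j)\<^sup>2)
      - 2 * (\<Sum>i\<in>K. \<Sum>j\<in>K. (a i * b i) * (a j * b j))"
    unfolding sum_distrib_left sum.distrib[symmetric] sum_subtractf[symmetric]
    by (intro sum.cong refl) (simp add: power2_eq_square algebra_simps)
  also have "\<dots> = 2 * ((\<Sum>k\<in>K. (a k)\<^sup>2) * (\<Sum>k\<in>K. (b k)\<^sup>2)) - 2 * (\<Sum>k\<in>K. a k * b k)\<^sup>2"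
    unfolding sum_product[symmetric] by (simp add: power2_eq_square mult.commute)
  finally show ?thesis by simp
qed

lemma cmod_sum_mult_square_le:
  "(cmod (\<Sum>k\<in>K. a k * b k))\<^sup>2 \<le> (\<Sum>k\<in>K. (cmod (a k))\<^sup>2) * (\<Sum>k\<in>K. (cmod (b k))\<^sup>2)"
proof -
  have "cmod (\<Sum>k\<in>K. a k * b k) \<le> (\<Sum>k\<in>K. cmod (a k) * cmod (b k))"
    by (rule order_trans[OF norm_sum]) (simp add: norm_mult)
  then have "(cmod (\<Sum>k\<in>K. a k * b k))\<^sup>2 \<le> (\<Sum>k\<in>K. cmod (a k) * cmod (b k))\<^sup>2" by (intro power_mono) auto
  also have "\<dots> \<le> (\<Sum>k\<in>K. (cmod (a k))\<^sup>2) * (\<Sum>k\<in>K. (cmod (b k))\<^sup>2)"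
    by (rule real_Cauchy_Schwarz)
  finally show ?thesis .
qed

text \<open>
  With \<open>P\<close> the projection onto the span of the orthonormal family, \<open>\<sigma> \<le> 2 P \<sigma> P + 2 (1 - P) \<sigma> (1 - P)\<close>.
  This replaces the gentle measurement lemma.
\<close>

lemma test_bound_by_projection:
  assumes \<sigma>: "psd d \<sigma>" "mtrace \<sigma> = 1" and X: "psd d X" and X1: "\<And>v. Re (qform d X v) \<le> sqnorm d v"
    and f: "orthonormal_family d K f" "finite K"
  shows "Re (mtrace (\<sigma> * X)) \<le> 2 * (\<Sum>k\<in>K. Re (qform d X (f k))) + 2 * (1 - (\<Sum>k\<in>K. Re (qform d \<sigma> (f k))))"
proof -
  obtain w where w: "gram_of d \<sigma> {..<d} w" using psd_gram[OF \<sigma>(1)] by blast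
  obtain x where x: "gram_of d X {..<d} x" using psd_gram[OF X] by blast
  note qX = qform_gram[OF x]
  let ?Q = "\<Sum>k\<in>K. Re (qform d X (f k))"
  have Q0: "0 \<le> ?Q" using psd_qform[OF X] by (intro sum_nonneg) (simp add: less_eq_complex_def)
  \<comment> \<open>The bound for one vector; adding it up over the rank-one terms \<open>w\<close>
    of \<open>\<sigma>\<close> gives the claim. Here \<open>p\<close> is the projection of
    \<open>v\<close> and \<open>r\<close> the remainder, and the factor 2 pays for the cross terms
    between them.\<close>
  have vec: "Re (qform d X v) \<le> 2 * (sqnorm d v * ?Q)
    + 2 * (sqnorm d v - (\<Sum>k\<in>K. (cmod (inner d (f k) v))\<^sup>2))" for v
  proof -
    define p where "p i = (\<Sum>k\<in>K. inner d (f k) v * f k i)" for i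
    define r where "r i = v i - p i" for i
    have v: "v = (\<lambda>i. p i + r i)" by (simp add: r_def)
    have par: "(cmod (a + b))\<^sup>2 \<le> 2 * (cmod a)\<^sup>2 + 2 * (cmod b)\<^sup>2" for a b
    proof -
      have "(cmod (a + b))\<^sup>2 \<le> (cmod a + cmod b)\<^sup>2" by (intro power_mono norm_triangle_ineq) auto
      also have "\<dots> \<le> 2 * (cmod a)\<^sup>2 + 2 * (cmod b)\<^sup>2"
        using zero_le_power2[of "cmod a - cmod b"] by (simp add: power2_eq_square algebra_simps)
      finally show ?thesis .
    qed
    have "Re (qform d X v) = (\<Sum>m<d. (cmod (inner d (x m) p + inner d (x m) r))\<^sup>2)"
      unfolding qX by (subst v) (simp add: inner_add_right)
    also have "\<dots> \<le> (\<Sum>m<d. 2 * (cmod (inner d (x m) p))\<^sup>2 + 2 * (cmod (inner d (x m) r))\<^sup>2)"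
      by (intro sum_mono par)
    also have "\<dots> = 2 * Re (qform d X p) + 2 * Re (qform d X r)"
      by (simp add: qX sum.distrib sum_distrib_left)
    finally have 1: "Re (qform d X v) \<le> 2 * Re (qform d X p) + 2 * Re (qform d X r)" .
    have 2: "Re (qform d X r) \<le> sqnorm d v - (\<Sum>k\<in>K. (cmod (inner d (f k) v))\<^sup>2)"
      using X1[of r] sqnorm_residual[OF f, of v] by (simp add: r_def[abs_def] p_def)
    \<comment> \<open>Cauchy-Schwarz over \<open>k\<close> separates the coordinates of
      \<open>v\<close> from the values of \<open>X\<close> at the \<open>f k\<close>, whose sum
      \<open>?Q\<close> is the trace of \<open>X\<close> on the span.\<close>
    have "Re (qform d X p) = (\<Sum>m<d. (cmod (\<Sum>k\<in>K. inner d (f k) v * inner d (x m) (f k)))\<^sup>2)"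
      unfolding qX p_def by (simp add: inner_sum_right)
    also have "\<dots> \<le> (\<Sum>m<d. (\<Sum>k\<in>K. (cmod (inner d (f k) v))\<^sup>2) * (\<Sum>k\<in>K. (cmod (inner d (x m) (f k)))\<^sup>2))"
      by (intro sum_mono cmod_sum_mult_square_le)
    also have "\<dots> = (\<Sum>k\<in>K. (cmod (inner d (f k) v))\<^sup>2) * ?Q"
      unfolding sum_distrib_left[symmetric] qX by (subst sum.swap) simp
    also have "\<dots> \<le> sqnorm d v * ?Q" using bessel[OF f, of v] Q0 by (rule mult_right_mono)
    finally have "2 * Re (qform d X p) \<le> 2 * (sqnorm d v * ?Q)" by simp
    from order_trans[OF 1 add_mono[OF this mult_left_mono[OF 2, of 2]]] show ?thesis by simp
  qed
  have tr: "(\<Sum>m<d. sqnorm d (w m)) = 1"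
    using mtrace_gram[OF w] \<sigma>(2) by (metis of_real_eq_1_iff)
  have "Re (mtrace (\<sigma> * X)) = (\<Sum>m<d. Re (qform d X (w m)))"
    by (simp add: mtrace_mult_gram[OF w psd_carrier[OF X]])
  also have "\<dots> \<le> (\<Sum>m<d. 2 * (sqnorm d (w m) * ?Q)
    + 2 * (sqnorm d (w m) - (\<Sum>k\<in>K. (cmod (inner d (f k) (w m)))\<^sup>2)))"
    by (intro sum_mono vec)
  also have "\<dots> = 2 * ((\<Sum>m<d. sqnorm d (w m)) * ?Q)
    + 2 * ((\<Sum>m<d. sqnorm d (w m)) - (\<Sum>m<d. \<Sum>k\<in>K. (cmod (inner d (f k) (w m)))\<^sup>2))"
    unfolding sum.distrib by (simp only: sum_distrib_left[symmetric] sum_distrib_right[symmetric] sum_subtractf)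
  also have "(\<Sum>m<d. \<Sum>k\<in>K. (cmod (inner d (f k) (w m)))\<^sup>2) = (\<Sum>k\<in>K. Re (qform d \<sigma> (f k)))"
    unfolding qform_gram[OF w]
    by (subst sum.swap) (simp add: cmod_inner_commute[of d "w _"])
  finally show ?thesis unfolding tr by simp
qed

section \<open>Typical sequences\<close>

lemma sum_lessThan_mult: "(\<Sum>i<N * k. g i) = (\<Sum>r<N. \<Sum>b<k. g (r * k + b))" for k :: nat
proof (cases "k = 0")
  case False
  have "(\<Sum>i<N * k. g i) = (\<Sum>(r, b)\<in>{..<N} \<times> {..<k}. g (r * k + b))"
  proof (rule sum.reindex_bij_witness[of _ "\<lambda>(r, b). r * k + b" "\<lambda>i. (i div k, i mod k)"]; clarsimp)
    fix i assume "i < N * k"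
    then show "i div k < N \<and> i mod k < k" using False by (simp add: less_mult_imp_div_less)
  next
    fix r b assume "r < N" "b < k"
    then have "r * k + b < (r + 1) * k" by simp
    also have "\<dots> \<le> N * k" using \<open>r < N\<close> by (intro mult_right_mono) auto
    finally show "r * k + b < N * k" .
  qed
  then show ?thesis by (simp add: sum.cartesian_product)
qed simp

lemma index_less_mult: "r < N \<Longrightarrow> b < k \<Longrightarrow> r * k + b < N * k" for k :: nat
proof -
  assume "r < N" "b < k"
  then have "r * k + b < (r + 1) * k" by simp
  also have "\<dots> \<le> N * k" using \<open>r < N\<close> by (intro mult_right_mono) auto
  finally show "r * k + b < N * k" .
qed

lemma digit_less: "0 < d \<Longrightarrow> digit d k s < d"
  by (simp add: digit_def)

lemma digit_low: "k < n \<Longrightarrow> 0 < d \<Longrightarrow> digit d k (m * d ^ n + s) = digit d k s"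
proof -
  assume k: "k < n" and d: "0 < d"
  then obtain j where "n = k + Suc j" using less_iff_Suc_add by auto
  then have eq: "m * d ^ n + s = (m * d ^ j * d) * d ^ k + s" by (simp add: power_add)
  have "(m * d ^ n + s) div d ^ k = m * d ^ j * d + s div d ^ k" unfolding eq using d by simp
  then show ?thesis by (simp add: digit_def)
qed

lemma digit_top: "m < d \<Longrightarrow> s < d ^ n \<Longrightarrow> digit d n (m * d ^ n + s) = m"
  by (simp add: digit_def)

text \<open>As \<open>s\<close> runs below \<open>d ^ n\<close>, its digits run through all
  \<open>n\<close>-tuples, so this is the distributive law. It reduces identities about tensor
  powers to a single factor.\<close>

lemma sum_prod_digits:
  fixes f :: "nat \<Rightarrow> nat \<Rightarrow> 'a::comm_semiring_1"
  assumes "0 < d"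
  shows "(\<Sum>s<d ^ n. \<Prod>k<n. f k (digit d k s)) = (\<Prod>k<n. \<Sum>m<d. f k m)"
proof (induction n)
  case (Suc n)
  have "(\<Sum>s<d ^ Suc n. \<Prod>k<Suc n. f k (digit d k s)) =
      (\<Sum>m<d. \<Sum>s<d ^ n. (\<Prod>k<n. f k (digit d k s)) * f n m)"
    by (simp add: sum_lessThan_mult digit_low digit_top assms)
  also have "\<dots> = (\<Prod>k<Suc n. \<Sum>m<d. f k m)"
    by (simp add: sum_distrib_right[symmetric] sum_distrib_left[symmetric] Suc)
  finally show ?case .
qed simp

lemma digits_inj:
  assumes "0 < d"
  shows "s < d ^ n \<Longrightarrow> t < d ^ n \<Longrightarrow> (\<And>k. k < n \<Longrightarrow> digit d k s = digit d k t) \<Longrightarrow> s = t"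
proof (induction n arbitrary: s t)
  case (Suc n)
  have split: "x = digit d n x * d ^ n + x mod d ^ n" "x mod d ^ n < d ^ n" if "x < d ^ Suc n" for x
    using that assms by (auto simp: digit_def less_mult_imp_div_less mult.commute)
  have dg: "digit d k (x mod d ^ n) = digit d k x" if "k < n" for k x
    using digit_low[OF that assms, of "x div d ^ n" "x mod d ^ n"] unfolding div_mult_mod_eq by (rule sym)
  have "s mod d ^ n = t mod d ^ n"
  proof (rule Suc.IH)
    fix k assume "k < n"
    then show "digit d k (s mod d ^ n) = digit d k (t mod d ^ n)"
      using Suc.prems(3)[of k] by (simp add: dg)
  qed (use split(2) Suc.prems(1,2) in blast)+
  then have "digit d n s * d ^ n + s mod d ^ n = digit d n t * d ^ n + t mod d ^ n"
    using Suc.prems(3)[of n] by simp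
  then show ?case
    unfolding split(1)[OF Suc.prems(1), symmetric] split(1)[OF Suc.prems(2), symmetric] .
qed simp

lemma prod_digits_delta:
  fixes c :: "nat \<Rightarrow> 'a::comm_semiring_1"
  assumes "0 < d" "s < d ^ n" "t < d ^ n"
  shows "(\<Prod>k<n. if digit d k s = digit d k t then c (digit d k s) else 0)
    = (if s = t then \<Prod>k<n. c (digit d k s) else 0)"
proof (cases "s = t")
  case False
  then obtain k where "k < n" "digit d k s \<noteq> digit d k t" using digits_inj[OF assms] by blast
  then have "(\<Prod>k<n. if digit d k s = digit d k t then c (digit d k s) else 0) = 0"
    by (intro prod_zero) auto
  with False show ?thesis by simp
qed simp

section \<open>The product distribution on digit strings and its typical sets\<close>

definition seq_prob :: "nat \<Rightarrow> (nat \<Rightarrow> real) \<Rightarrow> nat \<Rightarrow> nat \<Rightarrow> real" where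
  "seq_prob d p n s = (\<Prod>k<n. p (digit d k s))"

locale prob_vec =
  fixes d :: nat and p :: "nat \<Rightarrow> real"
  assumes d_pos: "0 < d" and p_nonneg: "\<And>m. m < d \<Longrightarrow> 0 \<le> p m" and p_sum: "(\<Sum>m<d. p m) = 1"
begin

lemma seq_prob_nonneg: "0 \<le> seq_prob d p n s"
  unfolding seq_prob_def by (intro prod_nonneg) (simp add: p_nonneg digit_less d_pos)

lemma seq_prob_sum: "(\<Sum>s<d ^ n. seq_prob d p n s) = 1"
  unfolding seq_prob_def by (subst sum_prod_digits[OF d_pos]) (simp add: p_sum)

lemma seq_prob_sum_le: "S \<subseteq> {..<d ^ n} \<Longrightarrow> (\<Sum>s\<in>S. seq_prob d p n s) \<le> 1"
  unfolding seq_prob_sum[of n, symmetric] by (intro sum_mono2) (auto simp: seq_prob_nonneg)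

text \<open>Variance of a sum of independent centred variables. The free shift \<open>x\<close>
  carries the induction: splitting off the top digit \<open>m\<close> moves \<open>g m\<close> into
  it, and the cross term disappears because \<open>g\<close> is centred.\<close>

lemma second_moment:
  assumes "(\<Sum>m<d. p m * g m) = 0"
  shows "(\<Sum>s<d ^ n. seq_prob d p n s * (x + (\<Sum>k<n. g (digit d k s)))\<^sup>2) = x\<^sup>2 + n * (\<Sum>m<d. p m * (g m)\<^sup>2)"
proof (induction n arbitrary: x)
  case 0
  then show ?case by (simp add: seq_prob_def)
next
  case (Suc n)
  let ?V = "\<Sum>m<d. p m * (g m)\<^sup>2"
  have "(\<Sum>s<d ^ Suc n. seq_prob d p (Suc n) s * (x + (\<Sum>k<Suc n. g (digit d k s)))\<^sup>2)
    = (\<Sum>m<d. \<Sum>s<d ^ n. p m * (seq_prob d p n s * ((x + g m) + (\<Sum>k<n. g (digit d k s)))\<^sup>2))"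
    unfolding power_Suc sum_lessThan_mult
  proof (intro sum.cong refl)
    fix m s assume "m \<in> {..<d}" "s \<in> {..<d ^ n}"
    then have 1: "seq_prob d p (Suc n) (m * d ^ n + s) = p m * seq_prob d p n s"
      by (simp add: seq_prob_def digit_low digit_top d_pos mult.commute)
    have 2: "x + (\<Sum>k<Suc n. g (digit d k (m * d ^ n + s))) = (x + g m) + (\<Sum>k<n. g (digit d k s))"
      using \<open>m \<in> _\<close> \<open>s \<in> _\<close> by (simp add: digit_low digit_top d_pos)
    show "seq_prob d p (Suc n) (m * d ^ n + s) * (x + (\<Sum>k<Suc n. g (digit d k (m * d ^ n + s))))\<^sup>2 =
       p m * (seq_prob d p n s * ((x + g m) + (\<Sum>k<n. g (digit d k s)))\<^sup>2)"
      unfolding 1 2 by (rule mult.assoc)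
  qed
  also have "\<dots> = (\<Sum>m<d. p m * ((x + g m)\<^sup>2 + n * ?V))"
    unfolding sum_distrib_left[symmetric] Suc.IH ..
  also have "\<dots> = (x\<^sup>2 + n * ?V) * (\<Sum>m<d. p m) + 2 * x * (\<Sum>m<d. p m * g m) + ?V"
    unfolding sum_distrib_left sum.distrib[symmetric]
    by (intro sum.cong refl) (simp add: power2_eq_square algebra_simps)
  also have "\<dots> = x\<^sup>2 + Suc n * ?V" unfolding p_sum assms by (simp add: algebra_simps)
  finally show ?case .
qed

lemma chebyshev:
  assumes "(\<Sum>m<d. p m * g m) = 0" "0 < \<delta>" "0 < n"
  shows "(\<Sum>s | s < d ^ n \<and> real n * \<delta> < \<bar>\<Sum>k<n. g (digit d k s)\<bar>. seq_prob d p n s)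
    \<le> (\<Sum>m<d. p m * (g m)\<^sup>2) / (real n * \<delta>\<^sup>2)"
proof -
  let ?B = "{s. s < d ^ n \<and> real n * \<delta> < \<bar>\<Sum>k<n. g (digit d k s)\<bar>}"
  have nd: "0 < real n * \<delta>" using assms by simp
  have "(\<Sum>s\<in>?B. seq_prob d p n s) * (real n * \<delta>)\<^sup>2
    \<le> (\<Sum>s\<in>?B. seq_prob d p n s * (0 + (\<Sum>k<n. g (digit d k s)))\<^sup>2)"
    unfolding sum_distrib_right
  proof (intro sum_mono mult_left_mono seq_prob_nonneg)
    fix s assume "s \<in> ?B"
    then have "real n * \<delta> \<le> \<bar>\<Sum>k<n. g (digit d k s)\<bar>" by simp
    with nd have "(real n * \<delta>)\<^sup>2 \<le> \<bar>\<Sum>k<n. g (digit d k s)\<bar>\<^sup>2" by (intro power_mono) auto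
    then show "(real n * \<delta>)\<^sup>2 \<le> (0 + (\<Sum>k<n. g (digit d k s)))\<^sup>2" by simp
  qed
  also have "\<dots> \<le> (\<Sum>s<d ^ n. seq_prob d p n s * (0 + (\<Sum>k<n. g (digit d k s)))\<^sup>2)"
    by (intro sum_mono2) (auto simp: seq_prob_nonneg)
  also have "\<dots> = n * (\<Sum>m<d. p m * (g m)\<^sup>2)" by (subst second_moment[OF assms(1)]) simp
  finally show ?thesis using assms(2,3) nd
    by (simp add: field_simps power2_eq_square)
qed

definition shannon :: "real \<Rightarrow> real" where
  "shannon b = - (\<Sum>m<d. p m * log b (p m))"

text \<open>Positivity is demanded explicitly: \<open>log b 0\<close> is a default value, and the
  converse divides by the square root of the probability.\<close>

definition typical :: "real \<Rightarrow> real \<Rightarrow> nat \<Rightarrow> nat set" where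
  "typical b \<delta> n = {s. s < d ^ n \<and> 0 < seq_prob d p n s
    \<and> \<bar>- log b (seq_prob d p n s) - real n * shannon b\<bar> \<le> real n * \<delta>}"

lemma seq_prob_pos_factor:
  assumes "0 < seq_prob d p n s" "k < n"
  shows "0 < p (digit d k s)"
proof -
  from assms(1) have "(\<Prod>k<n. p (digit d k s)) \<noteq> 0" unfolding seq_prob_def by linarith
  with assms(2) have "p (digit d k s) \<noteq> 0" by (simp add: prod_zero_iff)
  then show ?thesis using p_nonneg[OF digit_less[OF d_pos, of k s]] by linarith
qed

lemma log_seq_prob:
  assumes "1 < b" "0 < seq_prob d p n s"
  shows "log b (seq_prob d p n s) = (\<Sum>k<n. log b (p (digit d k s)))"
proof -
  note pos = seq_prob_pos_factor[OF assms(2)]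
  show ?thesis unfolding seq_prob_def log_def
    by (subst ln_prod) (use pos in \<open>force simp: sum_divide_distrib\<close>)+
qed

lemma typical_finite: "finite (typical b \<delta> n)"
  by (rule finite_subset[of _ "{..<d ^ n}"]) (auto simp: typical_def)

text \<open>The weak law of large numbers for the information content, with an explicit rate:
  \<open>V\<close> is a variance divided by \<open>\<delta>\<^sup>2\<close>.\<close>

lemma atypical_prob:
  assumes "1 < b" "0 < \<delta>"
  obtains V where "\<And>n. 0 < n \<Longrightarrow> 1 - V / n \<le> (\<Sum>s\<in>typical b \<delta> n. seq_prob d p n s)"
proof -
  \<comment> \<open>Letters of probability 0 get the value 0 rather than one built from
    \<open>log b 0\<close>. Their weight \<open>p m\<close> is 0, so the mean is unaffected, and
    they occur in no sequence of positive probability.\<close>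
  define g where "g m = (if p m = 0 then 0 else - log b (p m) - shannon b)" for m
  have g0: "(\<Sum>m<d. p m * g m) = 0"
  proof -
    have "(\<Sum>m<d. p m * g m) = (\<Sum>m<d. - (p m * log b (p m)) - shannon b * p m)"
      by (intro sum.cong refl) (simp add: g_def algebra_simps)
    also have "\<dots> = shannon b - shannon b * (\<Sum>m<d. p m)"
      unfolding sum_subtractf sum_distrib_left by (simp add: shannon_def sum_negf)
    finally show ?thesis by (simp add: p_sum)
  qed
  show thesis
  proof (rule that[of "(\<Sum>m<d. p m * (g m)\<^sup>2) / \<delta>\<^sup>2"])
    fix n :: nat assume n: "0 < n"
    let ?B = "{s. s < d ^ n \<and> real n * \<delta> < \<bar>\<Sum>k<n. g (digit d k s)\<bar>}"
    let ?T = "typical b \<delta> n"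
    have gs: "(\<Sum>k<n. g (digit d k s)) = - log b (seq_prob d p n s) - real n * shannon b"
      if "0 < seq_prob d p n s" for s
    proof -
      have "g (digit d k s) = - log b (p (digit d k s)) - shannon b" if "k < n" for k
        using seq_prob_pos_factor[OF \<open>0 < seq_prob d p n s\<close> that] by (simp add: g_def)
      then show ?thesis by (simp add: log_seq_prob[OF assms(1) that] sum_subtractf sum_negf)
    qed
    have "1 = (\<Sum>s<d ^ n. seq_prob d p n s)" by (simp add: seq_prob_sum)
    also have "\<dots> = (\<Sum>s\<in>{s. s < d ^ n \<and> 0 < seq_prob d p n s}. seq_prob d p n s)"
      using seq_prob_nonneg by (intro sum.mono_neutral_right) (auto simp: order.order_iff_strict)
    also have "\<dots> \<le> (\<Sum>s\<in>?T \<union> ?B. seq_prob d p n s)"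
    proof (intro sum_mono2)
      show "{s. s < d ^ n \<and> 0 < seq_prob d p n s} \<subseteq> ?T \<union> ?B"
      proof
        fix s assume "s \<in> {s. s < d ^ n \<and> 0 < seq_prob d p n s}"
        then have s: "s < d ^ n" "0 < seq_prob d p n s" by auto
        show "s \<in> ?T \<union> ?B"
          using s unfolding typical_def Un_iff mem_Collect_eq gs[OF s(2)] by linarith
      qed
    qed (simp_all add: typical_finite seq_prob_nonneg)
    also have "\<dots> \<le> (\<Sum>s\<in>?T. seq_prob d p n s) + (\<Sum>s\<in>?B. seq_prob d p n s)"
      by (subst sum.union_inter[symmetric]) (auto simp: typical_finite seq_prob_nonneg intro!: sum_nonneg)
    also have "(\<Sum>s\<in>?B. seq_prob d p n s) \<le> (\<Sum>m<d. p m * (g m)\<^sup>2) / (real n * \<delta>\<^sup>2)"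
      using chebyshev[OF g0 assms(2) n] .
    finally show "1 - (\<Sum>m<d. p m * (g m)\<^sup>2) / \<delta>\<^sup>2 / n \<le> (\<Sum>s\<in>?T. seq_prob d p n s)"
      by (simp add: mult.commute)
  qed
qed

lemma typical_bounds:
  assumes "1 < b" "s \<in> typical b \<delta> n"
  shows "b powr - (real n * (shannon b + \<delta>)) \<le> seq_prob d p n s"
    "seq_prob d p n s \<le> b powr - (real n * (shannon b - \<delta>))"
proof -
  from assms(2) have q: "0 < seq_prob d p n s" and l: "\<bar>- log b (seq_prob d p n s) - real n * shannon b\<bar>
    \<le> real n * \<delta>"
    by (auto simp: typical_def)
  have "seq_prob d p n s = b powr log b (seq_prob d p n s)" using q assms(1) by simp
  moreover from l have "- (real n * (shannon b + \<delta>)) \<le> log b (seq_prob d p n s)"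
     "log b (seq_prob d p n s) \<le> - (real n * (shannon b - \<delta>))" by (auto simp: algebra_simps abs_le_iff)
  ultimately show "b powr - (real n * (shannon b + \<delta>)) \<le> seq_prob d p n s"
    "seq_prob d p n s \<le> b powr - (real n * (shannon b - \<delta>))"
    using assms(1) by (metis powr_le_cancel_iff)+
qed

text \<open>Each typical sequence has at least the probability given by
  \<open>typical_bounds\<close>, and all of them together have at most 1.\<close>

lemma typical_card:
  assumes "1 < b"
  shows "card (typical b \<delta> n) \<le> b powr (real n * (shannon b + \<delta>))"
proof -
  define a where "a = real n * (shannon b + \<delta>)"
  have "card (typical b \<delta> n) * b powr - a \<le> (\<Sum>s\<in>typical b \<delta> n. seq_prob d p n s)"
    using sum_mono[of "typical b \<delta> n" "\<lambda>_. b powr - a" "seq_prob d p n"] typical_bounds(1)[OF assms, of _ \<delta> n]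
    by (simp add: a_def)
  also have "\<dots> \<le> 1" by (rule seq_prob_sum_le) (auto simp: typical_def)
  finally show ?thesis using assms unfolding a_def[symmetric] by (simp add: powr_minus field_simps)
qed

text \<open>Method of types: the probability of a sequence depends only on how often each of the
  \<open>d\<close> letters occurs, and each count lies between 0 and \<open>n\<close>.\<close>

lemma card_seq_prob_image: "card (seq_prob d p n ` {..<d ^ n}) \<le> (n + 1) ^ d"
proof -
  let ?P = "PiE {..<d} (\<lambda>_. {..n})"
  have "seq_prob d p n ` {..<d ^ n} \<subseteq> (\<lambda>f. \<Prod>m<d. p m ^ f m) ` ?P"
  proof clarsimp
    fix s
    let ?f = "\<lambda>m\<in>{..<d}. card {k. k < n \<and> digit d k s = m}"
    have "seq_prob d p n s = (\<Prod>m<d. \<Prod>k\<in>{k. k \<in> {..<n} \<and> digit d k s = m}. p (digit d k s))"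
      unfolding seq_prob_def by (intro prod.group[symmetric]) (auto simp: digit_less d_pos)
    also have "\<dots> = (\<Prod>m<d. p m ^ ?f m)"
      by (intro prod.cong refl) simp
    finally have "seq_prob d p n s = (\<Prod>m<d. p m ^ ?f m)" .
    moreover have "?f \<in> ?P"
    proof (rule PiE_I)
      fix m assume "m \<in> {..<d}"
      have "card {k. k < n \<and> digit d k s = m} \<le> card {..<n}" by (intro card_mono) auto
      then show "?f m \<in> {..n}" using \<open>m \<in> _\<close> by simp
    qed auto
    ultimately show "seq_prob d p n s \<in> (\<lambda>f. \<Prod>m<d. p m ^ f m) ` ?P" by (rule image_eqI)
  qed
  then have "card (seq_prob d p n ` {..<d ^ n}) \<le> card ?P"
    by (rule surj_card_le[rotated]) (auto intro: finite_PiE)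
  also have "\<dots> = (n + 1) ^ d" by (simp add: card_PiE)
  finally show ?thesis .
qed

end

section \<open>Encoded states and the converse bound\<close>

lemma linear_op_carrier: "linear_op_map d N C \<Longrightarrow> X \<in> carrier_mat d d \<Longrightarrow> C X \<in> carrier_mat N N"
  by (simp add: linear_op_map_def)

lemma linear_op_zero:
  assumes "linear_op_map d N C" "i < N" "j < N"
  shows "C (0\<^sub>m d d) $$ (i, j) = 0"
proof -
  have "C (0 \<cdot>\<^sub>m 0\<^sub>m d d) = 0 \<cdot>\<^sub>m C (0\<^sub>m d d)"
    using assms(1) unfolding linear_op_map_def by (meson zero_carrier_mat)
  moreover have "0 \<cdot>\<^sub>m 0\<^sub>m d d = (0\<^sub>m d d :: complex mat)" by (intro eq_matI) auto
  ultimately have "C (0\<^sub>m d d) = 0 \<cdot>\<^sub>m C (0\<^sub>m d d)" by simp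
  then have "C (0\<^sub>m d d) $$ (i, j) = (0 \<cdot>\<^sub>m C (0\<^sub>m d d)) $$ (i, j)" by simp
  then show ?thesis using linear_op_carrier[OF assms(1), of "0\<^sub>m d d"] assms(2,3) by simp
qed

lemma linear_op_sum:
  assumes C: "linear_op_map d N C" and "finite A" and "\<And>k. k \<in> A \<Longrightarrow> X k \<in> carrier_mat d d"
    and ij: "i < N" "j < N"
  shows "C (mat d d (\<lambda>ij. \<Sum>k\<in>A. c k * X k $$ ij)) $$ (i, j) = (\<Sum>k\<in>A. c k * C (X k) $$ (i, j))"
  using assms(2,3)
proof (induction A rule: finite_induct)
  case empty
  have "mat d d (\<lambda>_. 0) = (0\<^sub>m d d :: complex mat)" by (intro eq_matI) auto
  then show ?case using linear_op_zero[OF C ij] by simp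
next
  case (insert x A)
  let ?Y = "mat d d (\<lambda>ij. \<Sum>k\<in>A. c k * X k $$ ij)"
  have x: "X x \<in> carrier_mat d d" using insert by simp
  have "mat d d (\<lambda>ij. \<Sum>k\<in>insert x A. c k * X k $$ ij) = c x \<cdot>\<^sub>m X x + ?Y"
    using x insert.hyps by (intro eq_matI) auto
  then have "C (mat d d (\<lambda>ij. \<Sum>k\<in>insert x A. c k * X k $$ ij)) = c x \<cdot>\<^sub>m C (X x) + C ?Y"
    using C x by (simp add: linear_op_map_def)
  moreover have "C ?Y \<in> carrier_mat N N" "C (X x) \<in> carrier_mat N N"
    using linear_op_carrier[OF C] x by auto
  ultimately show ?case using insert ij by simp
qed

definition rank_one :: "nat \<Rightarrow> (nat \<Rightarrow> complex) \<Rightarrow> complex mat" where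
  "rank_one d u = mat d d (\<lambda>(i, j). u i * cnj (u j))"

lemma rank_one_carrier [simp]: "rank_one d u \<in> carrier_mat d d"
  by (simp add: rank_one_def)

lemma rank_one_gram: "gram_of d (rank_one d u) {()} (\<lambda>_. u)"
  by (simp add: gram_of_def rank_one_def)

lemma mtrace_rank_one: "mtrace (rank_one d u) = complex_of_real (sqnorm d u)"
  by (simp add: mtrace_gram[OF rank_one_gram])

lemma psd_rank_one: "psd d (rank_one d u)"
  by (rule gram_psd[OF rank_one_gram])

lemma mtrace_carrier: "A \<in> carrier_mat n n \<Longrightarrow> mtrace A = (\<Sum>i<n. A $$ (i, i))"
  by (simp add: mtrace_def)

lemma mtrace_smult: "A \<in> carrier_mat n n \<Longrightarrow> mtrace (c \<cdot>\<^sub>m A) = c * mtrace A"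
  by (simp add: mtrace_def sum_distrib_left)

text \<open>A code is only known to send density operators to density operators. Homogeneity carries
  this over to unnormalised vectors; the zero vector cannot be normalised and is settled by
  linearity.\<close>

lemma trace_preserving_rank_one:
  assumes C: "linear_op_map d N C" and tp: "\<And>\<sigma>. density_op d \<sigma> \<Longrightarrow> density_op N (C \<sigma>)"
  shows "mtrace (C (rank_one d u)) = complex_of_real (sqnorm d u)"
proof (cases "sqnorm d u = 0")
  case True
  then have "\<forall>i<d. u i = 0" unfolding sqnorm_def by (subst (asm) sum_nonneg_eq_0_iff) auto
  then have "rank_one d u = 0\<^sub>m d d" by (intro eq_matI) (auto simp: rank_one_def)
  then show ?thesis
    using True linear_op_zero[OF C] linear_op_carrier[OF C, of "0\<^sub>m d d"] by (simp add: mtrace_carrier)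
next
  case False
  define r where "r = sqnorm d u"
  have r: "0 < r" using False sqnorm_nonneg[of d u] unfolding r_def by linarith
  define v where "v i = complex_of_real (1 / sqrt r) * u i" for i
  have "sqnorm d v = (1 / sqrt r)\<^sup>2 * r"
    unfolding r_def sqnorm_def v_def by (simp add: norm_mult norm_divide power_mult_distrib power_divide
      sum_distrib_left sum_divide_distrib real_sqrt_pow2 sum_nonneg)
  then have v1: "sqnorm d v = 1" using r by (simp add: power_divide)
  then have "density_op d (rank_one d v)" by (simp add: density_op_def psd_rank_one mtrace_rank_one)
  then have "mtrace (C (rank_one d v)) = 1" using tp by (simp add: density_op_def)
  moreover have "rank_one d u = complex_of_real r \<cdot>\<^sub>m rank_one d v"
  proof (intro eq_matI)
    fix i j assume "i < dim_row (complex_of_real r \<cdot>\<^sub>m rank_one d v)" "j < dim_col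
      (complex_of_real r \<cdot>\<^sub>m rank_one d v)"
    moreover have "complex_of_real r * (complex_of_real (1 / sqrt r) * complex_of_real (1 / sqrt r)) = 1"
      using r by (simp flip: of_real_mult)
    then have "complex_of_real r * (v i * cnj (v j)) = u i * cnj (u j)"
      by (simp add: v_def mult_ac)
    ultimately show "rank_one d u $$ (i, j) = (complex_of_real r \<cdot>\<^sub>m rank_one d v) $$ (i, j)"
      by (simp add: rank_one_def)
  qed (auto simp: rank_one_def)
  then have "C (rank_one d u) = complex_of_real r \<cdot>\<^sub>m C (rank_one d v)"
    using C by (simp add: linear_op_map_def)
  ultimately show ?thesis
    using linear_op_carrier[OF C, of "rank_one d v"] by (simp add: mtrace_smult[of _ N] r_def)
qed

lemma mtrace_mult_one_minus:
  assumes "A \<in> carrier_mat d d" "B \<in> carrier_mat d d"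
  shows "mtrace (A * (1\<^sub>m d - B)) = mtrace A - mtrace (A * B)"
proof -
  have "A * (1\<^sub>m d - B) = A * 1\<^sub>m d - A * B" by (rule mult_minus_distrib_mat[OF assms(1) _ assms(2)]) simp
  then show ?thesis using assms by (simp add: mtrace_def sum_subtractf)
qed

lemma povm_qform_sum:
  assumes "is_povm d M X"
  shows "(\<Sum>i\<in>{1..M}. qform d (X i) v) = complex_of_real (sqnorm d v)"
proof -
  have eq: "(\<Sum>k\<in>{1..M}. X k $$ (i, j)) = (if i = j then 1 else 0)" if "i < d" "j < d" for i j
  proof -
    have "mat d d (\<lambda>(r, c). \<Sum>i\<in>{1..M}. X i $$ (r, c)) $$ (i, j) = 1\<^sub>m d $$ (i, j)"
      using assms by (simp only: is_povm_def)
    then show ?thesis using that by simp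
  qed
  have "(\<Sum>k\<in>{1..M}. qform d (X k) v) = (\<Sum>i<d. \<Sum>j<d. cnj (v i) * v j * (\<Sum>k\<in>{1..M}. X k $$ (i, j)))"
    unfolding qform_def by (subst sum_rotate) (simp add: sum_distrib_left mult_ac)
  also have "\<dots> = (\<Sum>i<d. \<Sum>j<d. cnj (v i) * v j * (if i = j then 1 else 0))"
    by (intro sum.cong refl) (simp add: eq del: One_nat_def)
  finally show ?thesis by (simp add: sum_delta_lessThan sqnorm_sum)
qed

lemma povm_qform_le:
  assumes X: "is_povm d M X" and i: "i \<in> {1..M}"
  shows "Re (qform d (X i) v) \<le> sqnorm d v"
proof -
  have nn: "0 \<le> Re (qform d (X k) v)" if "k \<in> {1..M}" for k
    using X that psd_qform[of d "X k" v] by (auto simp: is_povm_def less_eq_complex_def)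
  have "Re (qform d (X i) v) \<le> (\<Sum>k\<in>{1..M}. Re (qform d (X k) v))"
    by (rule member_le_sum[OF i]) (auto intro: nn)
  also have "\<dots> = sqnorm d v" using arg_cong[OF povm_qform_sum[OF X, of v], of Re] by simp
  finally show ?thesis .
qed

section \<open>Encoded states of a vector in Schmidt form\<close>

lemma tensor_id_carrier [simp]: "tensor_id d N k C X \<in> carrier_mat (N * k) (N * k)"
  by (simp add: tensor_id_def)

text \<open>The product vector \<open>e_r \<otimes> g\<close> in the index convention
  \<open>r * K + b\<close>.\<close>

definition slice_vec :: "nat \<Rightarrow> nat \<Rightarrow> (nat \<Rightarrow> complex) \<Rightarrow> nat \<Rightarrow> complex" where
  "slice_vec K r g i = (if i div K = r then g (i mod K) else 0)"

lemma slice_vec_index: "b < K \<Longrightarrow> slice_vec K r g (r' * K + b) = (if r' = r then g b else 0)"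
  by (simp add: slice_vec_def)

lemma inner_slice:
  assumes "r < N"
  shows "inner (N * K) (slice_vec K r g) h = (\<Sum>b<K. cnj (g b) * h (r * K + b))"
proof -
  have "inner (N * K) (slice_vec K r g) h = (\<Sum>r'<N. \<Sum>b<K. if r' = r then cnj (g b) * h (r' * K + b) else 0)"
    unfolding inner_def sum_lessThan_mult by (intro sum.cong refl) (auto simp: slice_vec_index)
  also have "\<dots> = (\<Sum>r'<N. if r' = r then (\<Sum>b<K. cnj (g b) * h (r * K + b)) else 0)"
    by (intro sum.cong refl) auto
  also have "\<dots> = (\<Sum>b<K. cnj (g b) * h (r * K + b))" using assms by simp
  finally show ?thesis .
qed

lemma qform_slice:
  assumes "r < N"
  shows "qform (N * K) A (slice_vec K r g) = (\<Sum>b<K. \<Sum>b'<K. cnj (g b) * A $$ (r * K + b, r * K + b') * g b')"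
proof -
  have "qform (N * K) A (slice_vec K r g) = inner (N * K) (slice_vec K r g) (\<lambda>i. cnj (inner (N
    * K) (slice_vec K r g) (\<lambda>j. cnj (A $$ (i, j)))))"
    unfolding qform_def inner_def by (simp add: sum_distrib_left mult_ac)
  also have "\<dots> = (\<Sum>b<K. \<Sum>b'<K. cnj (g b) * A $$ (r * K + b, r * K + b') * g b')"
    unfolding inner_slice[OF assms] by (simp add: sum_distrib_left mult_ac)
  finally show ?thesis .
qed

text \<open>The Schmidt form of a unit vector \<open>F\<close>, with a sender's space of dimension
  \<open>D\<close> and a receiver's space of dimension \<open>K\<close>. The
  \<open>\<beta> s\<close> stay unnormalised: their square norms carry the weights, so vanishing
  weights fit in and \<open>D\<close> may exceed \<open>K\<close>.\<close>

locale schmidt_state =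
  fixes D K :: nat and \<alpha> \<beta> :: "nat \<Rightarrow> nat \<Rightarrow> complex" and q :: "nat \<Rightarrow> real"
    and F :: "nat \<Rightarrow> complex"
  assumes \<alpha>_orth: "\<And>s t. s < D \<Longrightarrow> t < D \<Longrightarrow> inner D (\<alpha> s) (\<alpha> t) = (if s = t then 1 else 0)"
    and \<alpha>_complete: "\<And>a a'. a < D \<Longrightarrow> a' < D \<Longrightarrow> (\<Sum>s<D. \<alpha> s a * cnj (\<alpha> s a')) = (if a = a' then 1 else 0)"
    and \<beta>_orth: "\<And>s t. s < D \<Longrightarrow> t < D \<Longrightarrow> inner K (\<beta> s) (\<beta> t) = (if s = t then complex_of_real (q s) else 0)"
    and F: "\<And>a b. a < D \<Longrightarrow> b < K \<Longrightarrow> F (a * K + b) = (\<Sum>s<D. \<alpha> s a * \<beta> s b)"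
    and q_sum: "(\<Sum>s<D. q s) = 1"
begin

lemma q_nonneg: "s < D \<Longrightarrow> 0 \<le> q s"
  using \<beta>_orth[of s s] sqnorm_nonneg[of K "\<beta> s"] by (simp add: inner_self)

lemma sqnorm_\<alpha>_comb: "sqnorm D (\<lambda>a. \<Sum>s<D. \<alpha> s a * c s) = (\<Sum>s<D. (cmod (c s))\<^sup>2)"
proof -
  have *: "(\<Sum>t<D. c t * inner D (\<alpha> s) (\<alpha> t)) = c s" if "s < D" for s
  proof -
    have "(\<Sum>t<D. c t * inner D (\<alpha> s) (\<alpha> t)) = (\<Sum>t<D. c t * (if s = t then 1 else 0))"
      using that by (intro sum.cong refl) (simp add: \<alpha>_orth)
    then show ?thesis using that by (simp add: sum_delta_lessThan)
  qed
  have "complex_of_real (sqnorm D (\<lambda>a. \<Sum>s<D. c s * \<alpha> s a)) = (\<Sum>s<D. cnj (c s) * c s)"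
    unfolding inner_self[symmetric] inner_sum_left inner_sum_right using * by (intro sum.cong refl) simp
  also have "\<dots> = complex_of_real (\<Sum>s<D. (cmod (c s))\<^sup>2)"
    by (simp add: complex_norm_square[symmetric] mult.commute del: of_real_power)
  finally have "sqnorm D (\<lambda>a. \<Sum>s<D. c s * \<alpha> s a) = (\<Sum>s<D. (cmod (c s))\<^sup>2)"
    by (simp only: of_real_eq_iff)
  then show ?thesis by (simp only: mult.commute)
qed

text \<open>No signalling. The left side is the form of the receiver's marginal at \<open>g\<close>.
  Contracting the receiver's factor with \<open>g\<close> commutes with \<open>C\<close> and turns
  \<open>F\<close> into the sender's vector \<open>w\<close>; what remains is the trace of
  \<open>C (rank_one D w)\<close>, which is the same for every \<open>C\<close>.\<close>

lemma qform_marginal: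
  assumes C: "linear_op_map D N C" and tp: "\<And>\<sigma>. density_op D \<sigma> \<Longrightarrow> density_op N (C \<sigma>)"
  shows "(\<Sum>r<N. qform (N * K) (tensor_id D N K C (rank_one (D * K) F)) (slice_vec K r g))
    = complex_of_real (\<Sum>s<D. (cmod (inner K g (\<beta> s)))\<^sup>2)"
proof -
  let ?X = "\<lambda>(b, b'). op_block D K (rank_one (D * K) F) b b'"
  let ?c = "\<lambda>(b, b'). cnj (g b) * g b'"
  let ?A = "{..<K} \<times> {..<K}"
  define w where "w a = (\<Sum>s<D. \<alpha> s a * inner K g (\<beta> s))" for a
  have w: "w a = (\<Sum>b<K. cnj (g b) * F (a * K + b))" if "a < D" for a
  proof -
    have "w a = (\<Sum>s<D. \<Sum>b<K. cnj (g b) * (\<alpha> s a * \<beta> s b))"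
      unfolding w_def inner_def by (simp add: sum_distrib_left mult_ac)
    also have "\<dots> = (\<Sum>b<K. \<Sum>s<D. cnj (g b) * (\<alpha> s a * \<beta> s b))" by (rule sum.swap)
    finally show ?thesis using that by (simp add: F sum_distrib_left)
  qed
  have "(\<Sum>r<N. qform (N * K) (tensor_id D N K C (rank_one (D * K) F)) (slice_vec K r g))
    = (\<Sum>r<N. \<Sum>b<K. \<Sum>b'<K. cnj (g b) * C (?X (b, b')) $$ (r, r) * g b')"
    by (intro sum.cong refl) (simp add: qform_slice, intro sum.cong refl,
      simp add: tensor_id_def index_less_mult)
  also have "\<dots> = (\<Sum>r<N. \<Sum>k\<in>?A. ?c k * C (?X k) $$ (r, r))"
    by (simp add: sum.cartesian_product split_def mult_ac)
  also have "\<dots> = (\<Sum>r<N. C (mat D D (\<lambda>ij. \<Sum>k\<in>?A. ?c k * ?X k $$ ij)) $$ (r, r))"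
    by (intro sum.cong refl linear_op_sum[OF C, symmetric]) (auto simp: op_block_def)
  also have "mat D D (\<lambda>ij. \<Sum>k\<in>?A. ?c k * ?X k $$ ij) = rank_one D w"
  proof (intro eq_matI)
    fix i j assume "i < dim_row (rank_one D w)" "j < dim_col (rank_one D w)"
    then have ij: "i < D" "j < D" by (auto simp: rank_one_def)
    have op: "op_block D K (rank_one (D * K) F) b b' $$ (i, j) = F (i * K + b) * cnj (F (j * K + b'))"
      if "b < K" "b' < K" for b b'
      using ij that by (simp add: op_block_def rank_one_def index_less_mult)
    have "(\<Sum>k\<in>?A. ?c k * ?X k $$ (i, j)) = (\<Sum>b<K. \<Sum>b'<K. (cnj (g b) * F (i * K
      + b)) * (g b' * cnj (F (j * K + b'))))"
      unfolding sum.cartesian_product using op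
        by (intro sum.cong refl) (auto simp only: prod.case mem_Sigma_iff lessThan_iff mult_ac)
    also have "\<dots> = w i * cnj (w j)" by (simp add: w ij sum_product)
    finally show "mat D D (\<lambda>ij. \<Sum>k\<in>?A. ?c k * ?X k $$ ij) $$ (i, j) = rank_one D w $$ (i, j)"
      using ij by (simp add: rank_one_def)
  qed (auto simp: rank_one_def)
  also have "(\<Sum>r<N. C (rank_one D w) $$ (r, r)) = mtrace (C (rank_one D w))"
    using linear_op_carrier[OF C, of "rank_one D w"] by (simp add: mtrace_carrier)
  also have "\<dots> = complex_of_real (sqnorm D w)" by (rule trace_preserving_rank_one[OF C tp])
  also have "sqnorm D w = (\<Sum>s<D. (cmod (inner K g (\<beta> s)))\<^sup>2)"
    unfolding w_def by (rule sqnorm_\<alpha>_comb)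
  finally show ?thesis .
qed

text \<open>This is \<open>qform_marginal\<close> summed over the standard basis of the receiver's
  space.\<close>

lemma mtrace_encoded:
  assumes C: "linear_op_map D N C" and tp: "\<And>\<sigma>. density_op D \<sigma> \<Longrightarrow> density_op N (C \<sigma>)"
  shows "mtrace (tensor_id D N K C (rank_one (D * K) F)) = 1" (is "mtrace ?\<sigma> = 1")
proof -
  let ?e = "\<lambda>b i. if i = b then 1 else 0 :: complex"
  have ie: "inner K (?e b) v = v b" if "b < K" for b v
  proof -
    have "inner K (?e b) v = (\<Sum>i<K. (if i = b then 1 else 0) * v i)"
      unfolding inner_def by (intro sum.cong refl) auto
    then show ?thesis using that by (simp add: sum_delta_lessThan)
  qed
  have "mtrace ?\<sigma> = (\<Sum>r<N. \<Sum>b<K. ?\<sigma> $$ (r * K + b, r * K + b))"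
    by (subst mtrace_carrier[of _ "N * K"]) (simp_all add: sum_lessThan_mult)
  also have "\<dots> = (\<Sum>b<K. \<Sum>r<N. ?\<sigma> $$ (r * K + b, r * K + b))" by (rule sum.swap)
  also have "\<dots> = (\<Sum>b<K. \<Sum>r<N. qform (N * K) ?\<sigma> (slice_vec K r (?e b)))"
  proof (intro sum.cong refl)
    fix b r assume br: "b \<in> {..<K}" "r \<in> {..<N}"
    have "qform (N * K) ?\<sigma> (slice_vec K r (?e b)) = 
      (\<Sum>b'<K. (if b' = b then 1 else 0) * (\<Sum>b''<K. ?\<sigma> $$ (r * K + b', r * K + b'') * (if b''
        = b then 1 else 0)))"
      using br by (subst qform_slice) (auto simp: sum_distrib_left intro!: sum.cong)
    then show "?\<sigma> $$ (r * K + b, r * K + b) = qform (N * K) ?\<sigma> (slice_vec K r (?e b))"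
      using br by (simp only: sum_delta_lessThan lessThan_iff)
  qed
  also have "\<dots> = (\<Sum>b<K. complex_of_real (\<Sum>s<D. (cmod (\<beta> s b))\<^sup>2))"
    by (intro sum.cong refl) (simp add: qform_marginal[OF C tp] ie)
  also have "\<dots> = complex_of_real (\<Sum>s<D. \<Sum>b<K. (cmod (\<beta> s b))\<^sup>2)"
    by (subst sum.swap) simp
  also have "\<dots> = complex_of_real (\<Sum>s<D. q s)"
  proof (intro arg_cong[of _ _ complex_of_real] sum.cong refl)
    fix s assume "s \<in> {..<D}"
    then have "inner K (\<beta> s) (\<beta> s) = complex_of_real (q s)" by (simp add: \<beta>_orth)
    then show "(\<Sum>b<K. (cmod (\<beta> s b))\<^sup>2) = q s" 
      unfolding inner_self of_real_eq_iff by (simp only: sqnorm_def)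
  qed
  finally show ?thesis by (simp add: q_sum)
qed

lemma psd_encoded: "completely_positive D N C \<Longrightarrow> psd (N * K) (tensor_id D N K C (rank_one (D * K) F))"
  by (simp add: completely_positive_def psd_rank_one)

text \<open>Counting by trace: there are \<open>N * card S\<close> vectors
  \<open>e_r \<otimes> \<beta> s / sqrt (q s)\<close>, each encoded state has mass
  \<open>\<Sum>s\<in>S. q s\<close> on their span, and at each of them all elements of the POVM
  together give 1. Both factors 2 come from \<open>test_bound_by_projection\<close>.\<close>

lemma converse_bound:
  assumes M: "0 < M" and N: "0 < N"
    and C: "\<And>i. i \<in> {1..M} \<Longrightarrow> completely_positive D N (C i)"
    and tp: "\<And>i \<sigma>. i \<in> {1..M} \<Longrightarrow> density_op D \<sigma> \<Longrightarrow> density_op N (C i \<sigma>)"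
    and X: "is_povm (N * K) M X"
    and S: "S \<subseteq> {..<D}" "\<And>s. s \<in> S \<Longrightarrow> 0 < q s"
  defines "\<epsilon> \<equiv> 1 / real M * (\<Sum>i\<in>{1..M}. Re (mtrace (tensor_id D N K (C i) (rank_one (D * K) F) * (1\<^sub>m (N
    * K) - X i))))"
  shows "real M * (1 - \<epsilon> - 2 * (1 - (\<Sum>s\<in>S. q s))) \<le> 2 * real N * real (card S)"
proof -
  define \<sigma> where "\<sigma> i = tensor_id D N K (C i) (rank_one (D * K) F)" for i
  define f where "f = (\<lambda>(r, s). slice_vec K r (\<lambda>b. complex_of_real (1 / sqrt (q s)) * \<beta> s b))"
  let ?I = "{..<N} \<times> S"
  have fS: "finite S" using S(1) finite_subset by blast
  have sq: "complex_of_real (1 / sqrt (q s)) * complex_of_real (1 / sqrt (q s)) * complex_of_real (q s)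
    = 1" if "s \<in> S" for s
    using S(2)[OF that] by (simp flip: of_real_mult)
  have orth: "orthonormal_family (N * K) ?I f"
    unfolding orthonormal_family_def
  proof safe
    fix r s r' s' assume rs: "r < N" "r' < N" "s \<in> S" "s' \<in> S"
    have "inner (N * K) (f (r, s)) (f (r', s')) = (if r
      = r' then complex_of_real (1 / sqrt (q s)) * complex_of_real (1 / sqrt (q s'))
      * inner K (\<beta> s) (\<beta> s') else 0)"
      unfolding f_def prod.case inner_slice[OF rs(1)]
      by (cases "r = r'") (simp_all add: slice_vec_index inner_def sum_distrib_left mult.assoc
        mult.left_commute)
    also have "\<dots> = (if (r, s) = (r', s') then 1 else 0)"
      using rs S(1) sq[of s] by (auto simp: \<beta>_orth subset_iff)
    finally show "inner (N * K) (f (r, s)) (f (r', s')) = (if (r, s) = (r', s') then 1 else 0)" .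
  qed
  \<comment> \<open>With \<open>g\<close> the normalised \<open>\<beta> s\<close>, only the term
    \<open>t = s\<close> of \<open>qform_marginal\<close> survives, and it equals
    \<open>q s\<close>.\<close>
  have mass: "(\<Sum>k\<in>?I. Re (qform (N * K) (\<sigma> i) (f k))) = (\<Sum>s\<in>S. q s)" if i: "i \<in> {1..M}" for i
  proof -
    have "(\<Sum>k\<in>?I. Re (qform (N * K) (\<sigma> i) (f k))) = (\<Sum>s\<in>S. Re (\<Sum>r<N. qform (N * K) (\<sigma> i) (f (r, s))))"
      unfolding Re_sum by (subst sum.swap) (simp add: sum.cartesian_product)
    also have "\<dots> = (\<Sum>s\<in>S. q s)"
    proof (intro sum.cong refl)
      fix s assume s: "s \<in> S"
      then have sD: "s < D" using S by auto
      let ?g = "\<lambda>b. complex_of_real (1 / sqrt (q s)) * \<beta> s b"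
      have g: "inner K ?g (\<beta> t) = (if s = t then complex_of_real (sqrt (q s)) else 0)" if "t < D" for t
      proof -
        have "inner K ?g (\<beta> t) = complex_of_real (1 / sqrt (q s)) * inner K (\<beta> s) (\<beta> t)"
          by (simp add: inner_def sum_distrib_left mult_ac)
        moreover have "1 / sqrt (q s) * q s = sqrt (q s)" using S(2)[OF s] real_div_sqrt[of "q s"] by simp
        then have "complex_of_real (1 / sqrt (q s)) * complex_of_real (q s) = complex_of_real (sqrt (q s))"
          by (simp only: of_real_mult[symmetric])
        ultimately show ?thesis using \<beta>_orth[OF sD that] by (simp only: split: if_splits) auto
      qed
      have "(\<Sum>r<N. qform (N * K) (\<sigma> i) (f (r, s))) = complex_of_real (\<Sum>t<D. (cmod (inner K ?g (\<beta> t)))\<^sup>2)"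
        unfolding f_def \<sigma>_def prod.case using C[OF i] tp[OF i]
        by (intro qform_marginal) (auto simp: completely_positive_def)
      also have "(\<Sum>t<D. (cmod (inner K ?g (\<beta> t)))\<^sup>2) = (\<Sum>t<D. if t = s then q s else 0)"
      proof (intro sum.cong refl)
        fix t assume "t \<in> {..<D}"
        then have t: "t < D" by simp
        show "(cmod (inner K ?g (\<beta> t)))\<^sup>2 = (if t = s then q s else 0)"
          unfolding g[OF t] using q_nonneg[OF sD] by simp
      qed
      finally show "Re (\<Sum>r<N. qform (N * K) (\<sigma> i) (f (r, s))) = q s" using sD by simp
    qed
    finally show ?thesis .
  qed
  have suc: "Re (mtrace (\<sigma> i * X i)) \<le> 2 * (\<Sum>k\<in>?I. Re (qform (N * K) (X i) (f k))) + 2 * (1 - (\<Sum>s\<in>S. q s))"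
    if i: "i \<in> {1..M}" for i
    unfolding mass[OF i, symmetric]
    using C[OF i] tp[OF i] X i fS
    by (intro test_bound_by_projection orth povm_qform_le[OF X i])
      (auto simp: \<sigma>_def psd_encoded is_povm_def completely_positive_def intro!: mtrace_encoded)
  have "real M * \<epsilon> = (\<Sum>i\<in>{1..M}. 1 - Re (mtrace (\<sigma> i * X i)))"
  proof -
    have "real M * \<epsilon> = (\<Sum>i\<in>{1..M}. Re (mtrace (\<sigma> i * (1\<^sub>m (N * K) - X i))))"
      using M by (simp add: \<epsilon>_def \<sigma>_def)
    also have "\<dots> = (\<Sum>i\<in>{1..M}. 1 - Re (mtrace (\<sigma> i * X i)))"
    proof (intro sum.cong refl)
      fix i assume i: "i \<in> {1..M}"
      have "mtrace (\<sigma> i) = 1"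
        unfolding \<sigma>_def using C[OF i] tp[OF i] by (intro mtrace_encoded) (auto simp: completely_positive_def)
      moreover have "\<sigma> i \<in> carrier_mat (N * K) (N * K)" by (simp add: \<sigma>_def tensor_id_def)
      moreover have "X i \<in> carrier_mat (N * K) (N * K)" using X i by (auto simp: is_povm_def intro: psd_carrier)
      ultimately show "Re (mtrace (\<sigma> i * (1\<^sub>m (N * K) - X i))) = 1 - Re (mtrace (\<sigma> i * X i))"
        by (simp add: mtrace_mult_one_minus)
    qed
    finally show ?thesis .
  qed
  then have "real M * (1 - \<epsilon>) = (\<Sum>i\<in>{1..M}. Re (mtrace (\<sigma> i * X i)))"
    by (simp add: sum_subtractf algebra_simps)
  also have "\<dots> \<le> (\<Sum>i\<in>{1..M}. 2 * (\<Sum>k\<in>?I. Re (qform (N * K) (X i) (f k))) + 2 * (1 - (\<Sum>s\<in>S. q s)))"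
    by (intro sum_mono suc)
  also have "\<dots> = 2 * (\<Sum>k\<in>?I. \<Sum>i\<in>{1..M}. Re (qform (N * K) (X i) (f k))) + real M * (2 * (1 - (\<Sum>s\<in>S. q s)))"
    unfolding sum.distrib sum_distrib_left[symmetric] by (subst sum.swap) simp
  \<comment> \<open>The number of messages drops out here: summed over \<open>i\<close>, the
    elements of the POVM form the identity, whose value at a unit vector is 1.\<close>
  also have "(\<Sum>k\<in>?I. \<Sum>i\<in>{1..M}. Re (qform (N * K) (X i) (f k))) = (\<Sum>k\<in>?I. 1)"
  proof (intro sum.cong refl)
    fix k assume k: "k \<in> ?I"
    have "complex_of_real (sqnorm (N * K) (f k)) = 1"
      unfolding inner_self[symmetric] using orth k by (auto simp: orthonormal_family_def)
    then show "(\<Sum>i\<in>{1..M}. Re (qform (N * K) (X i) (f k))) = 1"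
      using arg_cong[OF povm_qform_sum[OF X, of "f k"], of Re] by simp
  qed
  finally show ?thesis by (simp add: algebra_simps card_cartesian_product)
qed

end

section \<open>Kraus maps, Weyl operators and the coding scheme\<close>

text \<open>Kraus form; the entry of the \<open>j\<close>-th Kraus operator in row \<open>r\<close>
  and column \<open>a\<close> is \<open>\<kappa> j r a\<close>.\<close>

definition kraus_map :: "nat \<Rightarrow> nat \<Rightarrow> nat set \<Rightarrow> (nat \<Rightarrow> nat \<Rightarrow> nat \<Rightarrow> complex) \<Rightarrow> complex mat \<Rightarrow> complex mat" where
  "kraus_map D N J \<kappa> X = mat N N (\<lambda>(r, r'). \<Sum>j\<in>J. \<Sum>a<D. \<Sum>a'<D. \<kappa> j r a * X $$ (a, a') * cnj (\<kappa> j r' a'))"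

lemma kraus_linear: "linear_op_map D N (kraus_map D N J \<kappa>)"
  unfolding linear_op_map_def kraus_map_def
  by (intro conjI ballI allI eq_matI) (auto simp: sum.distrib sum_distrib_left algebra_simps)

text \<open>Rows and columns carry separate data \<open>k\<close>, \<open>y\<close> and
  \<open>k'\<close>, \<open>z\<close>, because the row and the column of an entry of
  \<open>tensor_id\<close> may lie in different blocks of the second factor.\<close>

lemma kraus_gram_entry:
  "(\<Sum>j\<in>J. \<Sum>a<D. \<Sum>a'<D. k j a * (\<Sum>m\<in>M. y m a * cnj (z m a')) * cnj (k' j a'))
    = (\<Sum>(j, m)\<in>J \<times> M. (\<Sum>a<D. k j a * y m a) * cnj (\<Sum>a<D. k' j a * z m a))" for D :: nat
proof -
  have "(\<Sum>a<D. \<Sum>a'<D. k j a * (\<Sum>m\<in>M. y m a * cnj (z m a')) * cnj (k' j a'))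
      = (\<Sum>m\<in>M. (\<Sum>a<D. k j a * y m a) * cnj (\<Sum>a<D. k' j a * z m a))" for j
  proof -
    have "(\<Sum>a<D. \<Sum>a'<D. k j a * (\<Sum>m\<in>M. y m a * cnj (z m a')) * cnj (k' j a'))
      = (\<Sum>a<D. \<Sum>a'<D. \<Sum>m\<in>M. (k j a * y m a) * cnj (k' j a' * z m a'))"
      by (intro sum.cong refl) (simp add: sum_distrib_left sum_distrib_right mult_ac)
    also have "\<dots> = (\<Sum>m\<in>M. (\<Sum>a<D. k j a * y m a) * cnj (\<Sum>a<D. k' j a * z m a))"
      unfolding cnj_sum sum_product by (rule sum_rotate[symmetric])
    finally show ?thesis .
  qed
  then show ?thesis by (simp add: sum.cartesian_product)
qed

lemma kraus_gram:
  assumes "gram_of D X M x"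
  shows "gram_of N (kraus_map D N J \<kappa> X) (J \<times> M) (\<lambda>(j, m) r. \<Sum>a<D. \<kappa> j r a * x m a)"
  unfolding gram_of_def
proof (intro conjI allI impI)
  fix r r' assume r: "r < N" "r' < N"
  have "kraus_map D N J \<kappa> X $$ (r, r') = 
     (\<Sum>j\<in>J. \<Sum>a<D. \<Sum>a'<D. \<kappa> j r a * (\<Sum>m\<in>M. x m a * cnj (x m a')) * cnj (\<kappa> j r' a'))"
    unfolding kraus_map_def using r assms by (auto simp: gram_of_def intro!: sum.cong)
  then show "kraus_map D N J \<kappa> X $$ (r, r') =
    (\<Sum>m\<in>J \<times> M. (case m of (j, m) \<Rightarrow> \<lambda>r. \<Sum>a<D. \<kappa> j r a * x m a) r *
      cnj ((case m of (j, m) \<Rightarrow> \<lambda>r. \<Sum>a<D. \<kappa> j r a * x m a) r'))"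
    unfolding kraus_gram_entry by (simp add: split_def)
qed (simp add: kraus_map_def)

text \<open>Each Kraus operator, tensored with the identity, acts on each vector separately. This
  gives complete positivity and, in \<open>direct_coding\<close>, the explicit vectors of an encoded
  state.\<close>

lemma kraus_tensor_gram:
  assumes "gram_of (D * k) X M x"
  shows "gram_of (N * k) (tensor_id D N k (kraus_map D N J \<kappa>) X) (J \<times> M)
    (\<lambda>(j, m) i. \<Sum>a<D. \<kappa> j (i div k) a * x m (a * k + i mod k))"
  unfolding gram_of_def
proof (intro conjI allI impI)
  fix i i' assume i: "i < N * k" "i' < N * k"
  have k: "0 < k" using i by (cases k) auto
  have dm: "i div k < N" "i' div k < N" "i mod k < k" "i' mod k < k"
    using i k by (auto simp: less_mult_imp_div_less)
  have op: "op_block D k X (i mod k) (i' mod k) $$ (a, a') = 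
     (\<Sum>m\<in>M. x m (a * k + i mod k) * cnj (x m (a' * k + i' mod k)))" if "a < D" "a' < D" for a a'
    using assms that dm by (simp add: op_block_def gram_of_def index_less_mult)
  have "tensor_id D N k (kraus_map D N J \<kappa>) X $$ (i, i') = 
     (\<Sum>j\<in>J. \<Sum>a<D. \<Sum>a'<D. \<kappa> j (i div k) a * (\<Sum>m\<in>M. x m (a * k + i mod k) * cnj (x m (a' * k
       + i' mod k))) * cnj (\<kappa> j (i' div k) a'))"
    unfolding tensor_id_def kraus_map_def using i dm by (auto simp: op intro!: sum.cong)
  then show "tensor_id D N k (kraus_map D N J \<kappa>) X $$ (i, i') =
    (\<Sum>m\<in>J \<times> M. (case m of (j, m) \<Rightarrow> \<lambda>i. \<Sum>a<D. \<kappa> j (i div k) a * x m (a * k + i mod k)) i *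
      cnj ((case m of (j, m) \<Rightarrow> \<lambda>i. \<Sum>a<D. \<kappa> j (i div k) a * x m (a * k + i mod k)) i'))"
    unfolding kraus_gram_entry by (simp add: split_def)
qed simp

lemma kraus_cp: "completely_positive D N (kraus_map D N J \<kappa>)"
  unfolding completely_positive_def
proof (intro conjI allI impI kraus_linear)
  fix k X assume "psd (D * k) X"
  then obtain x where "gram_of (D * k) X {..<D * k} x" by (rule psd_gram)
  from gram_psd[OF kraus_tensor_gram[OF this]] show "psd (N * k) (tensor_id D N k (kraus_map D N J \<kappa>) X)" .
qed

lemma kraus_density:
  assumes tp: "\<And>a a'. a < D \<Longrightarrow> a' < D \<Longrightarrow> (\<Sum>j\<in>J. \<Sum>r<N. \<kappa> j r a * cnj (\<kappa> j r a')) = (if a = a' then 1 else 0)"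
    and \<sigma>: "density_op D \<sigma>"
  shows "density_op N (kraus_map D N J \<kappa> \<sigma>)"
proof -
  from \<sigma> have p: "psd D \<sigma>" and t: "mtrace \<sigma> = 1" by (auto simp: density_op_def)
  obtain x where "gram_of D \<sigma> {..<D} x" using psd_gram[OF p] .
  from gram_psd[OF kraus_gram[OF this]] have pk: "psd N (kraus_map D N J \<kappa> \<sigma>)" .
  have "mtrace (kraus_map D N J \<kappa> \<sigma>) = (\<Sum>r<N. \<Sum>j\<in>J. \<Sum>a<D. \<Sum>a'<D. \<kappa> j r a * \<sigma> $$ (a, a') * cnj (\<kappa> j r a'))"
    by (simp add: mtrace_def kraus_map_def)
  also have "\<dots> = (\<Sum>j\<in>J. \<Sum>a<D. \<Sum>a'<D. \<Sum>r<N. \<kappa> j r a * \<sigma> $$ (a, a') * cnj (\<kappa> j r a'))"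
    by (rule trans[OF sum.swap], rule sum.cong[OF refl], rule sum_rotate)
  also have "\<dots> = (\<Sum>a<D. \<Sum>a'<D. \<sigma> $$ (a, a') * (\<Sum>j\<in>J. \<Sum>r<N. \<kappa> j r a * cnj (\<kappa> j r a')))"
    by (subst sum_rotate) (simp add: sum_distrib_left mult_ac)
  also have "\<dots> = (\<Sum>a<D. \<Sum>a'<D. \<sigma> $$ (a, a') * (if a = a' then 1 else 0))"
    by (intro sum.cong refl) (simp add: tp)
  also have "\<dots> = mtrace \<sigma>" using psd_carrier[OF p] by (simp add: sum_delta_lessThan mtrace_carrier)
  finally show ?thesis using t pk by (simp add: density_op_def)
qed

section \<open>Generalised Pauli operators on level sets\<close>

lemma mod_add_cancel_nat:
  fixes u x y n :: nat
  assumes "(u + x) mod n = (u + y) mod n" "x < n" "y < n"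
  shows "x = y"
proof -
  have *: "x = y" if "(u + x) mod n = (u + y) mod n" "x < n" "y \<le> x" for x y
  proof -
    have "n dvd (u + x) - (u + y)" using that mod_eq_dvd_iff_nat[of "u + y" "u + x" n] by simp
    then show ?thesis using that nat_dvd_not_less[of "x - y" n] by (cases "x = y") auto
  qed
  show ?thesis using *[of x y] *[of y x] assms by (cases "y \<le> x") auto
qed

text \<open>The summands are the powers of the ratio of two distinct \<open>d\<close>-th roots of
  unity, so the geometric sum vanishes.\<close>

lemma sum_roots_of_unity_power:
  fixes y z d :: nat
  assumes "y < d" "z < d" "y \<noteq> z"
  shows "(\<Sum>j<d. cnj (cis (2 * pi * y / d) ^ j) * cis (2 * pi * z / d) ^ j) = 0"
proof -
  let ?e = "\<lambda>k. cis (2 * pi * real k / real d)"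
  define w where "w = cnj (?e y) * ?e z"
  have d: "0 < d" using assms by simp
  have ed: "?e k ^ d = 1" for k using d by (simp add: DeMoivre)
  have "?e y \<noteq> ?e z" using bij_betw_roots_unity[OF d] assms
    by (auto simp: bij_betw_def inj_on_def)
  moreover have "?e y * cnj (?e y) = 1" by (simp add: cis_mult cis_cnj)
  ultimately have w1: "w \<noteq> 1" unfolding w_def
  proof -
    assume ne: "?e y \<noteq> ?e z" and un: "?e y * cnj (?e y) = 1"
    have "?e y * (cnj (?e y) * ?e z) = ?e z" using un by (simp only: mult.assoc[symmetric] mult_1_left)
    then show "cnj (?e y) * ?e z \<noteq> 1" using ne by (metis mult.right_neutral)
  qed
  have wd: "w ^ d = 1" unfolding w_def power_mult_distrib by (simp add: ed flip: complex_cnj_power)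
  have "(\<Sum>j<d. cnj (?e y ^ j) * ?e z ^ j) = (\<Sum>j<d. w ^ j)"
    by (simp add: w_def power_mult_distrib)
  also have "\<dots> = 0" using geometric_sum[OF w1, of d] wd by simp
  finally show ?thesis .
qed

text \<open>
  In each level set of \<open>q\<close>, message \<open>i\<close> acts as the generalised Pauli (shift and clock) operator whose
  two exponents are the base-\<open>card (L v)\<close> digits of \<open>i - 1\<close>.
\<close>

lemma weyl_family:
  fixes q :: "nat \<Rightarrow> real" and S :: "nat set"
  assumes S: "finite S"
  defines "L \<equiv> \<lambda>v. {s \<in> S. q s = v}"
  assumes M: "\<And>v. v \<in> q ` S \<Longrightarrow> M \<le> (card (L v))\<^sup>2"
  obtains \<pi> :: "nat \<Rightarrow> nat \<Rightarrow> nat" and c :: "nat \<Rightarrow> nat \<Rightarrow> complex" where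
    "\<And>i. i \<in> {1..M} \<Longrightarrow> inj_on (\<pi> i) S" "\<And>i s. s \<in> S \<Longrightarrow> \<pi> i s < card S" "\<And>i s. cnj (c i s) * c i s = 1"
    "\<And>i i' v. i \<in> {1..M} \<Longrightarrow> i' \<in> {1..M} \<Longrightarrow> i \<noteq> i' \<Longrightarrow>
      (\<Sum>s\<in>L v. if \<pi> i s = \<pi> i' s then cnj (c i s) * c i' s else 0) = 0"
proof -
  have fL: "finite (L v)" for v using S by (simp add: L_def)
  obtain num where num: "bij_betw num S {..<card S}"
    using ex_bij_betw_finite_nat[OF S] by (auto simp: atLeast0LessThan)
  have "\<exists>e. bij_betw e (L v) {..<card (L v)}" for v
    using ex_bij_betw_finite_nat[OF fL[of v]] by (simp add: atLeast0LessThan)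
  then obtain e where e: "\<And>v. bij_betw (e v) (L v) {..<card (L v)}" by metis
  define d where "d v = card (L v)" for v
  define h where "h v = inv_into (L v) (e v)" for v
  \<comment> \<open>The shift is cyclic in the numbering \<open>e\<close> of the level set and never
    leaves it. Only afterwards does \<open>num\<close> rename \<open>S\<close> to
    \<open>{..<card S}\<close>, the labels of the system sent.\<close>
  define sh where "sh i s = h (q s) ((e (q s) s + (i - 1) div d (q s)) mod d (q s))" for i s
  define \<pi> where "\<pi> i s = num (sh i s)" for i s
  define c where "c i s = cis (2 * pi * real ((i - 1) mod d (q s)) / real (d (q s))) ^ e (q s) s" for i s
  have sL: "s \<in> L (q s)" if "s \<in> S" for s using that by (simp add: L_def)
  have dpos: "0 < d (q s)" if "s \<in> S" for s
    using sL[OF that] fL[of "q s"] by (auto simp: d_def card_gt_0_iff)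
  have e_lt: "e v s < d v" if "s \<in> L v" for s v
    using bij_betwE[OF e] that by (auto simp: d_def)
  have eh: "e v (h v j) = j" "h v j \<in> L v" if "j < d v" for v j
    using that e[of v] unfolding h_def d_def
    by (auto simp: bij_betw_inv_into_right intro: inv_into_into simp: bij_betw_def)
  have sh_L: "sh i s \<in> L (q s)" "e (q s) (sh i s)
    = (e (q s) s + (i - 1) div d (q s)) mod d (q s)" if "s \<in> S" for i s
    using eh dpos[OF that] by (auto simp: sh_def)
  have sh_S: "sh i s \<in> S" "q (sh i s) = q s" if "s \<in> S" for i s
    using sh_L[OF that] by (auto simp: L_def)
  have num_inj: "num s = num t \<longleftrightarrow> s = t" if "s \<in> S" "t \<in> S" for s t
    using num that by (auto simp: bij_betw_def inj_on_def)
  show thesis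
  proof
    fix i assume "i \<in> {1..M}"
    show "inj_on (\<pi> i) S"
    proof (rule inj_onI)
      fix s t assume st: "s \<in> S" "t \<in> S" "\<pi> i s = \<pi> i t"
      then have "sh i s = sh i t" by (simp add: \<pi>_def num_inj sh_S)
      then have v: "q s = q t" using sh_S st by metis
      have "(e (q s) s + (i - 1) div d (q s)) mod d (q s) = (e (q s) t + (i - 1) div d (q s)) mod d (q s)"
        using sh_L(2)[OF st(1), of i] sh_L(2)[OF st(2), of i] \<open>sh i s = sh i t\<close> v by simp
      then have "e (q s) s = e (q s) t"
        using mod_add_cancel_nat[of "(i - 1) div d (q s)" "e (q s) s" "d (q s)" "e (q s) t"]
          e_lt[OF sL[OF st(1)]] e_lt[OF sL[OF st(2)]] v by (simp add: add.commute)
      then show "s = t" using e[of "q s"] sL[OF st(1)] sL[OF st(2)] v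
        by (auto simp: bij_betw_def inj_on_def)
    qed
  next
    fix i s assume "s \<in> S"
    then show "\<pi> i s < card S" using num sh_S[of s i] by (auto simp: \<pi>_def bij_betw_def)
  next
    fix i s show "cnj (c i s) * c i s = 1"
      by (simp add: c_def cis_cnj cis_mult flip: power_mult_distrib)
  next
    fix i i' v assume i: "i \<in> {1..M}" "i' \<in> {1..M}" "i \<noteq> i'"
    show "(\<Sum>s\<in>L v. if \<pi> i s = \<pi> i' s then cnj (c i s) * c i' s else 0) = 0"
    proof (cases "L v = {}")
      case False
      then have v: "v \<in> q ` S" by (auto simp: L_def)
      have Md: "M \<le> d v * d v" using M[OF v] by (simp add: d_def power2_eq_square)
      have dv: "0 < d v" using False fL[of v] by (simp add: d_def card_gt_0_iff)
      \<comment> \<open>Here the bound on \<open>M\<close> enters: it makes the quotient a genuine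
        digit, so that unequal quotients are unequal shifts modulo \<open>d v\<close>.\<close>
      have lt: "(i - 1) div d v < d v" "(i' - 1) div d v < d v"
        using i Md by (auto intro!: less_mult_imp_div_less)
      have \<pi>eq: "\<pi> i s = \<pi> i' s \<longleftrightarrow> (i - 1) div d v = (i' - 1) div d v" if "s \<in> L v" for s
      proof -
        have s: "s \<in> S" "q s = v" using that by (auto simp: L_def)
        have "\<pi> i s = \<pi> i' s \<longleftrightarrow> sh i s = sh i' s" using s by (simp add: \<pi>_def num_inj sh_S)
        also have "\<dots> \<longleftrightarrow> e v (sh i s) = e v (sh i' s)"
          using sh_L(1)[OF s(1)] s(2) e[of v] by (auto simp: bij_betw_def inj_on_def)
        also have "\<dots> \<longleftrightarrow> (i - 1) div d v = (i' - 1) div d v"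
          using sh_L(2)[OF s(1), of i] sh_L(2)[OF s(1), of i'] s(2)
            mod_add_cancel_nat[of "e v s" "(i - 1) div d v" "d v" "(i' - 1) div d v"] lt by auto
        finally show ?thesis .
      qed
      show ?thesis
      \<comment> \<open>With unequal shifts no \<open>s\<close> has the same image under both
        messages, so every term is 0. With equal shifts the remainders differ, and the phases cancel
        over the numbering of the level set.\<close>
      proof (cases "(i - 1) div d v = (i' - 1) div d v")
        case True
        have "i - 1 \<noteq> i' - 1" using i by auto
        with True have ne: "(i - 1) mod d v \<noteq> (i' - 1) mod d v" by (metis div_mult_mod_eq)
        let ?w = "\<lambda>i. cis (2 * pi * real ((i - 1) mod d v) / real (d v))"
        have "(\<Sum>s\<in>L v. if \<pi> i s = \<pi> i' s then cnj (c i s) * c i' s else 0)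
          = (\<Sum>s\<in>L v. cnj (?w i ^ e v s) * ?w i' ^ e v s)"
          using True by (intro sum.cong refl) (auto simp: \<pi>eq c_def L_def)
        also have "\<dots> = (\<Sum>j<d v. cnj (?w i ^ j) * ?w i' ^ j)"
          using e[of v] unfolding d_def by (rule sum.reindex_bij_betw)
        also have "\<dots> = 0" using ne dv by (intro sum_roots_of_unity_power) auto
        finally show ?thesis .
      qed (simp add: \<pi>eq)
    qed simp
  qed
qed

section \<open>Encoder and decoder for a vector in Schmidt form\<close>

context schmidt_state
begin

lemma slice_beta_inner:
  assumes "r < N" "r' < N" "s < D" "t < D"
  shows "inner (N * K) (slice_vec K r (\<beta> s)) (slice_vec K r' (\<beta> t)) = (if r = r' \<and> s
    = t then complex_of_real (q s) else 0)"
  unfolding inner_slice[OF assms(1)]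
  using \<beta>_orth[OF assms(3,4)] by (cases "r = r'") (simp_all add: slice_vec_index inner_def)

lemma \<alpha>_F:
  assumes "s < D" "b < K"
  shows "(\<Sum>a<D. cnj (\<alpha> s a) * F (a * K + b)) = \<beta> s b"
proof -
  have "(\<Sum>a<D. cnj (\<alpha> s a) * F (a * K + b)) = (\<Sum>a<D. \<Sum>t<D. \<beta> t b * (cnj (\<alpha> s a) * \<alpha> t a))"
    using assms by (intro sum.cong refl) (simp add: F sum_distrib_left mult_ac)
  also have "\<dots> = (\<Sum>t<D. \<beta> t b * inner D (\<alpha> s) (\<alpha> t))"
    unfolding inner_def sum_distrib_left by (rule sum.swap)
  also have "\<dots> = (\<Sum>t<D. \<beta> t b * (if s = t then 1 else 0))"
    using assms by (intro sum.cong refl) (simp add: \<alpha>_orth)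
  finally show ?thesis using assms by (simp add: sum_delta_lessThan)
qed

text \<open>
  \<open>|\<alpha> s\<rangle> \<mapsto> c s |\<pi> s\<rangle>\<close> on the span of the \<open>\<alpha> s\<close> with \<open>s \<in> S\<close>; the orthogonal complement is
  measured and sent to \<open>|0\<rangle>\<close>, which restores trace preservation.
\<close>

definition enc_kraus :: "nat set \<Rightarrow> (nat \<Rightarrow> nat) \<Rightarrow> (nat \<Rightarrow> complex) \<Rightarrow> nat \<Rightarrow> nat \<Rightarrow> nat \<Rightarrow> complex" where
  "enc_kraus S \<pi> c j r a = (case j of
      0 \<Rightarrow> (\<Sum>s\<in>S. if \<pi> s = r then c s * cnj (\<alpha> s a) else 0)
    | Suc s \<Rightarrow> if s \<notin> S \<and> r = 0 then cnj (\<alpha> s a) else 0)"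

text \<open>By injectivity of \<open>\<pi>\<close>, operator 0 is isometric on the span of the
  \<open>\<alpha> s\<close> with \<open>s \<in> S\<close> and contributes the projection onto it.
  Each further operator contributes at most one of the missing \<open>\<alpha> s\<close>, and
  completeness adds everything up to the identity.\<close>

lemma enc_kraus_tp:
  assumes S: "S \<subseteq> {..<D}" and \<pi>: "inj_on \<pi> S" "\<And>s. s \<in> S \<Longrightarrow> \<pi> s < N" and N: "0 < N"
    and c: "\<And>s. cnj (c s) * c s = 1" and a: "a < D" "a' < D"
  shows "(\<Sum>j<Suc D. \<Sum>r<N. enc_kraus S \<pi> c j r a * cnj (enc_kraus S \<pi> c j r a')) = (if a = a' then 1 else 0)"
proof -
  have fS: "finite S" using S finite_subset by blast
  have "(\<Sum>r<N. enc_kraus S \<pi> c 0 r a * cnj (enc_kraus S \<pi> c 0 r a'))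
    = (\<Sum>r<N. \<Sum>s\<in>S. \<Sum>t\<in>S. if \<pi> s = r then (if \<pi> t
      = r then (c s * cnj (\<alpha> s a)) * cnj (c t * cnj (\<alpha> t a')) else 0) else 0)"
    unfolding enc_kraus_def cnj_sum by (simp add: sum_product if_distrib[of cnj]) (intro sum.cong refl, auto)
  also have "\<dots> = (\<Sum>s\<in>S. \<Sum>t\<in>S. \<Sum>r<N. if \<pi> s = r then (if \<pi> t
    = r then (c s * cnj (\<alpha> s a)) * cnj (c t * cnj (\<alpha> t a')) else 0) else 0)"
    by (rule sum_rotate)
  also have "\<dots> = (\<Sum>s\<in>S. \<Sum>t\<in>S. if s = t then (c s * cnj (\<alpha> s a)) * cnj (c t * cnj (\<alpha> t a')) else 0)"
    using \<pi> by (intro sum.cong refl) (auto simp: inj_on_def)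
  also have "\<dots> = (\<Sum>s\<in>S. (cnj (c s) * c s) * (\<alpha> s a' * cnj (\<alpha> s a)))"
    using fS by (simp add: mult_ac)
  also have "\<dots> = (\<Sum>s\<in>S. \<alpha> s a' * cnj (\<alpha> s a))" unfolding c by simp
  finally have main: "(\<Sum>r<N. enc_kraus S \<pi> c 0 r a * cnj (enc_kraus S \<pi> c 0 r a'))
    = (\<Sum>s\<in>S. \<alpha> s a' * cnj (\<alpha> s a))" .
  have rest: "(\<Sum>r<N. enc_kraus S \<pi> c (Suc s) r a * cnj (enc_kraus S \<pi> c (Suc s) r a'))
    = (if s \<notin> S then \<alpha> s a' * cnj (\<alpha> s a) else 0)" for s
  proof -
    have "(\<Sum>r<N. enc_kraus S \<pi> c (Suc s) r a * cnj (enc_kraus S \<pi> c (Suc s) r a')) = (\<Sum>r<N. if r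
      = 0 then (if s \<notin> S then \<alpha> s a' * cnj (\<alpha> s a) else 0) else 0)"
      by (intro sum.cong refl) (simp add: enc_kraus_def)
    then show ?thesis using N by simp
  qed
  have "(\<Sum>j<Suc D. \<Sum>r<N. enc_kraus S \<pi> c j r a * cnj (enc_kraus S \<pi> c j r a'))
    = (\<Sum>s\<in>S. \<alpha> s a' * cnj (\<alpha> s a)) + (\<Sum>s<D. if s \<notin> S then \<alpha> s a' * cnj (\<alpha> s a) else 0)"
    unfolding sum.lessThan_Suc_shift main rest ..
  also have "(\<Sum>s<D. if s \<notin> S then \<alpha> s a' * cnj (\<alpha> s a) else 0) = (\<Sum>s\<in>{..<D} - S. \<alpha> s a' * cnj (\<alpha> s a))"
    by (simp add: sum.If_cases Diff_eq Collect_neg_eq)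
  also have "(\<Sum>s\<in>S. \<alpha> s a' * cnj (\<alpha> s a)) + \<dots> = (\<Sum>s<D. \<alpha> s a' * cnj (\<alpha> s a))"
    using sum.subset_diff[OF S, of "\<lambda>s. \<alpha> s a' * cnj (\<alpha> s a)"] by (simp add: add.commute)
  finally show ?thesis using \<alpha>_complete[OF a(2) a(1)] by auto
qed

text \<open>Contracting the sender's factor of \<open>F\<close> with \<open>\<alpha> s\<close>
  leaves \<open>\<beta> s\<close>, by \<open>\<alpha>_F\<close>; operator 0 attaches the new label
  \<open>\<pi> s\<close> and the phase.\<close>

lemma enc_kraus_main:
  assumes S: "S \<subseteq> {..<D}" and "i < N * K"
  shows "(\<Sum>a<D. enc_kraus S \<pi> c 0 (i div K) a * F (a * K + i mod K)) = (\<Sum>s\<in>S. c s * slice_vec K (\<pi> s) (\<beta> s) i)"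
proof -
  have "0 < K" using assms(2) by (cases K) auto
  have "(\<Sum>a<D. enc_kraus S \<pi> c 0 (i div K) a * F (a * K + i mod K))
    = (\<Sum>a<D. \<Sum>s\<in>S. (if \<pi> s = i div K then c s * (cnj (\<alpha> s a) * F (a * K + i mod K)) else 0))"
    by (intro sum.cong refl) (simp add: enc_kraus_def sum_distrib_right if_distrib[of "\<lambda>x. x
      * _"] mult.assoc cong: if_cong)
  also have "\<dots> = (\<Sum>s\<in>S. \<Sum>a<D. (if \<pi> s = i div K then c s * (cnj (\<alpha> s a) * F (a * K + i mod K)) else 0))"
    by (rule sum.swap)
  also have "\<dots> = (\<Sum>s\<in>S. if \<pi> s = i div K then c s * (\<Sum>a<D. cnj (\<alpha> s a) * F (a * K + i mod K)) else 0)"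
    by (intro sum.cong refl) (simp add: sum_distrib_left)
  also have "\<dots> = (\<Sum>s\<in>S. c s * slice_vec K (\<pi> s) (\<beta> s) i)"
  proof (intro sum.cong refl)
    fix s assume "s \<in> S"
    then have "s < D" using S by auto
    then show "(if \<pi> s = i div K then c s * (\<Sum>a<D. cnj (\<alpha> s a) * F (a * K + i mod K)) else 0)
      = c s * slice_vec K (\<pi> s) (\<beta> s) i"
      using \<open>0 < K\<close> by (auto simp: slice_vec_def \<alpha>_F)
  qed
  finally show ?thesis .
qed

lemma inner_cong: "(\<And>i. i < d \<Longrightarrow> v i = w i) \<Longrightarrow> inner d u v = inner d u w"
  unfolding inner_def by (intro sum.cong refl) auto

text \<open>For message \<open>i\<close> the decoder tests for the span of the vectors
  \<open>\<psi> (i, v)\<close>, one per level set. The cancellation in \<open>weyl_family\<close>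
  makes them orthonormal over all pairs, so the error is bounded by the part of the state outside
  \<open>S\<close>.\<close>

lemma direct_coding:
  assumes S: "S \<subseteq> {..<D}" "S \<noteq> {}" "\<And>s. s \<in> S \<Longrightarrow> 0 < q s"
    and M: "0 < M" "\<And>v. v \<in> q ` S \<Longrightarrow> M \<le> (card {s \<in> S. q s = v})\<^sup>2"
  defines "N \<equiv> card S"
  obtains C X where
    "\<And>i. i \<in> {1..M} \<Longrightarrow> completely_positive D N (C i)"
    "\<And>i \<sigma>. i \<in> {1..M} \<Longrightarrow> density_op D \<sigma> \<Longrightarrow> density_op N (C i \<sigma>)"
    "is_povm (N * K) M X"
    "\<And>i. i \<in> {1..M} \<Longrightarrow> 0 \<le> Re (mtrace (tensor_id D N K (C i) (rank_one (D * K) F) * (1\<^sub>m (N * K) - X i)))"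
    "\<And>i. i \<in> {1..M} \<Longrightarrow> Re (mtrace (tensor_id D N K (C i) (rank_one (D * K) F) * (1\<^sub>m (N * K) - X i)))
      \<le> 1 - (\<Sum>s\<in>S. q s)"
proof -
  have fS: "finite S" using S(1) finite_subset by blast
  have N: "0 < N" using S(2) fS by (simp add: N_def card_gt_0_iff)
  define L where "L v = {s \<in> S. q s = v}" for v
  obtain \<pi> c where \<pi>: "\<And>i. i \<in> {1..M} \<Longrightarrow> inj_on (\<pi> i) S" "\<And>i s. s \<in> S \<Longrightarrow> \<pi> i s < N"
    and c: "\<And>i s. cnj (c i s) * c i s = 1"
    and weyl: "\<And>i i' v. i \<in> {1..M} \<Longrightarrow> i' \<in> {1..M} \<Longrightarrow> i \<noteq> i' \<Longrightarrow>
      (\<Sum>s\<in>L v. if \<pi> i s = \<pi> i' s then cnj (c i s) * c i' s else 0) = 0"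
    by (rule weyl_family[OF fS M(2), folded L_def N_def]) blast+
  have LS: "L v \<subseteq> S" for v by (auto simp: L_def)
  have fL: "finite (L v)" for v using fS LS finite_subset by blast
  define V where "V = q ` S"
  have fV: "finite V" using fS by (simp add: V_def)
  \<comment> \<open>The probability of level \<open>v\<close>, which is also the square norm of the
    corresponding part of the encoded vector; \<open>g v\<close> below normalises that part.\<close>
  define w where "w v = real (card (L v)) * v" for v
  have w: "0 < w v" if "v \<in> V" for v
    using that S(3) fL[of v] by (auto simp: w_def V_def L_def card_gt_0_iff intro!: mult_pos_pos)
  define g where "g v = complex_of_real (1 / sqrt (w v))" for v
  have cg: "cnj (g v) = g v" for v by (simp add: g_def)
  have gg: "g v * g v * complex_of_real (w v) = 1" if "v \<in> V" for v
    using w[OF that] unfolding g_def by (simp flip: of_real_mult)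
  define \<psi> where "\<psi> = (\<lambda>(i, v) x. \<Sum>s\<in>L v. (g v * c i s) * slice_vec K (\<pi> i s) (\<beta> s) x)"
  \<comment> \<open>The unnormalised output of Kraus operator 0 for message \<open>i\<close>, summed
    over all levels.\<close>
  define \<chi> where "\<chi> i x = (\<Sum>s\<in>S. c i s * slice_vec K (\<pi> i s) (\<beta> s) x)" for i x
  have sl: "inner (N * K) (slice_vec K (\<pi> i s) (\<beta> s)) (slice_vec K (\<pi> i' t) (\<beta> t)) =
      (if \<pi> i s = \<pi> i' t \<and> s = t then complex_of_real (q s) else 0)" if "s \<in> S" "t \<in> S" for i i' s t
    using that \<pi>(2) S(1) by (intro slice_beta_inner) auto
  have psi_slices: "inner (N * K) (\<psi> (i, v)) (\<lambda>x. \<Sum>t\<in>T. b t * slice_vec K (\<pi> i' t) (\<beta> t) x)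
      = g v * complex_of_real v * (\<Sum>s\<in>L v \<inter> T. if \<pi> i s = \<pi> i' s then cnj (c i s) * b s else 0)"
    if T: "T \<subseteq> S" for i i' v T b
  proof -
    have fT: "finite T" using fS T finite_subset by blast
    have "inner (N * K) (\<psi> (i, v)) (\<lambda>x. \<Sum>t\<in>T. b t * slice_vec K (\<pi> i' t) (\<beta> t) x)
      = (\<Sum>s\<in>L v. cnj (g v * c i s) * (\<Sum>t\<in>T. b t * (if \<pi> i s = \<pi> i' t \<and> s
        = t then complex_of_real (q s) else 0)))"
      unfolding \<psi>_def prod.case inner_sum_left inner_sum_right
      using LS T by (intro sum.cong refl arg_cong2[of _ _ _ _ "(*)"]) (auto simp: sl subset_iff)
    also have "\<dots> = (\<Sum>s\<in>L v. if s \<in> T then g v * complex_of_real v * (if \<pi> i s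
      = \<pi> i' s then cnj (c i s) * b s else 0) else 0)"
    proof (intro sum.cong refl)
      fix s assume s: "s \<in> L v"
      have "(\<Sum>t\<in>T. b t * (if \<pi> i s = \<pi> i' t \<and> s = t then complex_of_real (q s) else 0))
        = (\<Sum>t\<in>T. if s = t then b s * (if \<pi> i s = \<pi> i' s then complex_of_real (q s) else 0) else 0)"
        by (intro sum.cong refl) auto
      also have "\<dots> = (if s \<in> T then b s * (if \<pi> i s = \<pi> i' s then complex_of_real (q s) else 0) else 0)"
        using fT by simp
      finally show "cnj (g v * c i s) * (\<Sum>t\<in>T. b t * (if \<pi> i s = \<pi> i' t \<and> s
        = t then complex_of_real (q s) else 0))
        = (if s \<in> T then g v * complex_of_real v * (if \<pi> i s = \<pi> i' s then cnj (c i s) * b s else 0) else 0)"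
        using s by (simp add: cg L_def)
    qed
    also have "\<dots> = g v * complex_of_real v * (\<Sum>s\<in>L v \<inter> T. if \<pi> i s = \<pi> i' s then cnj (c i s) * b s else 0)"
      unfolding sum_distrib_left using fL by (simp add: sum.inter_restrict)
    finally show ?thesis .
  qed
  have psi_orth: "orthonormal_family (N * K) ({1..M} \<times> V) \<psi>"
    unfolding orthonormal_family_def
  proof safe
    fix i v i' v' assume iv: "i \<in> {1..M}" "i' \<in> {1..M}" "v \<in> V" "v' \<in> V"
    have "inner (N * K) (\<psi> (i, v)) (\<psi> (i', v')) = g v * complex_of_real v * (\<Sum>s\<in>L v \<inter> L v'. if \<pi> i s
      = \<pi> i' s then cnj (c i s) * (g v' * c i' s) else 0)"
      by (subst (2) \<psi>_def) (simp add: psi_slices[OF LS])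
    also have "\<dots> = (if (i, v) = (i', v') then 1 else 0)"
    proof (cases "v = v'")
      case True
      have "(\<Sum>s\<in>L v. if \<pi> i s = \<pi> i' s then cnj (c i s) * (g v' * c i' s) else 0)
         = g v * (\<Sum>s\<in>L v. if \<pi> i s = \<pi> i' s then cnj (c i s) * c i' s else 0)"
        unfolding True sum_distrib_left by (intro sum.cong refl) auto
      moreover have "(\<Sum>s\<in>L v. if \<pi> i s = \<pi> i' s then cnj (c i s) * c i' s else 0) = (if i
        = i' then complex_of_real (real (card (L v))) else 0)"
        using weyl[OF iv(1,2), of v] by (simp add: c)
      ultimately show ?thesis using True gg[OF iv(3)] by (simp add: w_def mult_ac)
    next
      case False
      then have "L v \<inter> L v' = {}" by (auto simp: L_def)
      with False show ?thesis by simp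
    qed
    finally show "inner (N * K) (\<psi> (i, v)) (\<psi> (i', v')) = (if (i, v) = (i', v') then 1 else 0)" .
  qed
  have psi_chi: "(cmod (inner (N * K) (\<psi> (i, v)) (\<chi> i)))\<^sup>2 = w v" if "v \<in> V" for i v
  proof -
    have "inner (N * K) (\<psi> (i, v)) (\<chi> i) = g v * complex_of_real v * (\<Sum>s\<in>L v \<inter> S. if \<pi> i s
      = \<pi> i s then cnj (c i s) * c i s else 0)"
      unfolding \<chi>_def by (rule psi_slices) simp
    also have "\<dots> = g v * complex_of_real (w v)"
    proof -
      have "(\<Sum>s\<in>L v \<inter> S. if \<pi> i s = \<pi> i s then cnj (c i s) * c i s else 0) = of_nat (card (L v))"
        using LS[of v] by (simp add: c Int_absorb2)
      then show ?thesis by (simp add: w_def mult_ac)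
    qed
    also have "\<dots> = complex_of_real (sqrt (w v))"
    proof -
      have "1 / sqrt (w v) * w v = sqrt (w v)" using real_div_sqrt[of "w v"] w[OF that] by simp
      then show ?thesis unfolding g_def by (simp only: of_real_mult[symmetric])
    qed
    finally show ?thesis using w[OF that] by simp
  qed
  have w_sum: "(\<Sum>v\<in>V. w v) = (\<Sum>s\<in>S. q s)"
  proof -
    have "(\<Sum>s\<in>S. q s) = (\<Sum>v\<in>V. \<Sum>s\<in>L v. q s)"
      unfolding V_def L_def by (rule sum.image_gen[OF fS])
    also have "\<dots> = (\<Sum>v\<in>V. w v)" by (intro sum.cong refl) (simp add: L_def w_def)
    finally show ?thesis ..
  qed
  define C where "C i = kraus_map D N {..<Suc D} (enc_kraus S (\<pi> i) (c i))" for i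
  have cp: "completely_positive D N (C i)" for i by (simp add: C_def kraus_cp)
  have tp: "density_op N (C i \<sigma>)" if "i \<in> {1..M}" "density_op D \<sigma>" for i \<sigma>
    unfolding C_def using that(2)
    by (rule kraus_density[rotated]) (rule enc_kraus_tp[OF S(1) \<pi>(1)[OF that(1)] \<pi>(2) N c])
  define Y where "Y i = mat (N * K) (N * K) (\<lambda>(x, y). \<Sum>v\<in>V. \<psi> (i, v) x * cnj (\<psi> (i, v) y))" for i
  have Yg: "gram_of (N * K) (Y i) V (\<lambda>v. \<psi> (i, v))" for i by (simp add: gram_of_def Y_def)
  \<comment> \<open>Message 1 also receives the complement of all the projections, so that the
    elements add up to the identity.\<close>
  define X where "X i = (if i = 1 then mat (N * K) (N * K) (\<lambda>(x, y). (if x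
    = y then 1 else 0) - (\<Sum>k\<in>{2..M}. Y k $$ (x, y))) else Y i)" for i
  have Xc: "X i \<in> carrier_mat (N * K) (N * K)" for i by (simp add: X_def Y_def)
  have qX1: "qform (N * K) (X 1) u = complex_of_real (sqnorm (N
    * K) u - (\<Sum>k\<in>{2..M}. \<Sum>v\<in>V. (cmod (inner (N * K) (\<psi> (k, v)) u))\<^sup>2))" for u
  proof -
    have "qform (N * K) (X 1) u = (\<Sum>i<N * K. \<Sum>j<N * K. cnj (u i) * u j * (if i = j then 1 else 0))
        - (\<Sum>i<N * K. \<Sum>j<N * K. \<Sum>k\<in>{2..M}. cnj (u i) * Y k $$ (i, j) * u j)"
      unfolding qform_def sum_subtractf[symmetric]
      by (intro sum.cong refl) (simp add: X_def algebra_simps sum_distrib_left sum_distrib_right)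
    also have "(\<Sum>i<N * K. \<Sum>j<N * K. \<Sum>k\<in>{2..M}. cnj (u i) * Y k $$ (i, j) * u j)
      = (\<Sum>k\<in>{2..M}. qform (N * K) (Y k) u)"
      unfolding qform_def by (rule sum_rotate[symmetric])
    also have "(\<Sum>i<N * K. \<Sum>j<N * K. cnj (u i) * u j * (if i = j then 1 else 0))
      = complex_of_real (sqnorm (N * K) u)"
      by (simp add: sum_delta_lessThan sqnorm_sum)
    finally show ?thesis by (simp add: qform_gram[OF Yg])
  qed
  have bes: "(\<Sum>k\<in>{1..M}. \<Sum>v\<in>V. (cmod (inner (N * K) (\<psi> (k, v)) u))\<^sup>2) \<le> sqnorm (N * K) u" for u
    using bessel[OF psi_orth, of u] fV by (simp add: sum.cartesian_product split_def)
  have M1: "{1..M} = insert 1 {2..M}" using M(1) by auto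
  \<comment> \<open>For \<open>i = 1\<close> this is Bessel's inequality for the whole family
    \<open>\<psi>\<close>; every other element equals its projection.\<close>
  have X_ge: "complex_of_real (\<Sum>v\<in>V. (cmod (inner (N * K) (\<psi> (i, v)) u))\<^sup>2) \<le> qform (N * K) (X i) u" for i u
  proof (cases "i = 1")
    case True
    have "(\<Sum>k\<in>{1..M}. \<Sum>v\<in>V. (cmod (inner (N * K) (\<psi> (k, v)) u))\<^sup>2) = 
      (\<Sum>v\<in>V. (cmod (inner (N * K) (\<psi> (1, v)) u))\<^sup>2) + (\<Sum>k\<in>{2..M}. \<Sum>v\<in>V. (cmod (inner (N * K) (\<psi> (k, v)) u))\<^sup>2)"
      unfolding M1 by (subst sum.insert) auto
    then show ?thesis using bes[of u] unfolding True qX1 by (simp add: less_eq_complex_def)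
  next
    case False
    then show ?thesis by (simp add: X_def qform_gram[OF Yg] less_eq_complex_def)
  qed
  have Xpsd: "psd (N * K) (X i)" for i
    unfolding psd_iff
  proof (intro conjI allI Xc)
    fix u
    have "0 \<le> complex_of_real (\<Sum>v\<in>V. (cmod (inner (N * K) (\<psi> (i, v)) u))\<^sup>2)"
      by (simp add: less_eq_complex_def sum_nonneg)
    then show "0 \<le> qform (N * K) (X i) u" using X_ge order_trans by blast
  qed
  have povm: "is_povm (N * K) M X"
    unfolding is_povm_def
  proof (intro conjI ballI Xpsd eq_matI)
    fix x y assume xy: "x < dim_row (1\<^sub>m (N * K))" "y < dim_col (1\<^sub>m (N * K))"
    have "(\<Sum>i\<in>{1..M}. X i $$ (x, y)) = X 1 $$ (x, y) + (\<Sum>i\<in>{2..M}. X i $$ (x, y))"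
      unfolding M1 by (subst sum.insert) auto
    also have "(\<Sum>i\<in>{2..M}. X i $$ (x, y)) = (\<Sum>i\<in>{2..M}. Y i $$ (x, y))"
      by (intro sum.cong refl) (auto simp: X_def)
    also have "X 1 $$ (x, y) = (if x = y then 1 else 0) - (\<Sum>i\<in>{2..M}. Y i $$ (x, y))"
      using xy by (simp add: X_def)
    finally show "mat (N * K) (N * K) (\<lambda>(r, c). \<Sum>i\<in>{1..M}. X i $$ (r, c)) $$ (x, y) = 1\<^sub>m (N * K) $$ (x, y)"
      using xy by simp
  qed auto
  let ?\<sigma> = "\<lambda>i. tensor_id D N K (C i) (rank_one (D * K) F)"
  define \<xi> where "\<xi> i = (\<lambda>(j, m::unit) x. \<Sum>a<D. enc_kraus S (\<pi> i) (c i) j (x div K) a * F (a * K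
    + x mod K))" for i
  have sg: "gram_of (N * K) (?\<sigma> i) ({..<Suc D} \<times> {()}) (\<xi> i)" for i
    unfolding C_def \<xi>_def by (rule kraus_tensor_gram[OF rank_one_gram])
  have err: "Re (mtrace (?\<sigma> i * (1\<^sub>m (N * K) - X i)))
    = 1 - (\<Sum>m\<in>{..<Suc D} \<times> {()}. Re (qform (N * K) (X i) (\<xi> i m)))"
    and tr: "(\<Sum>m\<in>{..<Suc D} \<times> {()}. sqnorm (N * K) (\<xi> i m)) = 1" if i: "i \<in> {1..M}" for i
  proof -
    have t: "mtrace (?\<sigma> i) = 1"
      using cp[of i] tp[OF i] by (intro mtrace_encoded) (auto simp: completely_positive_def)
    then show "Re (mtrace (?\<sigma> i * (1\<^sub>m (N * K) - X i)))
      = 1 - (\<Sum>m\<in>{..<Suc D} \<times> {()}. Re (qform (N * K) (X i) (\<xi> i m)))"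
      by (simp add: mtrace_mult_one_minus[OF tensor_id_carrier Xc] mtrace_mult_gram[OF sg Xc])
    show "(\<Sum>m\<in>{..<Suc D} \<times> {()}. sqnorm (N * K) (\<xi> i m)) = 1"
      using mtrace_gram[OF sg[of i]] t by (metis of_real_eq_1_iff)
  qed
  show thesis
  proof (rule that[of C X])
    fix i assume i: "i \<in> {1..M}"
    have "(\<Sum>m\<in>{..<Suc D} \<times> {()}. Re (qform (N * K) (X i) (\<xi> i m)))
      \<le> (\<Sum>m\<in>{..<Suc D} \<times> {()}. sqnorm (N * K) (\<xi> i m))"
      by (intro sum_mono povm_qform_le[OF povm i])
    then show "0 \<le> Re (mtrace (?\<sigma> i * (1\<^sub>m (N * K) - X i)))" unfolding err[OF i] tr[OF i] by simp
    \<comment> \<open>Success is credited to Kraus operator 0 alone, whose output is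
      \<open>\<chi> i\<close>; the terms of the other operators are nonnegative.\<close>
    have "(\<Sum>s\<in>S. q s) = (\<Sum>v\<in>V. (cmod (inner (N * K) (\<psi> (i, v)) (\<chi> i)))\<^sup>2)"
      unfolding w_sum[symmetric] by (intro sum.cong refl psi_chi[symmetric])
    also have "\<dots> = (\<Sum>v\<in>V. (cmod (inner (N * K) (\<psi> (i, v)) (\<xi> i (0, ()))))\<^sup>2)"
    proof (intro sum.cong refl arg_cong[of _ _ "\<lambda>x. (cmod x)\<^sup>2"] inner_cong)
      fix x assume "x < N * K"
      from enc_kraus_main[OF S(1) this] show "\<chi> i x = \<xi> i (0, ()) x" by (simp add: \<chi>_def \<xi>_def)
    qed
    also have "\<dots> \<le> Re (qform (N * K) (X i) (\<xi> i (0, ())))"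
      using X_ge[of i "\<xi> i (0, ())"] by (simp add: less_eq_complex_def)
    also have "\<dots> \<le> (\<Sum>m\<in>{..<Suc D} \<times> {()}. Re (qform (N * K) (X i) (\<xi> i m)))"
      using psd_qform[OF Xpsd] by (intro member_le_sum) (auto simp: less_eq_complex_def)
    finally show "Re (mtrace (?\<sigma> i * (1\<^sub>m (N * K) - X i))) \<le> 1 - (\<Sum>s\<in>S. q s)"
      unfolding err[OF i] by simp
  qed (use cp tp povm in auto)
qed

end

section \<open>Rates\<close>

context prob_vec
begin

text \<open>Every level set of probability below \<open>\<tau>\<close> is removed from the typical
  set. A surviving one has total probability at least \<open>\<tau>\<close>, while each member has
  at most \<open>b powr - (n (H - \<delta>))\<close>, so it must be large.\<close>

lemma card_level_bound:
  assumes b: "1 < b" and \<delta>: "0 < \<delta>"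
  obtains W where "0 < W" "\<And>n. 0 < n \<Longrightarrow> \<exists>S \<subseteq> typical b \<delta> n. 1 - W / n \<le> (\<Sum>s\<in>S. seq_prob d p n s) \<and>
    (\<forall>v\<in>seq_prob d p n ` S. b powr (real n * (shannon b - \<delta>)) / real (n + 1) ^ (d + 1)
      \<le> card {s \<in> S. seq_prob d p n s = v})"
proof -
  obtain V where V: "\<And>n. 0 < n \<Longrightarrow> 1 - V / n \<le> (\<Sum>s\<in>typical b \<delta> n. seq_prob d p n s)"
    using atypical_prob[OF b \<delta>] by blast
  have V0: "0 \<le> V"
  proof -
    have "typical b \<delta> 1 \<subseteq> {..<d ^ 1}" by (auto simp: typical_def)
    from seq_prob_sum_le[OF this] V[of 1] show ?thesis by simp
  qed
  show thesis
  \<comment> \<open>\<open>V\<close> pays for the atypical sequences, 1 for the removed level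
    sets.\<close>
  proof (rule that[of "V + 1"])
    fix n :: nat assume n: "0 < n"
    let ?q = "seq_prob d p n" and ?T = "typical b \<delta> n"
    \<comment> \<open>At most \<open>(n + 1) ^ d\<close> level sets can be removed, so with this
      threshold their total probability is at most \<open>1 / (n + 1)\<close>. The loss in the size
      of the others is polynomial and costs no rate.\<close>
    define \<tau> where "\<tau> = 1 / real (n + 1) ^ (d + 1)"
    have \<tau>: "0 < \<tau>" by (simp add: \<tau>_def)
    define L where "L v = {s \<in> ?T. ?q s = v}" for v
    define S where "S = {s \<in> ?T. \<tau> \<le> (\<Sum>t\<in>L (?q s). ?q t)}"
    have fT: "finite ?T" by (rule typical_finite)
    have level: "{s \<in> S. ?q s = v} = L v" if "v \<in> ?q ` S" for v
      using that by (auto simp: S_def L_def)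
    have "(\<Sum>s\<in>?T - S. ?q s) = (\<Sum>v\<in>?q ` (?T - S). \<Sum>s\<in>{s \<in> ?T - S. ?q s = v}. ?q s)"
      using fT by (intro sum.image_gen) auto
    also have "\<dots> \<le> (\<Sum>v\<in>?q ` (?T - S). \<tau>)"
    proof (intro sum_mono)
      fix v assume "v \<in> ?q ` (?T - S)"
      then obtain s where s: "s \<in> ?T" "s \<notin> S" "v = ?q s" by auto
      have "(\<Sum>s\<in>{s \<in> ?T - S. ?q s = v}. ?q s) \<le> (\<Sum>t\<in>L v. ?q t)"
        using fT by (intro sum_mono2) (auto simp: L_def seq_prob_nonneg)
      also have "\<dots> \<le> \<tau>" using s by (simp add: S_def)
      finally show "(\<Sum>s\<in>{s \<in> ?T - S. ?q s = v}. ?q s) \<le> \<tau>" .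
    qed
    also have "\<dots> = card (?q ` (?T - S)) * \<tau>" by simp
    also have "\<dots> \<le> real ((n + 1) ^ d) * \<tau>"
    proof (intro mult_right_mono)
      have "card (?q ` (?T - S)) \<le> card (?q ` {..<d ^ n})" by (intro card_mono) (auto simp: typical_def)
      also have "\<dots> \<le> (n + 1) ^ d" by (rule card_seq_prob_image)
      finally show "real (card (?q ` (?T - S))) \<le> real ((n + 1) ^ d)" by (rule of_nat_mono)
    qed (use \<tau> in auto)
    also have "\<dots> = 1 / real (n + 1)" by (simp add: \<tau>_def)
    also have "\<dots> \<le> 1 / real n" using n by (simp add: field_simps)
    finally have "(\<Sum>s\<in>?T - S. ?q s) \<le> 1 / real n" .
    moreover have "(\<Sum>s\<in>?T. ?q s) = (\<Sum>s\<in>?T - S. ?q s) + (\<Sum>s\<in>S. ?q s)"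
      using fT by (intro sum.subset_diff) (auto simp: S_def)
    ultimately have mass: "1 - (V + 1) / n \<le> (\<Sum>s\<in>S. ?q s)"
      using V[OF n] by (simp add: add_divide_distrib)
    have size: "b powr (real n * (shannon b - \<delta>)) / real (n + 1) ^ (d + 1) \<le> card {s \<in> S. ?q s = v}"
      if v: "v \<in> ?q ` S" for v
    proof -
      obtain s where s: "s \<in> ?T" "v = ?q s" "\<tau> \<le> (\<Sum>t\<in>L v. ?q t)" using v by (auto simp: S_def)
      have "\<tau> \<le> (\<Sum>t\<in>L v. ?q t)" by (rule s(3))
      also have "\<dots> = card (L v) * v" by (simp add: L_def)
      also have "\<dots> \<le> card (L v) * b powr - (real n * (shannon b - \<delta>))"
        using typical_bounds(2)[OF b s(1)] s(2) by (intro mult_left_mono) auto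
      finally have "\<tau> \<le> card (L v) / b powr (real n * (shannon b - \<delta>))"
        by (simp only: powr_minus divide_inverse)
      then have "\<tau> * b powr (real n * (shannon b - \<delta>)) \<le> card (L v)"
        using b by (simp add: pos_le_divide_eq)
      then show ?thesis unfolding level[OF v] \<tau>_def by simp
    qed
    show "\<exists>S \<subseteq> ?T. 1 - (V + 1) / n \<le> (\<Sum>s\<in>S. ?q s) \<and>
      (\<forall>v\<in>?q ` S. b powr (real n * (shannon b - \<delta>)) / real (n + 1) ^ (d + 1) \<le> card {s \<in> S. ?q s = v})"
      using mass size by (intro exI[of _ S]) (auto simp: S_def)
  qed (use V0 in simp)
qed

end

section \<open>From bounds at fixed block length to rates\<close>

lemma ln_over_n: "(\<lambda>n. ln (real n + 1) / real n) \<longlonglongrightarrow> 0"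
  by real_asymp

locale dc_setting = prob_vec dA l for dA :: nat and l :: "nat \<Rightarrow> real" +
  fixes dB :: nat and \<alpha> \<beta> :: "nat \<Rightarrow> nat \<Rightarrow> nat \<Rightarrow> complex" and F :: "nat \<Rightarrow> nat \<Rightarrow> complex" and \<rho> :: "complex mat"
  assumes schmidt: "\<And>n. schmidt_state (dA ^ n) (dB ^ n) (\<alpha> n) (\<beta> n) (seq_prob dA l n) (F n)"
    and power_eq: "\<And>n. bipartite_tensor_power dA dB n \<rho> = rank_one (dA ^ n * dB ^ n) (F n)"
begin

text \<open>Apply \<open>converse_bound\<close> to the typical set. Once the error is below 1/4 and
  the atypical probability below 1/8, the bracket there is at least 1 - 1/4 - 2/8 = 1/2, so
  \<open>M / N\<close> is at most 4 times the size of the typical set; the 4 disappears after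
  division by \<open>n\<close>.\<close>

lemma rate_upper:
  assumes b: "1 < b" and codes: "\<And>n. 1 \<le> n \<Longrightarrow> is_code dA dB n (\<Phi> n)"
    and err: "(\<lambda>n. avg_error dA dB \<rho> n (\<Phi> n)) \<longlonglongrightarrow> 0"
  shows "liminf (\<lambda>n. ereal (1 / real n * log b (real (num_msgs (\<Phi> n)) / real (qdim (\<Phi> n)))))
    \<le> ereal (shannon b)"
proof (rule ereal_le_epsilon2)
  fix \<delta> :: real assume \<delta>: "0 < \<delta>"
  obtain V where V: "\<And>n. 0 < n \<Longrightarrow> 1 - V / n \<le> (\<Sum>s\<in>typical b \<delta> n. seq_prob dA l n s)"
    using atypical_prob[OF b \<delta>] by blast
  have "(\<lambda>n. V / real n) \<longlonglongrightarrow> 0" by real_asymp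
  then have ev: "\<forall>\<^sub>F n in sequentially. V / real n < 1 / 8" by (rule order_tendstoD) simp
  have ev': "\<forall>\<^sub>F n in sequentially. avg_error dA dB \<rho> n (\<Phi> n) < 1 / 4"
    using err by (rule order_tendstoD) simp
  have "\<forall>\<^sub>F n in sequentially. ereal (1 / real n * log b (real (num_msgs (\<Phi> n)) / real (qdim (\<Phi> n))))
     \<le> ereal (log b 4 / real n + (shannon b + \<delta>))"
    using ev ev' eventually_gt_at_top[of 0]
  proof eventually_elim
    case (elim n)
    interpret s: schmidt_state "dA ^ n" "dB ^ n" "\<alpha> n" "\<beta> n" "seq_prob dA l n" "F n" by (rule schmidt)
    let ?M = "num_msgs (\<Phi> n)" and ?N = "qdim (\<Phi> n)" and ?T = "typical b \<delta> n"
    from codes[of n] elim(3) have code: "is_code dA dB n (\<Phi> n)" by simp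
    then have M: "0 < ?M" and N: "0 < ?N" by (auto simp: is_code_def)
    have "real ?M * (1 - avg_error dA dB \<rho> n (\<Phi> n) - 2 * (1 - (\<Sum>s\<in>?T. seq_prob dA l n s)))
      \<le> 2 * real ?N * real (card ?T)"
      unfolding avg_error_def power_eq using code M N
      by (intro s.converse_bound) (auto simp: is_code_def typical_def)
    moreover have "1 / 2 \<le> 1 - avg_error dA dB \<rho> n (\<Phi> n) - 2 * (1 - (\<Sum>s\<in>?T. seq_prob dA l n s))"
    proof -
      have "1 / 2 \<le> 1 - e - 2 * (1 - P)" if "1 - x \<le> P" "x < 1 / 8" "e < 1 / 4" for e P x :: real
        using that by (simp add: right_diff_distrib)
      from this[OF V[OF elim(3)] elim(1,2)] show ?thesis .
    qed
    then have "real ?M * (1 / 2) \<le> real ?M * (1 - avg_error dA dB \<rho> n (\<Phi> n) - 2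
      * (1 - (\<Sum>s\<in>?T. seq_prob dA l n s)))"
      by (intro mult_left_mono) auto
    moreover have "2 * real ?N * real (card ?T) \<le> 2 * real ?N * b powr (real n * (shannon b + \<delta>))"
      using typical_card[OF b, of \<delta> n] by (intro mult_left_mono) auto
    ultimately have "real ?M * (1 / 2) \<le> 2 * real ?N * b powr (real n * (shannon b + \<delta>))" by linarith
    then have "real ?M / real ?N \<le> 4 * b powr (real n * (shannon b + \<delta>))"
      using N by (simp add: field_simps)
    then have "log b (real ?M / real ?N) \<le> log b (4 * b powr (real n * (shannon b + \<delta>)))"
      using b M N by (subst log_le_cancel_iff) auto
    also have "\<dots> = log b 4 + real n * (shannon b + \<delta>)" using b by (subst log_mult_pos) auto
    finally have "1 / real n * log b (real ?M / real ?N) \<le> 1 / real n * (log b 4 + real n * (shannon b + \<delta>))"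
      by (intro mult_left_mono) auto
    also have "\<dots> = log b 4 / real n + (shannon b + \<delta>)" using elim(3) by (simp add: field_simps)
    finally show ?case by simp
  qed
  then have "liminf (\<lambda>n. ereal (1 / real n * log b (real (num_msgs (\<Phi> n)) / real (qdim (\<Phi> n)))))
    \<le> liminf (\<lambda>n. ereal (log b 4 / real n + (shannon b + \<delta>)))" by (rule Liminf_mono)
  also have "\<dots> = ereal (shannon b + \<delta>)"
  proof (intro lim_imp_Liminf tendsto_ereal)
    have "(\<lambda>n. log b 4 / real n) \<longlonglongrightarrow> 0" by real_asymp
    from tendsto_add[OF this tendsto_const[of "shannon b + \<delta>"]]
    show "(\<lambda>n. log b 4 / real n + (shannon b + \<delta>)) \<longlonglongrightarrow> shannon b + \<delta>" by simp
  qed simp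
  finally show "liminf (\<lambda>n. ereal (1 / real n * log b (real (num_msgs (\<Phi> n)) / real (qdim (\<Phi> n)))))
    \<le> ereal (shannon b) + ereal \<delta>"
    by simp
qed

text \<open>The number of messages is the largest that \<open>direct_coding\<close> allows:
  \<open>v\<close> is a level of smallest size in \<open>S\<close>.\<close>

lemma code_exists:
  assumes S: "S \<subseteq> {..<dA ^ n}" "S \<noteq> {}" "\<And>s. s \<in> S \<Longrightarrow> 0 < seq_prob dA l n s"
  obtains \<Phi> v where "is_code dA dB n \<Phi>" "qdim \<Phi> = card S" "v \<in> seq_prob dA l n ` S"
    "num_msgs \<Phi> = (card {s \<in> S. seq_prob dA l n s = v})\<^sup>2"
    "0 \<le> avg_error dA dB \<rho> n \<Phi>" "avg_error dA dB \<rho> n \<Phi> \<le> 1 - (\<Sum>s\<in>S. seq_prob dA l n s)"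
proof -
  interpret s: schmidt_state "dA ^ n" "dB ^ n" "\<alpha> n" "\<beta> n" "seq_prob dA l n" "F n" by (rule schmidt)
  let ?q = "seq_prob dA l n"
  let ?c = "\<lambda>v. (card {s \<in> S. ?q s = v})\<^sup>2"
  have fS: "finite S" using S(1) finite_subset by blast
  define v where "v = arg_min_on ?c (?q ` S)"
  have qS: "finite (?q ` S)" "?q ` S \<noteq> {}" using S(2) fS by auto
  have v: "v \<in> ?q ` S" unfolding v_def by (rule arg_min_if_finite(1)[OF qS])
  have vmin: "?c v \<le> ?c u" if "u \<in> ?q ` S" for u unfolding v_def by (rule arg_min_least[OF qS that])
  define M where "M = ?c v"
  have M: "0 < M" using v fS by (auto simp: M_def card_gt_0_iff)
  obtain C X where CX: "\<And>i. i \<in> {1..M} \<Longrightarrow> completely_positive (dA ^ n) (card S) (C i)"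
    "\<And>i \<sigma>. i \<in> {1..M} \<Longrightarrow> density_op (dA ^ n) \<sigma> \<Longrightarrow> density_op (card S) (C i \<sigma>)"
    "is_povm (card S * dB ^ n) M X"
    and e0: "\<And>i. i \<in> {1..M} \<Longrightarrow> 0 \<le> Re (mtrace (tensor_id (dA ^ n) (card S) (dB ^ n) (C i) (rank_one
      (dA ^ n * dB ^ n) (F n)) * (1\<^sub>m (card S * dB ^ n) - X i)))"
    and e1: "\<And>i. i \<in> {1..M} \<Longrightarrow> Re (mtrace (tensor_id (dA ^ n) (card S) (dB ^ n) (C i) (rank_one (dA ^ n
      * dB ^ n) (F n)) * (1\<^sub>m (card S * dB ^ n) - X i))) \<le> 1 - (\<Sum>s\<in>S. ?q s)"
    using s.direct_coding[OF S M vmin[folded M_def]] by blast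
  let ?\<Phi> = "\<lparr>num_msgs = M, qdim = card S, enc = C, dec = X\<rparr>"
  show thesis
  proof (rule that[of ?\<Phi> v])
    show "is_code dA dB n ?\<Phi>" using CX M S(2) fS by (auto simp: is_code_def card_gt_0_iff)
    show "0 \<le> avg_error dA dB \<rho> n ?\<Phi>"
      unfolding avg_error_def power_eq dc_code.select_convs by (intro mult_nonneg_nonneg sum_nonneg e0) auto
    have "avg_error dA dB \<rho> n ?\<Phi> \<le> 1 / real M * (\<Sum>i\<in>{1..M}. 1 - (\<Sum>s\<in>S. ?q s))"
      unfolding avg_error_def power_eq dc_code.select_convs by (intro mult_left_mono sum_mono e1) auto
    then show "avg_error dA dB \<rho> n ?\<Phi> \<le> 1 - (\<Sum>s\<in>S. ?q s)" using M by simp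
  qed (use v in \<open>auto simp: M_def\<close>)
qed

text \<open>\<open>M\<close> is at least \<open>b powr (2 n (H - \<delta>))\<close> up to a
  polynomial factor and \<open>N\<close> is at most \<open>b powr (n (H + \<delta>))\<close>. The
  exponent per copy is therefore
  \<open>2 (H - \<delta>) - (H + \<delta>) = H - 3 \<delta>\<close>.\<close>

lemma rate_lower:
  assumes b: "1 < b" and \<delta>: "0 < \<delta>"
  obtains \<Phi> where "\<And>n. 1 \<le> n \<Longrightarrow> is_code dA dB n (\<Phi> n)" "(\<lambda>n. avg_error dA dB \<rho> n (\<Phi> n)) \<longlonglongrightarrow> 0"
    "ereal (shannon b - 3 * \<delta>) \<le> liminf (\<lambda>n. ereal (1 / real n
      * log b (real (num_msgs (\<Phi> n)) / real (qdim (\<Phi> n)))))"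
proof -
  obtain W where W: "0 < W" and good: "\<And>n. 0 < n \<Longrightarrow> \<exists>S \<subseteq> typical b \<delta> n. 1 - W / n \<le> (\<Sum>s\<in>S. seq_prob dA l n s) \<and>
    (\<forall>v\<in>seq_prob dA l n ` S. b powr (real n * (shannon b - \<delta>)) / real (n + 1) ^ (dA + 1)
      \<le> card {s \<in> S. seq_prob dA l n s = v})"
    using card_level_bound[OF b \<delta>] by blast
  let ?low = "\<lambda>n. shannon b - 3 * \<delta> - 2 * (dA + 1) / ln b * (ln (real n + 1) / real n)"
  \<comment> \<open>For \<open>n \<le> W\<close> the set \<open>S\<close> may be empty, so the rate
    is claimed only beyond \<open>W\<close>; a code has to be supplied for every positive
    \<open>n\<close> all the same.\<close>
  let ?P = "\<lambda>n \<Phi>. is_code dA dB n \<Phi> \<and> 0 \<le> avg_error dA dB \<rho> n \<Phi> \<and> avg_error dA dB \<rho> n \<Phi> \<le> W / n \<and>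
      (W < n \<longrightarrow> ?low n \<le> 1 / real n * log b (real (num_msgs \<Phi>) / real (qdim \<Phi>)))"
  have "\<exists>\<Phi>. ?P n \<Phi>" if n: "0 < n" for n
  proof -
    let ?q = "seq_prob dA l n"
    obtain S where S: "S \<subseteq> typical b \<delta> n" "1 - W / n \<le> (\<Sum>s\<in>S. ?q s)"
      and lev: "\<And>v. v \<in> ?q ` S \<Longrightarrow> b powr (real n * (shannon b - \<delta>)) / real (n + 1) ^ (dA + 1)
        \<le> card {s \<in> S. ?q s = v}"
      using good[OF n] by blast
    have Sq: "S \<subseteq> {..<dA ^ n}" "\<And>s. s \<in> S \<Longrightarrow> 0 < ?q s" using S(1) by (auto simp: typical_def)
    show ?thesis
    proof (cases "S = {}")
      \<comment> \<open>A filler code from a single sequence of positive probability: its error is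
        at most 1, which is at most \<open>W / n\<close> here.\<close>
      case True
      then have Wn: "real n \<le> W" using S(2) n by (simp add: field_simps)
      have "\<exists>s<dA ^ n. 0 < ?q s"
      proof (rule ccontr)
        assume "\<not> (\<exists>s<dA ^ n. 0 < ?q s)"
        then have "(\<Sum>s<dA ^ n. ?q s) \<le> 0" by (intro sum_nonpos) force
        then show False by (simp add: seq_prob_sum)
      qed
      then obtain s where s: "s < dA ^ n" "0 < ?q s" by blast
      obtain \<Phi> v where \<Phi>: "is_code dA dB n \<Phi>" "0 \<le> avg_error dA dB \<rho> n \<Phi>" "avg_error dA dB \<rho> n \<Phi>
        \<le> 1 - (\<Sum>s\<in>{s}. ?q s)"
        by (rule code_exists[of "{s}" n]) (use s in auto)
      have "1 \<le> W / n" using Wn n by (simp add: field_simps)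
      then have "?P n \<Phi>" using \<Phi> s Wn by auto
      then show ?thesis by blast
    next
      case False
      obtain \<Phi> v where \<Phi>: "is_code dA dB n \<Phi>" "qdim \<Phi> = card S" "v \<in> ?q ` S"
        "num_msgs \<Phi> = (card {s \<in> S. ?q s = v})\<^sup>2"
        "0 \<le> avg_error dA dB \<rho> n \<Phi>" "avg_error dA dB \<rho> n \<Phi> \<le> 1 - (\<Sum>s\<in>S. ?q s)"
        using code_exists[OF Sq(1) False Sq(2)] by blast
      define u where "u = b powr (real n * (shannon b - \<delta>)) / real (n + 1) ^ (dA + 1)"
      define z where "z = b powr (real n * (shannon b + \<delta>))"
      have u0: "0 < u" using b by (simp add: u_def)
      have z0: "0 < z" using b by (simp add: z_def)
      have N0: "0 < qdim \<Phi>" "0 < num_msgs \<Phi>" using \<Phi>(1) by (auto simp: is_code_def)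
      have "u\<^sup>2 \<le> (real (card {s \<in> S. ?q s = v}))\<^sup>2"
        using lev[OF \<Phi>(3)] u0 unfolding u_def[symmetric] by (intro power_mono) auto
      then have uM: "u\<^sup>2 \<le> real (num_msgs \<Phi>)" by (simp add: \<Phi>(4))
      have "card S \<le> card (typical b \<delta> n)" using S(1) typical_finite by (intro card_mono)
      then have Nz: "real (qdim \<Phi>) \<le> z" using typical_card[OF b, of \<delta> n] by (simp add: \<Phi>(2) z_def)
      have logu: "log b u = real n * (shannon b - \<delta>) - (dA + 1) * (ln (real n + 1) / ln b)"
      proof -
        have "log b (real (n + 1) ^ (dA + 1)) = real (dA + 1) * log b (real (n + 1))"
          by (rule log_nat_power) simp
        then show ?thesis
          unfolding u_def using b by (subst log_divide_pos) (simp_all add: log_def add.commute del: power_Suc)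
      qed
      have "?low n = 1 / real n * (2 * log b u - real n * (shannon b + \<delta>))"
        unfolding logu using n b by (simp add: field_simps)
      also have "2 * log b u - real n * (shannon b + \<delta>) = log b (u\<^sup>2 / z)"
        using b u0 z0 by (simp add: log_divide_pos log_nat_power z_def)
      also have "1 / real n * log b (u\<^sup>2 / z) \<le> 1 / real n * log b (real (num_msgs \<Phi>) / real (qdim \<Phi>))"
      proof (intro mult_left_mono)
        have "u\<^sup>2 / z \<le> real (num_msgs \<Phi>) / real (qdim \<Phi>)"
          using uM Nz N0 u0 by (intro frac_le) auto
        then show "log b (u\<^sup>2 / z) \<le> log b (real (num_msgs \<Phi>) / real (qdim \<Phi>))"
          using b u0 z0 N0 by (subst log_le_cancel_iff) auto
      qed auto
      finally have "?low n \<le> 1 / real n * log b (real (num_msgs \<Phi>) / real (qdim \<Phi>))" .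
      then have "?P n \<Phi>" using \<Phi> S(2) by auto
      then show ?thesis by blast
    qed
  qed
  then obtain \<Phi> where \<Phi>: "\<And>n. 0 < n \<Longrightarrow> ?P n (\<Phi> n)" by metis
  show thesis
  proof (rule that[of \<Phi>])
    fix n :: nat assume "1 \<le> n" then show "is_code dA dB n (\<Phi> n)" using \<Phi>[of n] by simp
  next
    have W0: "(\<lambda>n. W / real n) \<longlonglongrightarrow> 0" by real_asymp
    show "(\<lambda>n. avg_error dA dB \<rho> n (\<Phi> n)) \<longlonglongrightarrow> 0"
    proof (rule tendsto_sandwich[OF _ _ tendsto_const W0])
      show "\<forall>\<^sub>F n in sequentially. 0 \<le> avg_error dA dB \<rho> n (\<Phi> n)"
        "\<forall>\<^sub>F n in sequentially. avg_error dA dB \<rho> n (\<Phi> n) \<le> W / real n"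
        using eventually_gt_at_top[of 0] by (eventually_elim, use \<Phi> in blast)+
    qed
  next
    have "(\<lambda>n. ?low n) \<longlonglongrightarrow> shannon b - 3 * \<delta> - 2 * (dA + 1) / ln b * 0"
      by (intro tendsto_intros ln_over_n)
    then have "ereal (shannon b - 3 * \<delta>) = liminf (\<lambda>n. ereal (?low n))"
      by (intro lim_imp_Liminf[symmetric] tendsto_ereal) auto
    also have "\<dots> \<le> liminf (\<lambda>n. ereal (1 / real n * log b (real (num_msgs (\<Phi> n)) / real (qdim (\<Phi> n)))))"
    proof (rule Liminf_mono)
      have "\<forall>\<^sub>F n in sequentially. W < real n"
        using filterlim_real_sequentially by (simp add: filterlim_at_top_dense)
      then show "\<forall>\<^sub>F n in sequentially. ereal (?low n)
        \<le> ereal (1 / real n * log b (real (num_msgs (\<Phi> n)) / real (qdim (\<Phi> n))))"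
        using eventually_gt_at_top[of 0]
      proof eventually_elim
        case (elim n)
        then show ?case using \<Phi>[of n] by simp
      qed
    qed
    finally show "ereal (shannon b - 3 * \<delta>) \<le> liminf (\<lambda>n. ereal (1 / real n
      * log b (real (num_msgs (\<Phi> n)) / real (qdim (\<Phi> n)))))" .
  qed
qed

theorem dc_capacity_eq:
  assumes b: "1 < b"
  shows "dc_capacity b dA dB \<rho> = ereal (shannon b)"
proof (rule antisym)
  show "dc_capacity b dA dB \<rho> \<le> ereal (shannon b)"
    unfolding dc_capacity_def using rate_upper[OF b] by (intro Sup_least) blast
  show "ereal (shannon b) \<le> dc_capacity b dA dB \<rho>"
  proof (rule ereal_le_epsilon2)
    fix e :: real assume "0 < e"
    then have e: "0 < e / 3" by simp
    obtain \<Phi> where \<Phi>: "\<And>n. 1 \<le> n \<Longrightarrow> is_code dA dB n (\<Phi> n)" "(\<lambda>n. avg_error dA dB \<rho> n (\<Phi> n)) \<longlonglongrightarrow> 0"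
      "ereal (shannon b - 3 * (e / 3)) \<le> liminf (\<lambda>n. ereal (1 / real n
        * log b (real (num_msgs (\<Phi> n)) / real (qdim (\<Phi> n)))))"
      using rate_lower[OF b e] by blast
    have "ereal (shannon b - e) \<le> liminf (\<lambda>n. ereal (1 / real n
      * log b (real (num_msgs (\<Phi> n)) / real (qdim (\<Phi> n)))))"
      using \<Phi>(3) by simp
    also have "\<dots> \<le> dc_capacity b dA dB \<rho>"
      unfolding dc_capacity_def using \<Phi>(1,2) by (intro Sup_upper) blast
    finally have "ereal (shannon b - e) + ereal e \<le> dc_capacity b dA dB \<rho> + ereal e" by (rule add_right_mono)
    then show "ereal (shannon b) \<le> dc_capacity b dA dB \<rho> + ereal e" by simp
  qed
qed

end

section \<open>Tensor powers of the Schmidt form, and the capacity\<close>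

lemma pair_digit_less:
  assumes "0 < dA" "0 < dB"
  shows "pair_digit dA dB n k i < dA * dB"
  unfolding pair_digit_def by (intro index_less_mult digit_less assms)

lemma pair_digit_index:
  assumes "b < dB ^ n"
  shows "pair_digit dA dB n k (a * dB ^ n + b) = digit dA k a * dB + digit dB k b"
proof -
  have nz: "dB ^ n \<noteq> 0" using assms by linarith
  have "(a * dB ^ n + b) div dB ^ n = a" using div_mult_self3[OF nz, of a b] assms by simp
  then show ?thesis using assms by (simp add: pair_digit_def)
qed

lemma bipartite_tensor_power_pure:
  assumes "\<phi> \<in> carrier_vec (dA * dB)" "0 < dA" "0 < dB"
  shows "bipartite_tensor_power dA dB n (pure_state \<phi>)
    = rank_one (dA ^ n * dB ^ n) (\<lambda>i. \<Prod>k<n. \<phi> $ pair_digit dA dB n k i)"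
  using assms unfolding bipartite_tensor_power_def rank_one_def pure_state_def
  by (intro cong_mat) (simp_all add: pair_digit_less prod.distrib)

text \<open>The orthogonality, completeness and expansion conditions are sums over digit strings of
  products over positions, so \<open>sum_prod_digits\<close> splits them into single-copy
  identities. The indices \<open>s\<close> and \<open>a\<close> are read in base \<open>dA\<close>,
  the receiver's index in base \<open>dB\<close>.\<close>

lemma schmidt_state_power:
  fixes T :: "nat \<Rightarrow> nat \<Rightarrow> complex"
  assumes d: "0 < dA" "0 < dB" and p: "prob_vec dA l" and sd: "spectral_decomp dA R u l"
    and T: "\<And>x b. x < dA \<Longrightarrow> T x b = (\<Sum>m<dA. u m x * \<beta> m b)"
    and \<beta>: "\<And>i j. i < dA \<Longrightarrow> j < dA \<Longrightarrow> (\<Sum>b<dB. cnj (\<beta> i b) * \<beta> j b) = (if i = j then complex_of_real (l i) else 0)"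
    and F: "\<And>a b. a < dA ^ n \<Longrightarrow> b < dB ^ n \<Longrightarrow> F (a * dB ^ n + b) = (\<Prod>k<n. T (digit dA k a) (digit dB k b))"
  shows "schmidt_state (dA ^ n) (dB ^ n) (\<lambda>s a. \<Prod>k<n. u (digit dA k s) (digit dA k a))
    (\<lambda>s b. \<Prod>k<n. \<beta> (digit dA k s) (digit dB k b)) (seq_prob dA l n) F"
proof
  note u1 = sd[unfolded spectral_decomp_def, THEN conjunct1, rule_format]
  note u2 = sd[unfolded spectral_decomp_def, THEN conjunct2, THEN conjunct1, rule_format]
  note dl = digit_less[OF d(1)]
  fix s t assume st: "s < dA ^ n" "t < dA ^ n"
  have "inner (dA ^ n) (\<lambda>a. \<Prod>k<n. u (digit dA k s) (digit dA k a)) (\<lambda>a. \<Prod>k<n. u (digit dA k t) (digit dA k a))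
    = (\<Sum>a<dA ^ n. \<Prod>k<n. cnj (u (digit dA k s) (digit dA k a)) * u (digit dA k t) (digit dA k a))"
    by (simp add: inner_def prod.distrib)
  also have "\<dots> = (\<Prod>k<n. \<Sum>m<dA. cnj (u (digit dA k s) m) * u (digit dA k t) m)"
    by (rule sum_prod_digits[OF d(1)])
  also have "\<dots> = (\<Prod>k<n. if digit dA k s = digit dA k t then 1 else 0)"
    by (intro prod.cong refl u1 dl)
  also have "\<dots> = (if s = t then 1 else 0)" using prod_digits_delta[OF d(1) st, of "\<lambda>_. 1 :: complex"] by simp
  finally show "inner (dA ^ n) (\<lambda>a. \<Prod>k<n. u (digit dA k s) (digit dA k a)) (\<lambda>a. \<Prod>k<n. u (digit dA k t)
    (digit dA k a))
    = (if s = t then 1 else 0)" .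
  have "(\<Sum>m<dA ^ n. (\<Prod>k<n. u (digit dA k m) (digit dA k s)) * cnj (\<Prod>k<n. u (digit dA k m) (digit dA k t)))
    = (\<Sum>m<dA ^ n. \<Prod>k<n. u (digit dA k m) (digit dA k s) * cnj (u (digit dA k m) (digit dA k t)))"
    by (simp add: prod.distrib)
  also have "\<dots> = (\<Prod>k<n. \<Sum>m<dA. u m (digit dA k s) * cnj (u m (digit dA k t)))"
    by (rule sum_prod_digits[OF d(1)])
  also have "\<dots> = (\<Prod>k<n. if digit dA k s = digit dA k t then 1 else 0)"
    by (intro prod.cong refl u2 dl)
  also have "\<dots> = (if s = t then 1 else 0)" using prod_digits_delta[OF d(1) st, of "\<lambda>_. 1 :: complex"] by simp
  finally show "(\<Sum>m<dA ^ n. (\<Prod>k<n. u (digit dA k m) (digit dA k s))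
    * cnj (\<Prod>k<n. u (digit dA k m) (digit dA k t)))
    = (if s = t then 1 else 0)" .
  have "inner (dB ^ n) (\<lambda>b. \<Prod>k<n. \<beta> (digit dA k s) (digit dB k b)) (\<lambda>b. \<Prod>k<n. \<beta> (digit dA k t) (digit dB k b))
    = (\<Sum>b<dB ^ n. \<Prod>k<n. cnj (\<beta> (digit dA k s) (digit dB k b)) * \<beta> (digit dA k t) (digit dB k b))"
    by (simp add: inner_def prod.distrib)
  also have "\<dots> = (\<Prod>k<n. \<Sum>b<dB. cnj (\<beta> (digit dA k s) b) * \<beta> (digit dA k t) b)"
    by (rule sum_prod_digits[OF d(2)])
  also have "\<dots> = (\<Prod>k<n. if digit dA k s = digit dA k t then complex_of_real (l (digit dA k s)) else 0)"
    by (intro prod.cong refl \<beta> dl)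
  also have "\<dots> = (if s = t then complex_of_real (seq_prob dA l n s) else 0)"
    unfolding seq_prob_def of_real_prod by (rule prod_digits_delta[OF d(1) st])
  finally show "inner (dB ^ n) (\<lambda>b. \<Prod>k<n. \<beta> (digit dA k s) (digit dB k b)) (\<lambda>b. \<Prod>k<n. \<beta> (digit dA k t)
    (digit dB k b))
    = (if s = t then complex_of_real (seq_prob dA l n s) else 0)" .
next
  fix a b assume ab: "a < dA ^ n" "b < dB ^ n"
  have "F (a * dB ^ n + b) = (\<Prod>k<n. \<Sum>m<dA. u m (digit dA k a) * \<beta> m (digit dB k b))"
    by (simp add: F[OF ab] T digit_less[OF d(1)])
  also have "\<dots> = (\<Sum>s<dA ^ n. \<Prod>k<n. u (digit dA k s) (digit dA k a) * \<beta> (digit dA k s) (digit dB k b))"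
    by (rule sum_prod_digits[OF d(1), symmetric])
  finally show "F (a * dB ^ n + b) = (\<Sum>s<dA ^ n. (\<Prod>k<n. u (digit dA k s) (digit dA k a))
    * (\<Prod>k<n. \<beta> (digit dA k s) (digit dB k b)))"
    by (simp add: prod.distrib)
next
  show "(\<Sum>s<dA ^ n. seq_prob dA l n s) = 1" by (rule prob_vec.seq_prob_sum[OF p])
qed

theorem theorem7:
  fixes b :: real and dA dB :: nat and \<phi> :: "complex vec"
  assumes "b > 1"
    and "\<phi> \<in> carrier_vec (dA * dB)"
    and "\<phi> \<bullet>c \<phi> = 1"
  defines "\<rho>A \<equiv> ptrace_B dA dB (pure_state \<phi>)"
    and "\<rho>B \<equiv> ptrace_A dA dB (pure_state \<phi>)"
  shows "dc_capacity b dA dB (pure_state \<phi>) = ereal (vn_entropy b \<rho>B)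
    \<and> vn_entropy b \<rho>B = vn_entropy b \<rho>A"
proof -
  \<comment> \<open>A unit vector exists only in positive dimension, and digits make sense only for
    positive bases.\<close>
  have "dA * dB \<noteq> 0"
  proof
    assume "dA * dB = 0"
    then have "\<phi> \<bullet>c \<phi> = 0" using assms(2) by (simp add: scalar_prod_def)
    with assms(3) show False by simp
  qed
  then have d: "0 < dA" "0 < dB" by auto
  define T where "T x b = \<phi> $ (x * dB + b)" for x b
  have A: "\<rho>A \<in> carrier_mat dA dA" "\<And>i j. i < dA \<Longrightarrow> j < dA \<Longrightarrow> \<rho>A $$ (i, j) = (\<Sum>b<dB. T i b * cnj (T j b))"
    using assms(2) by (auto simp: \<rho>A_def ptrace_B_def pure_state_def T_def index_less_mult)
  have B: "\<rho>B \<in> carrier_mat dB dB" "\<And>i j. i < dB \<Longrightarrow> j < dB \<Longrightarrow> \<rho>B $$ (i, j) = (\<Sum>a<dA. T a i * cnj (T a j))"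
    using assms(2) by (auto simp: \<rho>B_def ptrace_A_def pure_state_def T_def index_less_mult)
  have hA: "mat_adjoint \<rho>A = \<rho>A" using A(1) by (intro eq_matI) (auto simp: mat_adjoint_mat A(2) mult.commute)
  have hB: "mat_adjoint \<rho>B = \<rho>B" using B(1) by (intro eq_matI) (auto simp: mat_adjoint_mat B(2) mult.commute)
  \<comment> \<open>The spectrum \<open>l\<close> that evaluates the entropy also serves below for
    the Schmidt form and the typical sequences, so \<open>shannon b\<close> is literally the entropy
    of \<open>\<rho>A\<close>.\<close>
  obtain u l where sA: "spectral_decomp dA \<rho>A u l" and eA: "vn_entropy b \<rho>A = - (\<Sum>i<dA. l i * log b (l i))"
    by (rule vn_entropy_spectral[OF A(1) hA])
  obtain v r where sB: "spectral_decomp dB \<rho>B v r" and eB: "vn_entropy b \<rho>B = - (\<Sum>i<dB. r i * log b (r i))"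
    by (rule vn_entropy_spectral[OF B(1) hB])
  have eq: "vn_entropy b \<rho>B = vn_entropy b \<rho>A"
    unfolding eA eB using schmidt_spectra[OF sA A(2) sB B(2), of "log b"] by simp
  obtain \<beta> where T: "\<And>x b. x < dA \<Longrightarrow> T x b = (\<Sum>k<dA. u k x * \<beta> k b)"
    and \<beta>: "\<And>i j. i < dA \<Longrightarrow> j < dA \<Longrightarrow> (\<Sum>b<dB. cnj (\<beta> i b) * \<beta> j b) = (if i = j then complex_of_real (l i) else 0)"
    using schmidt_vectors[OF sA A(2)] by blast
  have p: "prob_vec dA l"
  proof
    fix m assume m: "m < dA"
    have "complex_of_real (sqnorm dB (\<beta> m)) = complex_of_real (l m)" unfolding sqnorm_sum
      using \<beta>[OF m m] by simp
    then show "0 \<le> l m" using sqnorm_nonneg[of dB "\<beta> m"] by (simp only: of_real_eq_iff)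
  next
    have "complex_of_real (\<Sum>m<dA. l m) = (\<Sum>k<dA. complex_of_real (l k) * (\<Sum>i<dA. cnj (u k i) * u k i))"
      using sA by (simp add: spectral_decomp_def)
    also have "\<dots> = (\<Sum>i<dA. \<rho>A $$ (i, i))"
    proof -
      have "(\<Sum>i<dA. \<rho>A $$ (i, i)) = (\<Sum>i<dA. \<Sum>k<dA. complex_of_real (l k) * (cnj (u k i) * u k i))"
        using sA by (intro sum.cong refl) (simp add: spectral_decomp_def mult_ac)
      also have "\<dots> = (\<Sum>k<dA. \<Sum>i<dA. complex_of_real (l k) * (cnj (u k i) * u k i))" by (rule sum.swap)
      finally show ?thesis by (simp only: sum_distrib_left)
    qed
    also have "\<dots> = (\<Sum>i<dA. \<Sum>b<dB. \<phi> $ (i * dB + b) * cnj (\<phi> $ (i * dB + b)))"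
      by (intro sum.cong refl) (simp add: A(2) T_def)
    also have "\<dots> = \<phi> \<bullet>c \<phi>"
    proof -
      have "\<phi> \<bullet>c \<phi> = (\<Sum>i<dA * dB. \<phi> $ i * cnj (\<phi> $ i))"
        using assms(2) by (simp add: scalar_prod_def atLeast0LessThan)
      then show ?thesis by (simp only: sum_lessThan_mult)
    qed
    finally show "(\<Sum>m<dA. l m) = 1" unfolding assms(3) of_real_eq_1_iff .
  qed (rule d)
  interpret dc_setting dA l dB "\<lambda>n s a. \<Prod>k<n. u (digit dA k s) (digit dA k a)"
    "\<lambda>n s b. \<Prod>k<n. \<beta> (digit dA k s) (digit dB k b)" "\<lambda>n i. \<Prod>k<n. \<phi> $ pair_digit dA dB n k i" "pure_state \<phi>"
  proof (intro dc_setting.intro dc_setting_axioms.intro p)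
    fix n
    show "bipartite_tensor_power dA dB n (pure_state \<phi>)
      = rank_one (dA ^ n * dB ^ n) (\<lambda>i. \<Prod>k<n. \<phi> $ pair_digit dA dB n k i)"
      by (rule bipartite_tensor_power_pure[OF assms(2) d])
    show "schmidt_state (dA ^ n) (dB ^ n) (\<lambda>s a. \<Prod>k<n. u (digit dA k s) (digit dA k a))
      (\<lambda>s b. \<Prod>k<n. \<beta> (digit dA k s) (digit dB k b)) (seq_prob dA l n) (\<lambda>i. \<Prod>k<n. \<phi> $ pair_digit dA dB n k i)"
      by (rule schmidt_state_power[OF d p sA T \<beta>]) (simp_all add: pair_digit_index T_def)
  qed
  have "shannon b = vn_entropy b \<rho>A" by (simp add: shannon_def eA)
  then show ?thesis using dc_capacity_eq[OF assms(1)] eq by simp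
qed

end
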